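(* Let $n\geq 2$. There exists a constant $C_n>0$ depending only on $n$ such that, for every smooth, bounded domain $\Omega\subset\mathbb R^n$ and every integer $k\geq 1$, $$|\partial\Omega|^{\frac{1}{n-1}}\,\sigma_k(\Omega)\leq C_n\, k^{\frac{1}{n-1}+\frac{n-2}{n(n-1)^2}}.$$
   Context: A domain is a connected open set; $|\partial\Omega|$ denotes the $(n-1)$-dimensional measure of the boundary of $\Omega$. The Steklov eigenvalues of a smooth, bounded domain $\Omega\subset\mathbb R^n$ are the numbers $\sigma$ for which the problem $$\sum_{i=1}^n\partial_{ii}^2u=0 \text{ in }\Omega,\qquad \partial_N u=\sigma u\text{ on }\partial\Omega$$ ($N$ the outer unit normal) has a nontrivial solution; they form a sequence, repeated according to multiplicity, indexed starting from $1$: $$0=\sigma_1(\Omega)<\sigma_2(\Omega)\leq\cdots\leq\sigma_k(\Omega)\leq\cdots\nearrow+\infty .$$ Equivalently, $$\sigma_k(\Omega)=\min_{\substack{V\subset H^1(\Omega)\\ \dim V=k}}\ \max_{0\neq\phi\in V}\frac{\int_\Omega|\nabla\phi|^2}{\int_{\partial\Omega}\phi^2},$$ where the quotient is understood as $+\infty$ when the trace of $\phi\ne0$ on $\partial\Omega$ vanishes. *)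

theory Defs
  imports "HOL-Analysis.Analysis"
begin

subsection \<open>Smooth functions and smooth bounded domains\<close>

text \<open>The set \<open>U\<close> is meant to be open; \<open>g\<close> is the gradient of \<open>f\<close> on \<open>U\<close>.\<close>

fun Ck_on :: "nat \<Rightarrow> 'a::euclidean_space set \<Rightarrow> ('a \<Rightarrow> real) \<Rightarrow> bool" where
  "Ck_on 0 U f \<longleftrightarrow> continuous_on U f"
| "Ck_on (Suc k) U f \<longleftrightarrow>
     (\<exists>g. (\<forall>x\<in>U. GDERIV f x :> g x) \<and> (\<forall>i\<in>Basis. Ck_on k U (\<lambda>x. g x \<bullet> i)))"

definition smooth_on :: "'a::euclidean_space set \<Rightarrow> ('a \<Rightarrow> real) \<Rightarrow> bool" where
  "smooth_on U f \<longleftrightarrow> (\<forall>k. Ck_on k U f)"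

text \<open>
  Smoothness of the boundary is expressed by local defining functions: near each boundary point
  \<open>p\<close>, the domain is the sublevel set \<open>\<rho> < 0\<close> of a smooth function \<open>\<rho>\<close> with nonzero gradient
  at \<open>p\<close>. By continuity \<open>\<rho> p = 0\<close>, so (implicit function theorem) \<open>\<Omega>\<close> lies locally on one side
  of a smooth hypersurface.
\<close>

definition smooth_bounded_domain :: "'a::euclidean_space set \<Rightarrow> bool" where
  "smooth_bounded_domain \<Omega> \<longleftrightarrow>
     open \<Omega> \<and> connected \<Omega> \<and> \<Omega> \<noteq> {} \<and> bounded \<Omega> \<and>
     (\<forall>p\<in>frontier \<Omega>. \<exists>U \<rho> d. open U \<and> p \<in> U \<and> smooth_on U \<rho> \<and>
        (GDERIV \<rho> p :> d) \<and> d \<noteq> 0 \<and> \<Omega> \<inter> U = {x\<in>U. \<rho> x < 0})"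

subsection \<open>Hausdorff measure and the boundary measure\<close>

text \<open>
  Normalised so that in dimension \<open>s\<close> it agrees with Lebesgue measure and on smooth
  \<open>s\<close>-dimensional submanifolds with the surface measure. Boundedness of the covering sets has to be
  required explicitly, since \<^const>\<open>diameter\<close> is only meaningful for bounded sets. Borel sets are
  Caratheodory measurable for \<open>hausdorff_outer s\<close> (a metric outer measure), so that
  \<^const>\<open>measure_of\<close> yields its restriction to the Borel sets.
\<close>

definition hausdorff_pre :: "nat \<Rightarrow> real \<Rightarrow> 'a::metric_space set \<Rightarrow> ennreal" where
  "hausdorff_pre s \<delta> A =
     (INF U\<in>{U :: nat \<Rightarrow> 'a set. A \<subseteq> (\<Union>i. U i) \<and> (\<forall>i. bounded (U i) \<and> diameter (U i) \<le> \<delta>)}.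
        (\<Sum>i. if U i = {} then 0
              else ennreal (unit_ball_vol (real s) * (diameter (U i) / 2) ^ s)))"

definition hausdorff_outer :: "nat \<Rightarrow> 'a::metric_space set \<Rightarrow> ennreal" where
  "hausdorff_outer s A = (SUP \<delta>\<in>{0<..}. hausdorff_pre s \<delta> A)"

definition hausdorff_measure :: "nat \<Rightarrow> 'a::metric_space measure" where
  "hausdorff_measure s = measure_of UNIV (sets borel) (hausdorff_outer s)"

definition boundary_measure :: "'a::euclidean_space set \<Rightarrow> 'a measure" where
  "boundary_measure \<Omega> = restrict_space (hausdorff_measure (DIM('a) - 1)) (frontier \<Omega>)"

subsection \<open>The Sobolev space $H^1$ and the trace\<close>

definition square_integrable :: "'a measure \<Rightarrow> ('a \<Rightarrow> 'b::euclidean_space) \<Rightarrow> bool" where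
  "square_integrable M f \<longleftrightarrow> f \<in> borel_measurable M \<and> integrable M (\<lambda>x. (norm (f x))\<^sup>2)"

definition L2_tendsto ::
    "'a measure \<Rightarrow> (nat \<Rightarrow> 'a \<Rightarrow> 'b::euclidean_space) \<Rightarrow> ('a \<Rightarrow> 'b) \<Rightarrow> bool" where
  "L2_tendsto M f l \<longleftrightarrow>
     (\<lambda>m. \<integral>\<^sup>+x. ennreal ((norm (f m x - l x))\<^sup>2) \<partial>M) \<longlonglongrightarrow> 0"

definition test_function :: "'a::euclidean_space set \<Rightarrow> ('a \<Rightarrow> real) \<Rightarrow> bool" where
  "test_function \<Omega> \<psi> \<longleftrightarrow>
     smooth_on UNIV \<psi> \<and> (\<exists>K. compact K \<and> K \<subseteq> \<Omega> \<and> (\<forall>x. x \<notin> K \<longrightarrow> \<psi> x = 0))"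

text \<open>
  \<open>H1_grad \<Omega> u g\<close>: \<open>u\<close> represents an element of \<open>H\<^sup>1(\<Omega>)\<close>, and \<open>g\<close> its weak gradient.
  Elements of \<open>H\<^sup>1(\<Omega>)\<close> are represented by functions on the whole space, of which only the
  a.e. class on \<open>\<Omega>\<close> matters.
\<close>

definition H1_grad :: "'a::euclidean_space set \<Rightarrow> ('a \<Rightarrow> real) \<Rightarrow> ('a \<Rightarrow> 'a) \<Rightarrow> bool" where
  "H1_grad \<Omega> u g \<longleftrightarrow>
     square_integrable (lebesgue_on \<Omega>) u \<and> square_integrable (lebesgue_on \<Omega>) g \<and>
     (\<forall>\<psi> d. test_function \<Omega> \<psi> \<and> (\<forall>x. GDERIV \<psi> x :> d x) \<longrightarrow>
        (\<integral>x. u x *\<^sub>R d x \<partial>lebesgue_on \<Omega>) = - (\<integral>x. \<psi> x *\<^sub>R g x \<partial>lebesgue_on \<Omega>))"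

text \<open>
  The trace is the continuous extension to \<open>H\<^sup>1(\<Omega>)\<close>, with values in \<open>L\<^sup>2(\<partial>\<Omega>)\<close>, of the restriction
  map \<open>v \<mapsto> v|\<^bsub>\<partial>\<Omega>\<^esub>\<close> on functions of \<open>H\<^sup>1(\<Omega>)\<close> that are continuous up to the boundary. It is given
  as a relation between representatives; for smooth bounded \<open>\<Omega>\<close>, every \<open>u\<close> in \<open>H\<^sup>1(\<Omega>)\<close> has a
  trace \<open>t\<close>, unique up to equality a.e. on \<open>\<partial>\<Omega>\<close>.
\<close>

definition has_trace :: "'a::euclidean_space set \<Rightarrow> ('a \<Rightarrow> real) \<Rightarrow> ('a \<Rightarrow> real) \<Rightarrow> bool" where
  "has_trace \<Omega> u t \<longleftrightarrow>
     square_integrable (boundary_measure \<Omega>) t \<and>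
     (\<exists>g v w. H1_grad \<Omega> u g \<and>
        (\<forall>m. H1_grad \<Omega> (v m) (w m) \<and> continuous_on (closure \<Omega>) (v m)) \<and>
        L2_tendsto (lebesgue_on \<Omega>) v u \<and> L2_tendsto (lebesgue_on \<Omega>) w g \<and>
        L2_tendsto (boundary_measure \<Omega>) v t)"

subsection \<open>Steklov eigenvalues\<close>

text \<open>
  The Rayleigh quotient of a function with weak gradient \<open>g\<close> and trace \<open>t\<close>; it is \<open>\<infinity>\<close> when the
  trace vanishes (in \<^typ>\<open>ennreal\<close>, plain division would give \<open>0 / 0 = 0\<close>).
\<close>

definition steklov_quotient ::
    "'a::euclidean_space set \<Rightarrow> ('a \<Rightarrow> 'a) \<Rightarrow> ('a \<Rightarrow> real) \<Rightarrow> ennreal" where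
  "steklov_quotient \<Omega> g t =
     (let D = (\<integral>\<^sup>+x. ennreal ((norm (g x))\<^sup>2) \<partial>lebesgue_on \<Omega>);
          B = (\<integral>\<^sup>+x. ennreal ((t x)\<^sup>2) \<partial>boundary_measure \<Omega>)
      in if B = 0 then \<infinity> else D / B)"

text \<open>
  Bases of \<open>k\<close>-dimensional subspaces \<open>V\<close> of \<open>H\<^sup>1(\<Omega>)\<close>: linear independence is that of a.e. classes.
  The basis functions \<open>\<phi> i\<close> come with their weak gradients \<open>g i\<close> and traces \<open>t i\<close>.
\<close>

definition H1_bases ::
    "'a::euclidean_space set \<Rightarrow> nat \<Rightarrow>
     ((nat \<Rightarrow> 'a \<Rightarrow> real) \<times> (nat \<Rightarrow> 'a \<Rightarrow> 'a) \<times> (nat \<Rightarrow> 'a \<Rightarrow> real)) set" where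
  "H1_bases \<Omega> k =
     {(\<phi>, g, t). (\<forall>i<k. H1_grad \<Omega> (\<phi> i) (g i) \<and> has_trace \<Omega> (\<phi> i) (t i)) \<and>
        (\<forall>c. (AE x in lebesgue_on \<Omega>. (\<Sum>i<k. c i * \<phi> i x) = 0) \<longrightarrow> (\<forall>i<k. c i = 0))}"

text \<open>
  The \<open>k\<close>-th Steklov eigenvalue (counted from 1, with multiplicity), as the minimum over all
  \<open>k\<close>-dimensional \<open>V\<close> of the maximum of the Rayleigh quotient over the nonzero elements of \<open>V\<close>.
  The latter are the combinations \<open>\<Sum>i<k. c i * \<phi> i\<close> of a basis with \<open>c\<close> not zero on \<open>{..<k}\<close>,
  whose gradients and traces are the corresponding combinations of the \<open>g i\<close> and \<open>t i\<close>.
\<close>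

definition steklov_eigenvalue :: "'a::euclidean_space set \<Rightarrow> nat \<Rightarrow> ennreal" where
  "steklov_eigenvalue \<Omega> k =
     (INF (\<phi>, g, t)\<in>H1_bases \<Omega> k. SUP c\<in>{c :: nat \<Rightarrow> real. \<exists>i<k. c i \<noteq> 0}.
        steklov_quotient \<Omega> (\<lambda>x. \<Sum>i<k. c i *\<^sub>R g i x) (\<lambda>x. \<Sum>i<k. c i * t i x))"

end

theory Submission
  imports Defs
begin

text \<open>
  Write \<open>n\<close> for the dimension, \<open>M = |\<partial>\<Omega>|\<close>, \<open>V = |\<Omega>|\<close> and \<open>L = V\<^bsup>1/n\<^esup>\<close>. The bound
  interpolates between two estimates, each obtained from \<open>k\<close> test functions with disjoint supports.

  The first is \<open>\<sigma>\<^sub>k \<le> C k\<^bsup>2/n\<^esup> L\<^bsup>n-2\<^esup> / M\<close>. Balls carrying boundary mass at least \<open>v\<close>, with \<open>v\<close>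
  comparable to \<open>M / k\<close>, are chosen successively with almost minimal radius, always after deleting the
  doubles of the previous ones. The test functions are cutoffs of these balls that vanish near the
  previous balls. Since the supports are disjoint, the total squared gradient at a point is controlled
  by \<open>1 / r\<^sup>2\<close> for the smallest radius \<open>r\<close> of a relevant ball; it exceeds \<open>1 / \<rho>\<^sup>2\<close> only on
  balls of radius \<open>r < \<rho>\<close>, each of which contributes \<open>r\<^bsup>n-2\<^esup>\<close>, and \<open>\<rho> = (V / k)\<^bsup>1/n\<^esup>\<close> balances the two parts.

  The second is \<open>\<sigma>\<^sub>k \<le> C / r\<close> with \<open>r\<close> comparable to \<open>L k\<^bsup>-1/(n-1)\<^esup>\<close>, valid if \<open>r M \<le> c V\<close>. The
  set of points around which \<open>\<Omega>\<close> has density at least one half at scale \<open>r\<close> then has volume comparable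
  to \<open>V\<close>, and by the relative isoperimetric inequality each point of its boundary is near boundary of
  \<open>\<Omega>\<close> of area \<open>c r\<^bsup>n-1\<^esup>\<close>. By the isoperimetric inequality this set needs many balls of radius
  comparable to \<open>r\<close> to cover its boundary, so \<open>k\<close> disjoint ones can be chosen.

  Both isoperimetric inequalities follow from one projection argument: a path from \<open>x\<close> to \<open>x + z\<close> along
  the coordinate axes that leaves a set meets its boundary, so \<open>x\<close> lies in a box erected over a covering of
  the boundary. The two estimates are compared at \<open>M = k\<^bsup>(n-2)/(n(n-1))\<^esup> L\<^bsup>n-1\<^esup>\<close>.
\<close>

subsection \<open>Continuously differentiable functions in $H^1$\<close>

lemma gderiv_zero_outside_support:
  fixes h :: "'a::euclidean_space \<Rightarrow> real"
  assumes der: "GDERIV h x :> d" and K: "compact K" and hK: "\<And>x. x \<notin> K \<Longrightarrow> h x = 0" and x: "x \<notin> K"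
  shows "d = 0"
proof -
  have hder: "(h has_derivative (\<lambda>v. v \<bullet> d)) (at x)"
    using der by (simp add: gderiv_def inner_commute)
  have "open (- K)" using K by (simp add: compact_imp_closed open_Compl)
  then have "((\<lambda>_. 0) has_derivative (\<lambda>v. v \<bullet> d)) (at x)"
    using has_derivative_transform_within_open[OF hder, of "- K" "\<lambda>_. 0"] x hK by auto
  then have "(\<lambda>v. v \<bullet> d) = (\<lambda>v. 0)"
    using has_derivative_const has_derivative_unique by blast
  then have "d \<bullet> d = 0" by metis
  then show ?thesis by simp
qed

lemma gderiv_continuous:
  fixes h :: "'a::euclidean_space \<Rightarrow> real"
  assumes "\<And>x. GDERIV h x :> g x"
  shows "continuous_on S h"
  using assms by (metis continuous_at_imp_continuous_on gderiv_def has_derivative_continuous)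

text \<open>By translation invariance every difference quotient of \<open>h\<close> in the direction
  \<open>b\<close> has integral zero. The quotients converge pointwise to
  \<open>g x \<bullet> b\<close>, and dominated convergence passes to the limit.\<close>

lemma integral_directional_derivative_compact_support:
  fixes h :: "'a::euclidean_space \<Rightarrow> real"
  assumes der: "\<And>x. GDERIV h x :> g x" and cont: "continuous_on UNIV g"
    and K: "compact K" and hK: "\<And>x. x \<notin> K \<Longrightarrow> h x = 0"
  shows "(\<integral>x. g x \<bullet> b \<partial>lborel) = 0"
proof -
  obtain R where R: "R > 0" "\<And>x. x \<in> K \<Longrightarrow> norm x \<le> R"
    using compact_imp_bounded[OF K] by (auto simp: bounded_pos)
  define K' where "K' = cball (0::'a) (R + norm b)"
  have hder: "(h has_derivative (\<lambda>v. v \<bullet> g x)) (at x)" for x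
    using der[of x] by (simp add: gderiv_def inner_commute)
  have hc: "continuous_on UNIV h" using gderiv_continuous[OF der] .
  have [measurable]: "h \<in> borel_measurable borel"
    using hc by (simp add: borel_measurable_continuous_onI)
  have g0: "g x = 0" if "x \<notin> K" for x
    using gderiv_zero_outside_support[OF der K hK that] .
  obtain B where B: "B > 0" "\<And>x. x \<in> K \<Longrightarrow> norm (g x) \<le> B"
    using compact_imp_bounded[OF compact_continuous_image[OF continuous_on_subset[OF cont subset_UNIV] K]]
    by (auto simp: bounded_pos)
  then have B': "norm (g x) \<le> B" for x using g0[of x] by (cases "x \<in> K") auto
  have lip: "\<bar>h y - h x\<bar> \<le> B * norm (y - x)" for x y
  proof -
    have on: "onorm (\<lambda>v. v \<bullet> g z) \<le> B" for z
    proof (rule onorm_bound)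
      fix v
      have "\<bar>v \<bullet> g z\<bar> \<le> norm v * norm (g z)" by (rule Cauchy_Schwarz_ineq2)
      also have "\<dots> \<le> norm v * B" using B' by (intro mult_left_mono) auto
      finally show "norm (v \<bullet> g z) \<le> B * norm v" by (simp add: mult.commute)
    qed (use B in simp)
    show ?thesis
      using differentiable_bound[of UNIV h "\<lambda>x v. v \<bullet> g x" B y x] hder on by auto
  qed
  define e where "e m = inverse (real (Suc m))" for m
  have e: "e m > 0" "e m \<le> 1" for m by (auto simp: e_def field_simps)
  have elim: "e \<longlonglongrightarrow> 0" unfolding e_def by (rule LIMSEQ_inverse_real_of_nat)
  define q where "q m x = (h (x + e m *\<^sub>R b) - h x) / e m" for m x
  \<comment> \<open>The steps \<open>e m\<close> are at most 1, so all quotients vanish outside the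
    enlarged ball \<open>K'\<close>, and the Lipschitz bound \<open>B\<close> makes \<open>w\<close>
    an integrable majorant.\<close>
  define w where "w x = B * norm b * indicator K' x" for x
  have wi: "integrable lborel w" unfolding w_def K'_def
    by (intro integrable_mult_right integrable_real_indicator) (use emeasure_bounded_finite[OF bounded_cball[of "0::'a" "R + norm b"]] in \<open>simp_all add: top.not_eq_extremum\<close>)
  have qw: "norm (q m x) \<le> w x" for m x
  proof (cases "x \<in> K'")
    case True
    have "\<bar>h (x + e m *\<^sub>R b) - h x\<bar> \<le> B * (e m * norm b)"
      using lip[of "x + e m *\<^sub>R b" x] e[of m] by simp
    then show ?thesis using True e[of m] by (simp add: q_def w_def field_simps)
  next
    case False
    then have nx: "norm x > R + norm b" by (simp add: K'_def)
    have "norm x \<le> norm (x + e m *\<^sub>R b) + norm (e m *\<^sub>R b)"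
      using norm_triangle_ineq4[of "x + e m *\<^sub>R b" "e m *\<^sub>R b"] by simp
    moreover have "norm (e m *\<^sub>R b) \<le> norm b" using e[of m] by (simp add: mult_left_le_one_le)
    ultimately have "x \<notin> K" "x + e m *\<^sub>R b \<notin> K" using R nx norm_ge_zero[of b] by (smt (verit))+
    then show ?thesis using hK False by (simp add: q_def w_def)
  qed
  have hi: "integrable lborel h"
  proof -
    have "integrable lborel (\<lambda>x. indicator K x *\<^sub>R h x)"
      by (rule borel_integrable_compact[OF K]) (rule continuous_on_subset[OF hc subset_UNIV])
    moreover have "(\<lambda>x. indicator K x *\<^sub>R h x) = h"
    proof
      show "indicator K x *\<^sub>R h x = h x" for x by (cases "x \<in> K") (auto simp: hK)
    qed
    ultimately show ?thesis by simp
  qed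
  have tr: "integrable lborel (\<lambda>x. h (x + c))" "(\<integral>x. h (x + c) \<partial>lborel) = (\<integral>x. h x \<partial>lborel)" for c
  proof -
    have d: "lborel = distr lborel borel (\<lambda>x. c + x)" by (rule lborel_distr_plus[symmetric])
    have "integrable (distr lborel borel (\<lambda>x. c + x)) h" using d hi by simp
    then have "integrable lborel (\<lambda>x. h (c + x))" by (subst (asm) integrable_distr_eq) auto
    then show "integrable lborel (\<lambda>x. h (x + c))" by (simp add: add.commute)
    have "(\<integral>x. h x \<partial>lborel) = (\<integral>x. h x \<partial>distr lborel borel (\<lambda>x. c + x))" using d by simp
    also have "\<dots> = (\<integral>x. h (c + x) \<partial>lborel)" by (rule integral_distr) auto
    finally show "(\<integral>x. h (x + c) \<partial>lborel) = (\<integral>x. h x \<partial>lborel)" by (simp add: add.commute)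
  qed
  have q0: "(\<integral>x. q m x \<partial>lborel) = 0" for m
    unfolding q_def using tr hi by simp
  have lim: "(\<lambda>m. q m x) \<longlonglongrightarrow> g x \<bullet> b" for x
  proof -
    have "((\<lambda>t. h (x + t *\<^sub>R b)) has_derivative (\<lambda>t. (t *\<^sub>R b) \<bullet> g x)) (at 0)"
      by (rule has_derivative_compose[of "\<lambda>t. x + t *\<^sub>R b" "\<lambda>t. t *\<^sub>R b" 0 UNIV h "\<lambda>v. v \<bullet> g x"])
        (use hder[of x] in \<open>auto intro!: derivative_eq_intros\<close>)
    then have "((\<lambda>t. h (x + t *\<^sub>R b)) has_real_derivative g x \<bullet> b) (at 0)"
      by (rule has_derivative_imp_has_field_derivative) (simp add: inner_commute)
    then have "((\<lambda>t. (h (x + t *\<^sub>R b) - h x) / t) \<longlongrightarrow> g x \<bullet> b) (at 0)"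
      by (simp add: has_field_derivative_iff)
    then have "((\<lambda>t. (h (x + t *\<^sub>R b) - h x) / t) \<circ> e) \<longlonglongrightarrow> g x \<bullet> b"
      unfolding tendsto_at_iff_sequentially using elim e(1) by (auto simp: less_imp_neq[symmetric])
    then show ?thesis by (simp add: q_def comp_def)
  qed
  have "(\<lambda>m. \<integral>x. q m x \<partial>lborel) \<longlonglongrightarrow> (\<integral>x. g x \<bullet> b \<partial>lborel)"
  proof (rule integral_dominated_convergence[OF _ _ wi])
    show "(\<lambda>x. g x \<bullet> b) \<in> borel_measurable lborel"
      using cont by (simp add: borel_measurable_continuous_onI continuous_intros)
    show "q m \<in> borel_measurable lborel" for m unfolding q_def by measurable
  qed (use lim qw in auto)
  then show ?thesis by (simp add: q0 LIMSEQ_const_iff)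
qed

text \<open>\<open>Ck_on\<close> only asserts that some gradient has continuous components;
  uniqueness of the derivative identifies it with the given \<open>d\<close>.\<close>

lemma test_function_gradient_continuous:
  assumes "test_function \<Omega> \<psi>" and d: "\<forall>x. GDERIV \<psi> x :> d x"
  shows "continuous_on UNIV d"
proof -
  have "Ck_on (Suc 0) UNIV \<psi>"
    using assms(1) unfolding test_function_def smooth_on_def by blast
  then obtain g where g: "\<And>x. GDERIV \<psi> x :> g x" "\<And>i. i \<in> Basis \<Longrightarrow> continuous_on UNIV (\<lambda>x. g x \<bullet> i)"
    by auto
  have "g = d"
  proof
    fix x
    have "(\<lambda>v. v \<bullet> g x) = (\<lambda>v. v \<bullet> d x)"
      using has_derivative_unique[OF g(1)[of x, unfolded gderiv_def] d[rule_format, of x, unfolded gderiv_def]] .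
    then show "g x = d x" by (metis vector_eq_ldot)
  qed
  then show ?thesis using g(2) continuous_on_componentwise by blast
qed

lemma square_integrable_lebesgue_on:
  fixes g :: "'a::euclidean_space \<Rightarrow> 'b::euclidean_space"
  assumes "open \<Omega>" "bounded \<Omega>" and cont: "continuous_on UNIV g"
  shows "square_integrable (lebesgue_on \<Omega>) g"
proof -
  have m: "\<Omega> \<in> sets lebesgue" using assms by auto
  have lm: "\<Omega> \<in> lmeasurable" using assms by (simp add: lmeasurable_open)
  have gm: "g \<in> borel_measurable (lebesgue_on \<Omega>)"
    using continuous_imp_measurable_on_sets_lebesgue[OF continuous_on_subset[OF cont subset_UNIV] m] .
  obtain B where B: "\<And>x. x \<in> closure \<Omega> \<Longrightarrow> norm (g x) \<le> B"
    using compact_imp_bounded[OF compact_continuous_image[OF continuous_on_subset[OF cont subset_UNIV]],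
      of "closure \<Omega>"] assms by (auto simp: bounded_iff compact_closure)
  have fin: "finite_measure (lebesgue_on \<Omega>)" using lm
    by (simp add: finite_measure_lebesgue_on)
  have "integrable (lebesgue_on \<Omega>) (\<lambda>x. (norm (g x))\<^sup>2)"
  proof (rule finite_measure.integrable_const_bound[OF fin, where B = "B\<^sup>2"])
    show "AE x in lebesgue_on \<Omega>. norm ((norm (g x))\<^sup>2) \<le> B\<^sup>2"
      using B closure_subset by (intro AE_I2) (fastforce simp: space_restrict_space intro: power_mono)
  qed (use gm in measurable)
  then show ?thesis using gm by (simp add: square_integrable_def)
qed

text \<open>The product \<open>u * \<psi>\<close> has compact support and gradient
  \<open>u d + \<psi> g\<close>, so the integral of this gradient vanishes. This is the defining
  identity of the weak gradient.\<close>

lemma H1_grad_C1: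
  fixes u :: "'a::euclidean_space \<Rightarrow> real"
  assumes "open \<Omega>" "bounded \<Omega>" and der: "\<And>x. GDERIV u x :> g x" and cont: "continuous_on UNIV g"
  shows "H1_grad \<Omega> u g"
  unfolding H1_grad_def
proof (intro conjI allI impI)
  show "square_integrable (lebesgue_on \<Omega>) u" "square_integrable (lebesgue_on \<Omega>) g"
    using square_integrable_lebesgue_on assms gderiv_continuous[OF der] by blast+
  fix \<psi> d assume "test_function \<Omega> \<psi> \<and> (\<forall>x. GDERIV \<psi> x :> d x)"
  then have tf: "test_function \<Omega> \<psi>" and d: "\<And>x. GDERIV \<psi> x :> d x" by auto
  have dc: "continuous_on UNIV d" using test_function_gradient_continuous tf d by blast
  have uc: "continuous_on UNIV u" and pc: "continuous_on UNIV \<psi>"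
    using gderiv_continuous der d by blast+
  obtain K where K: "compact K" "K \<subseteq> \<Omega>" "\<And>x. x \<notin> K \<Longrightarrow> \<psi> x = 0"
    using tf by (auto simp: test_function_def)
  have d0: "d x = 0" if "x \<notin> K" for x
    using gderiv_zero_outside_support[OF d K(1) K(3) that] .
  \<comment> \<open>Both integrands vanish off the compact set
    \<open>K \<subseteq> \<Omega>\<close>, so integrals over \<open>\<Omega>\<close> may be taken
    over the whole space, where the previous lemma applies.\<close>
  have red: "integrable lborel f \<and> (\<integral>x. f x \<partial>lebesgue_on \<Omega>) = (\<integral>x. f x \<partial>lborel)"
    if c: "continuous_on UNIV f" and z: "\<And>x. x \<notin> K \<Longrightarrow> f x = 0" for f :: "'a \<Rightarrow> 'a"
  proof
    have "integrable lborel (\<lambda>x. indicator K x *\<^sub>R f x)"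
      by (rule borel_integrable_compact[OF K(1)]) (rule continuous_on_subset[OF c subset_UNIV])
    moreover have eq: "(\<lambda>x. indicator K x *\<^sub>R f x) = f"
    proof
      show "indicator K x *\<^sub>R f x = f x" for x by (cases "x \<in> K") (auto simp: z)
    qed
    ultimately show "integrable lborel f" by simp
    have "(\<integral>x. f x \<partial>lebesgue_on \<Omega>) = (\<integral>x. indicator \<Omega> x *\<^sub>R f x \<partial>lebesgue)"
      using assms(1) by (subst integral_restrict_space) auto
    also have "(\<lambda>x. indicator \<Omega> x *\<^sub>R f x) = f"
    proof
      show "indicator \<Omega> x *\<^sub>R f x = f x" for x using K(2) by (cases "x \<in> K") (auto simp: z)
    qed
    also have "(\<integral>x. f x \<partial>lebesgue) = (\<integral>x. f x \<partial>lborel)"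
      by (rule integral_completion) (use c in \<open>simp add: borel_measurable_continuous_onI\<close>)
    finally show "(\<integral>x. f x \<partial>lebesgue_on \<Omega>) = (\<integral>x. f x \<partial>lborel)" .
  qed
  have r1: "integrable lborel (\<lambda>x. u x *\<^sub>R d x)"
     "(\<integral>x. u x *\<^sub>R d x \<partial>lebesgue_on \<Omega>) = (\<integral>x. u x *\<^sub>R d x \<partial>lborel)"
    using red[of "\<lambda>x. u x *\<^sub>R d x"] d0 uc dc by (auto intro: continuous_intros)
  have r2: "integrable lborel (\<lambda>x. \<psi> x *\<^sub>R g x)"
     "(\<integral>x. \<psi> x *\<^sub>R g x \<partial>lebesgue_on \<Omega>) = (\<integral>x. \<psi> x *\<^sub>R g x \<partial>lborel)"
    using red[of "\<lambda>x. \<psi> x *\<^sub>R g x"] K(3) pc cont by (auto intro: continuous_intros)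
  have hd: "GDERIV (\<lambda>x. u x * \<psi> x) x :> (u x *\<^sub>R d x + \<psi> x *\<^sub>R g x)" for x
    using GDERIV_mult[OF der[of x] d[of x]] .
  have cd: "continuous_on UNIV (\<lambda>x. u x *\<^sub>R d x + \<psi> x *\<^sub>R g x)"
    by (intro continuous_intros uc dc pc cont)
  have "(\<integral>x. u x *\<^sub>R d x + \<psi> x *\<^sub>R g x \<partial>lborel) \<bullet> b = 0" for b
    using integral_directional_derivative_compact_support[OF hd cd K(1), of b] K(3) r1(1) r2(1)
    by (subst integral_inner_left[symmetric]) auto
  then have "(\<integral>x. u x *\<^sub>R d x + \<psi> x *\<^sub>R g x \<partial>lborel) = 0" by (metis inner_eq_zero_iff)
  then have "(\<integral>x. u x *\<^sub>R d x \<partial>lborel) + (\<integral>x. \<psi> x *\<^sub>R g x \<partial>lborel) = 0"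
    using r1 r2 by simp
  then show "(\<integral>x. u x *\<^sub>R d x \<partial>lebesgue_on \<Omega>) = - (\<integral>x. \<psi> x *\<^sub>R g x \<partial>lebesgue_on \<Omega>)"
    using r1(2) r2(2) by (simp add: eq_neg_iff_add_eq_0)
qed

section \<open>The boundary measure and traces of continuously differentiable functions\<close>

lemma sets_boundary_measure:
  "sets (boundary_measure \<Omega>) = (\<inter>) (frontier \<Omega>) ` sets borel"
  "space (boundary_measure \<Omega>) = frontier \<Omega>"
proof -
  have "sets (hausdorff_measure s :: 'a measure) = sets borel" for s
    unfolding hausdorff_measure_def
    by (simp add: sets_measure_of_conv sets.sigma_sets_eq[of borel, simplified])
  then show "sets (boundary_measure \<Omega>) = (\<inter>) (frontier \<Omega>) ` sets borel"
    by (simp add: boundary_measure_def sets_restrict_space)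
  show "space (boundary_measure \<Omega>) = frontier \<Omega>"
    by (simp add: boundary_measure_def hausdorff_measure_def space_restrict_space space_measure_of_conv)
qed

lemma square_integrable_boundary:
  fixes t :: "'a::euclidean_space \<Rightarrow> real"
  assumes "bounded \<Omega>" and fin: "finite_measure (boundary_measure \<Omega>)" and cont: "continuous_on UNIV t"
  shows "square_integrable (boundary_measure \<Omega>) t"
proof -
  note sp = sets_boundary_measure(2)[of \<Omega>]
  have tm: "t \<in> borel_measurable (boundary_measure \<Omega>)"
  proof -
    have "t \<in> borel_measurable borel" using cont by (simp add: borel_measurable_continuous_onI)
    moreover have "sets (hausdorff_measure (DIM('a) - 1) :: 'a measure) = sets borel"
      unfolding hausdorff_measure_def by (simp add: sets_measure_of_conv sets.sigma_sets_eq[of borel, simplified])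
    ultimately show ?thesis unfolding boundary_measure_def
      by (intro measurable_restrict_space1) (simp cong: measurable_cong_sets)
  qed
  obtain B where B: "\<And>x. x \<in> frontier \<Omega> \<Longrightarrow> norm (t x) \<le> B"
    using compact_imp_bounded[OF compact_continuous_image[OF continuous_on_subset[OF cont subset_UNIV]],
      of "frontier \<Omega>"] compact_frontier_bounded[OF assms(1)] by (auto simp: bounded_iff)
  have "integrable (boundary_measure \<Omega>) (\<lambda>x. (norm (t x))\<^sup>2)"
  proof (rule finite_measure.integrable_const_bound[OF fin, where B = "B\<^sup>2"])
    show "AE x in boundary_measure \<Omega>. norm ((norm (t x))\<^sup>2) \<le> B\<^sup>2"
      using B by (intro AE_I2) (fastforce simp: sp abs_le_square_iff[symmetric])
  qed (use tm in measurable)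
  then show ?thesis using tm by (simp add: square_integrable_def)
qed

text \<open>The function is itself continuous up to the boundary, so the constant sequence serves as
  approximation in the definition of the trace.\<close>

lemma has_trace_C1:
  fixes u :: "'a::euclidean_space \<Rightarrow> real"
  assumes "open \<Omega>" "bounded \<Omega>" and der: "\<And>x. GDERIV u x :> g x" and cont: "continuous_on UNIV g"
    and "finite_measure (boundary_measure \<Omega>)"
  shows "has_trace \<Omega> u u"
  unfolding has_trace_def
proof (intro conjI exI)
  show "square_integrable (boundary_measure \<Omega>) u"
    using square_integrable_boundary assms gderiv_continuous[OF der] by blast
  show "H1_grad \<Omega> u g" using H1_grad_C1 assms by blast
  show "\<forall>m. H1_grad \<Omega> u g \<and> continuous_on (closure \<Omega>) u"
    using H1_grad_C1 assms gderiv_continuous[OF der] by blast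
qed (auto simp: L2_tendsto_def)

subsection \<open>Test functions with disjoint supports\<close>

lemma norm_power2_sum_disjoint:
  fixes v :: "nat \<Rightarrow> 'b::real_inner"
  assumes "\<And>i j. i < k \<Longrightarrow> j < k \<Longrightarrow> i \<noteq> j \<Longrightarrow> v i = 0 \<or> v j = 0"
  shows "(norm (\<Sum>i<k. c i *\<^sub>R v i))\<^sup>2 = (\<Sum>i<k. (c i)\<^sup>2 * (norm (v i))\<^sup>2)"
proof (cases "\<exists>i<k. v i \<noteq> 0")
  case True
  then obtain i where i: "i < k" "v i \<noteq> 0" by blast
  then have z: "v j = 0" if "j < k" "j \<noteq> i" for j using assms that by blast
  have "(\<Sum>j<k. c j *\<^sub>R v j) = c i *\<^sub>R v i"
    using i z by (subst sum.remove[of _ i]) auto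
  moreover have "(\<Sum>j<k. (c j)\<^sup>2 * (norm (v j))\<^sup>2) = (c i)\<^sup>2 * (norm (v i))\<^sup>2"
    using i z by (subst sum.remove[of _ i]) auto
  ultimately show ?thesis by (simp add: power_mult_distrib)
qed auto

lemma nn_integral_sum_disjoint:
  fixes v :: "nat \<Rightarrow> 'a \<Rightarrow> 'b::euclidean_space"
  assumes "\<And>i j x. i < k \<Longrightarrow> j < k \<Longrightarrow> i \<noteq> j \<Longrightarrow> v i x = 0 \<or> v j x = 0"
    and meas: "\<And>i. i < k \<Longrightarrow> v i \<in> borel_measurable M"
  shows "(\<integral>\<^sup>+x. ennreal ((norm (\<Sum>i<k. c i *\<^sub>R v i x))\<^sup>2) \<partial>M)
     = (\<Sum>i<k. ennreal ((c i)\<^sup>2) * (\<integral>\<^sup>+x. ennreal ((norm (v i x))\<^sup>2) \<partial>M))"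
proof -
  have "(\<integral>\<^sup>+x. ennreal ((norm (\<Sum>i<k. c i *\<^sub>R v i x))\<^sup>2) \<partial>M)
      = (\<integral>\<^sup>+x. (\<Sum>i<k. ennreal ((c i)\<^sup>2) * ennreal ((norm (v i x))\<^sup>2)) \<partial>M)"
    using assms by (subst norm_power2_sum_disjoint) (auto simp: sum_ennreal[symmetric] ennreal_mult)
  also have "\<dots> = (\<Sum>i<k. \<integral>\<^sup>+x. ennreal ((c i)\<^sup>2) * ennreal ((norm (v i x))\<^sup>2) \<partial>M)"
    using meas by (intro nn_integral_sum) auto
  also have "\<dots> = (\<Sum>i<k. ennreal ((c i)\<^sup>2) * (\<integral>\<^sup>+x. ennreal ((norm (v i x))\<^sup>2) \<partial>M))"
    using meas by (intro sum.cong nn_integral_cmult) auto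
  finally show ?thesis .
qed

text \<open>Disjoint supports make the Dirichlet energy and the boundary norm diagonal quadratic
  forms in the coefficients. A bound for each function then carries over to every linear
  combination, and the span is admissible in the min-max formula.\<close>

lemma steklov_eigenvalue_le_disjoint_supports:
  fixes \<phi> :: "nat \<Rightarrow> 'a::euclidean_space \<Rightarrow> real"
  assumes \<Omega>: "open \<Omega>" "bounded \<Omega>" and fin: "finite_measure (boundary_measure \<Omega>)"
    and der: "\<And>i x. i < k \<Longrightarrow> GDERIV (\<phi> i) x :> g i x"
    and cont: "\<And>i. i < k \<Longrightarrow> continuous_on UNIV (g i)"
    and disj: "\<And>i j x. i < k \<Longrightarrow> j < k \<Longrightarrow> i \<noteq> j \<Longrightarrow> \<phi> i x = 0 \<or> \<phi> j x = 0"
    and gz: "\<And>i x. i < k \<Longrightarrow> \<phi> i x = 0 \<Longrightarrow> g i x = 0"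
    and \<beta>: "\<beta> > 0" "\<And>i. i < k \<Longrightarrow> ennreal \<beta> \<le> (\<integral>\<^sup>+x. ennreal ((\<phi> i x)\<^sup>2) \<partial>boundary_measure \<Omega>)"
    and \<delta>: "\<delta> \<ge> 0" "\<And>i. i < k \<Longrightarrow> (\<integral>\<^sup>+x. ennreal ((norm (g i x))\<^sup>2) \<partial>lebesgue_on \<Omega>) \<le> ennreal \<delta>"
  shows "steklov_eigenvalue \<Omega> k \<le> ennreal (\<delta> / \<beta>)"
proof -
  note sp = sets_boundary_measure(2)[of \<Omega>]
  have pc: "continuous_on UNIV (\<phi> i)" if "i < k" for i
    using gderiv_continuous der that by blast
  have pm: "\<phi> i \<in> borel_measurable (boundary_measure \<Omega>)" if "i < k" for i
    using square_integrable_boundary[OF \<Omega>(2) fin pc[OF that]] by (simp add: square_integrable_def)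
  have gm: "g i \<in> borel_measurable (lebesgue_on \<Omega>)" if "i < k" for i
    using square_integrable_lebesgue_on[OF \<Omega> cont[OF that]] by (simp add: square_integrable_def)
  have indep: "\<forall>i<k. c i = 0" if ae: "AE x in lebesgue_on \<Omega>. (\<Sum>i<k. c i * \<phi> i x) = 0" for c
  proof (intro allI impI, rule ccontr)
    fix i assume i: "i < k" and ci: "c i \<noteq> 0"
    \<comment> \<open>The lower bound \<open>\<beta>\<close> forces \<open>\<phi> i\<close> to be
      nonzero at a boundary point, hence on a nonempty open subset of \<open>\<Omega>\<close>. There
      the combination reduces to \<open>c i * \<phi> i\<close>, so it cannot vanish almost
      everywhere.\<close>
    have "\<exists>x\<in>frontier \<Omega>. \<phi> i x \<noteq> 0"
    proof (rule ccontr)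
      assume "\<not> ?thesis"
      then have "(\<integral>\<^sup>+x. ennreal ((\<phi> i x)\<^sup>2) \<partial>boundary_measure \<Omega>) = (\<integral>\<^sup>+x. 0 \<partial>boundary_measure \<Omega>)"
        by (intro nn_integral_cong) (auto simp: sp)
      then show False using \<beta>(1) \<beta>(2)[OF i] by simp
    qed
    then obtain x0 where x0: "x0 \<in> frontier \<Omega>" "\<phi> i x0 \<noteq> 0" by blast
    define U where "U = {x. \<phi> i x \<noteq> 0}"
    have oU: "open U" unfolding U_def
      using open_Collect_neq[OF pc[OF i] continuous_on_const, of 0] by simp
    have "U \<inter> \<Omega> \<noteq> {}" using x0 oU open_Int_closure_eq_empty[of U \<Omega>]
      by (auto simp: frontier_def U_def)
    moreover have "negligible (U \<inter> \<Omega>)"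
    proof -
      have "AE x in lebesgue. x \<in> \<Omega> \<longrightarrow> (\<Sum>i<k. c i * \<phi> i x) = 0"
        using ae \<Omega>(1) by (subst (asm) AE_restrict_space_iff) auto
      then have "AE x in lebesgue. x \<notin> U \<inter> \<Omega>"
      proof eventually_elim
        case (elim x)
        have "x \<in> U \<Longrightarrow> (\<Sum>j<k. c j * \<phi> j x) = c i * \<phi> i x"
          using i disj[of _ i x] by (subst sum.remove[of _ i]) (auto simp: U_def intro!: sum.neutral)
        then show ?case using elim ci by (auto simp: U_def)
      qed
      then have "U \<inter> \<Omega> \<in> null_sets lebesgue"
        using oU \<Omega>(1) by (subst AE_iff_null_sets) auto
      then show ?thesis by (simp add: negligible_iff_null_sets)
    qed
    ultimately show False using open_not_negligible[of "U \<inter> \<Omega>"] oU \<Omega>(1) by auto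
  qed
  have mem: "(\<phi>, g, \<phi>) \<in> H1_bases \<Omega> k"
    unfolding H1_bases_def
    using H1_grad_C1[OF \<Omega> der cont] has_trace_C1[OF \<Omega> der cont fin] indep by simp
  have "steklov_quotient \<Omega> (\<lambda>x. \<Sum>i<k. c i *\<^sub>R g i x) (\<lambda>x. \<Sum>i<k. c i * \<phi> i x) \<le> ennreal (\<delta> / \<beta>)"
    if c: "\<exists>i<k. c i \<noteq> 0" for c
  proof -
    define C where "C = (\<Sum>i<k. (c i)\<^sup>2)"
    define D where "D = (\<integral>\<^sup>+x. ennreal ((norm (\<Sum>i<k. c i *\<^sub>R g i x))\<^sup>2) \<partial>lebesgue_on \<Omega>)"
    define B where "B = (\<integral>\<^sup>+x. ennreal ((\<Sum>i<k. c i * \<phi> i x)\<^sup>2) \<partial>boundary_measure \<Omega>)"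
    have C: "C > 0" unfolding C_def using c by (auto intro: sum_pos2)
    have "D = (\<Sum>i<k. ennreal ((c i)\<^sup>2) * (\<integral>\<^sup>+x. ennreal ((norm (g i x))\<^sup>2) \<partial>lebesgue_on \<Omega>))"
      unfolding D_def by (rule nn_integral_sum_disjoint) (use disj gz gm in blast)+
    also have "\<dots> \<le> (\<Sum>i<k. ennreal ((c i)\<^sup>2) * ennreal \<delta>)"
      by (intro sum_mono mult_left_mono) (use \<delta> in auto)
    also have "\<dots> = ennreal (C * \<delta>)"
      using \<delta>(1) by (simp add: C_def sum_ennreal ennreal_mult sum_distrib_right[symmetric] sum_nonneg)
    finally have D: "D \<le> ennreal (C * \<delta>)" .
    have "ennreal (C * \<beta>) = (\<Sum>i<k. ennreal ((c i)\<^sup>2) * ennreal \<beta>)"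
      using \<beta>(1) by (simp add: C_def sum_ennreal ennreal_mult sum_distrib_right[symmetric] sum_nonneg)
    also have "\<dots> \<le> (\<Sum>i<k. ennreal ((c i)\<^sup>2) * (\<integral>\<^sup>+x. ennreal ((norm (\<phi> i x))\<^sup>2) \<partial>boundary_measure \<Omega>))"
      by (intro sum_mono mult_left_mono) (use \<beta> in auto)
    also have "\<dots> = B"
      unfolding B_def using nn_integral_sum_disjoint[of k \<phi> "boundary_measure \<Omega>" c] disj pm by simp
    finally have B: "ennreal (C * \<beta>) \<le> B" .
    have "ennreal (C * \<beta>) > 0" using C \<beta>(1) by simp
    then have B0: "B > 0" using B by order
    have "D \<le> ennreal (C * \<beta>) * ennreal (\<delta> / \<beta>)"
      using D C \<beta>(1) \<delta>(1) by (simp add: ennreal_mult[symmetric])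
    also have "\<dots> \<le> B * ennreal (\<delta> / \<beta>)" by (intro mult_right_mono B) simp
    finally have "D / B \<le> ennreal (\<delta> / \<beta>)" using B0 by (intro divide_le_posI_ennreal)
    moreover have "B \<noteq> 0" using B0 by auto
    ultimately show ?thesis by (simp add: steklov_quotient_def Let_def flip: D_def B_def)
  qed
  then have "(SUP c\<in>{c :: nat \<Rightarrow> real. \<exists>i<k. c i \<noteq> 0}.
      steklov_quotient \<Omega> (\<lambda>x. \<Sum>i<k. c i *\<^sub>R g i x) (\<lambda>x. \<Sum>i<k. c i * \<phi> i x)) \<le> ennreal (\<delta> / \<beta>)"
    by (intro SUP_least) auto
  then show ?thesis unfolding steklov_eigenvalue_def
    by (intro INF_lower2[OF mem]) simp
qed

section \<open>Smooth cutoff functions\<close>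

lemma DERIV_max_0_power:
  fixes t :: real
  assumes p: "p \<ge> 2"
  shows "DERIV (\<lambda>t. (max 0 t) ^ p) t :> real p * (max 0 t) ^ (p - 1)"
proof -
  consider "t > 0" | "t < 0" | "t = 0" by linarith
  then show ?thesis
  proof cases
    case 1
    have "DERIV (\<lambda>t. t ^ p) t :> real p * t ^ (p - 1)" by (auto intro!: derivative_eq_intros)
    then have "DERIV (\<lambda>t. (max 0 t) ^ p) t :> real p * t ^ (p - 1)"
      by (rule DERIV_cong_ev[THEN iffD1, rotated 3])
        (use eventually_nhds_in_open[of "{0<..}" t] 1 in \<open>auto elim!: eventually_mono\<close>)
    then show ?thesis using 1 by simp
  next
    case 2
    have "DERIV (\<lambda>t::real. 0) t :> 0" by simp
    then have "DERIV (\<lambda>t. (max 0 t) ^ p) t :> 0"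
      by (rule DERIV_cong_ev[THEN iffD1, rotated 3])
        (use eventually_nhds_in_open[of "{..<0}" t] 2 p in \<open>auto elim!: eventually_mono\<close>)
    then show ?thesis using 2 p by (auto simp: power_0_left)
  next
    case 3
    \<comment> \<open>At zero the difference quotient equals \<open>(max 0 h) ^ (p - 1)\<close>,
      which tends to zero because \<open>p \<ge> 2\<close>.\<close>
    have "((\<lambda>h. (max 0 h) ^ (p - 1)) \<longlongrightarrow> (max 0 (0::real)) ^ (p - 1)) (at 0)"
      by (intro tendsto_intros)
    moreover have z: "(max 0 (0::real)) ^ (p - 1) = 0" using p by (simp add: power_0_left)
    ultimately have "((\<lambda>h. (max 0 h) ^ (p - 1)) \<longlongrightarrow> 0) (at (0::real))" by metis
    moreover have "\<forall>\<^sub>F h in at (0::real). (max 0 h) ^ (p - 1) = ((max 0 (0 + h)) ^ p - (max 0 0) ^ p) / h"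
      unfolding eventually_at_filter
    proof (intro always_eventually allI impI)
      fix h :: real assume "h \<noteq> 0"
      then show "(max 0 h) ^ (p - 1) = ((max 0 (0 + h)) ^ p - (max 0 0) ^ p) / h"
        using p by (cases p) (auto simp: max_def)
    qed
    ultimately have "((\<lambda>h. ((max 0 (0 + h)) ^ p - (max 0 0) ^ p) / h) \<longlongrightarrow> 0) (at (0::real))"
      by (rule Lim_transform_eventually)
    then show ?thesis unfolding DERIV_def 3 z mult_zero_right .
  qed
qed

lemma GDERIV_sum:
  fixes f :: "'i \<Rightarrow> 'a::real_inner \<Rightarrow> real"
  assumes "\<And>l. l \<in> I \<Longrightarrow> GDERIV (f l) x :> d l"
  shows "GDERIV (\<lambda>x. \<Sum>l\<in>I. f l x) x :> (\<Sum>l\<in>I. d l)"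
  using assms unfolding gderiv_def inner_sum_right by (intro has_derivative_sum) auto

text \<open>
  A smooth substitute for \<open>(1 - max\<^sub>l a\<^sub>l)\<^sup>+\<close>: the maximum is replaced by an \<open>\<ell>\<^sup>p\<close>-norm with \<open>p\<close>
  logarithmic in the number of functions, so that the gradient is still controlled by the
  largest single gradient and not by their sum.
\<close>

lemma soft_bump:
  fixes a :: "'i \<Rightarrow> 'a::euclidean_space \<Rightarrow> real"
  assumes I: "finite I"
    and der: "\<And>l x. l \<in> I \<Longrightarrow> GDERIV (a l) x :> b l x"
    and cont: "\<And>l. l \<in> I \<Longrightarrow> continuous_on UNIV (b l)"
  shows "\<exists>\<phi> g. (\<forall>x. GDERIV \<phi> x :> g x) \<and> continuous_on UNIV g \<and> (\<forall>x. \<phi> x = 0 \<longrightarrow> g x = 0) \<and>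
    (\<forall>x. (\<forall>l\<in>I. a l x \<le> 0) \<longrightarrow> \<phi> x = 1 / 4) \<and>
    (\<forall>x. \<phi> x \<noteq> 0 \<longrightarrow> (\<forall>l\<in>I. a l x < 1)) \<and>
    (\<forall>x G. 0 \<le> G \<longrightarrow> (\<forall>l\<in>I. 0 < a l x \<longrightarrow> a l x < 1 \<longrightarrow> norm (b l x) \<le> G) \<longrightarrow> norm (g x) \<le> 3 * G)"
proof -
  \<comment> \<open>The exponent is chosen so that \<open>card I \<le> 2 ^ (p - 1)\<close> and
    \<open>p \<ge> 2\<close>; linear growth in \<open>card I\<close> achieves this.\<close>
  define p where "p = card I + 2"
  have p2: "p \<ge> 2" by (simp add: p_def)
  have cardp: "real (card I) * (1/2) ^ (p - 1) \<le> 1"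
  proof -
    have "real (card I) \<le> 2 ^ card I" using of_nat_less_two_power less_imp_le by blast
    also have "\<dots> \<le> 2 ^ (p - 1)" unfolding p_def by (intro power_increasing) auto
    finally show ?thesis by (simp add: field_simps)
  qed
  define s where "s x = (\<Sum>l\<in>I. (max 0 (a l x)) ^ p)" for x
  \<comment> \<open>The added constant keeps \<open>\<theta>\<close> at least 1/2, where the root is
    differentiable, and gives \<open>\<theta> = 1/2\<close> where all \<open>a l\<close> are
    nonpositive. Squaring in \<open>\<phi>\<close> then yields the value 1/4 and a gradient that
    vanishes together with \<open>\<phi>\<close>.\<close>
  define Y where "Y x = (1/2) ^ p + s x" for x
  define \<theta> where "\<theta> x = Y x powr (1 / p)" for x
  define \<phi> where "\<phi> x = (max 0 (1 - \<theta> x)) ^ 2" for x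
  define w where "w x = (\<Sum>l\<in>I. (max 0 (a l x)) ^ (p - 1) *\<^sub>R b l x)" for x
  define g where "g x = (- 2 * max 0 (1 - \<theta> x) * (\<theta> x / (\<theta> x) ^ p)) *\<^sub>R w x" for x
  have s0: "s x \<ge> 0" for x unfolding s_def by (intro sum_nonneg) auto
  have Y0: "Y x > 0" "Y x \<ge> (1/2) ^ p" for x using s0[of x] by (auto simp: Y_def add_pos_nonneg)
  have \<theta>p: "(\<theta> x) ^ p = Y x" for x
    using Y0[of x] p2 by (simp add: \<theta>_def powr_realpow[symmetric] powr_powr)
  have \<theta>0: "\<theta> x > 0" for x using Y0[of x] by (simp add: \<theta>_def)
  have \<theta>2: "\<theta> x \<ge> 1/2" for x
  proof -
    have "(1/2) ^ p \<le> (\<theta> x) ^ p" using Y0 \<theta>p by simp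
    then show ?thesis using power_mono_iff[of "1/2" "\<theta> x" p] \<theta>0[of x] p2 by simp
  qed
  have sder: "GDERIV s x :> (real p *\<^sub>R w x)" for x
  proof -
    have "GDERIV s x :> (\<Sum>l\<in>I. (real p * (max 0 (a l x)) ^ (p - 1)) *\<^sub>R b l x)"
      unfolding s_def
      by (intro GDERIV_sum GDERIV_DERIV_compose[OF der DERIV_max_0_power[OF p2]])
    then show ?thesis by (simp add: w_def scaleR_sum_right)
  qed
  have Yder: "GDERIV Y x :> (real p *\<^sub>R w x)" for x
    using GDERIV_add[OF GDERIV_const sder] unfolding Y_def by simp
  have \<theta>der: "GDERIV \<theta> x :> ((\<theta> x / (\<theta> x) ^ p) *\<^sub>R w x)" for x
  proof -
    have "DERIV (\<lambda>y. y powr (1 / p)) (Y x) :> (1 / p) * Y x powr (1 / p - 1)"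
      using has_real_derivative_powr[OF Y0(1)] .
    from GDERIV_DERIV_compose[OF Yder this]
    have "GDERIV \<theta> x :> (((1 / p) * Y x powr (1 / p - 1)) *\<^sub>R real p *\<^sub>R w x)"
      unfolding \<theta>_def .
    moreover have eq: "((1 / p) * Y x powr (1 / p - 1)) *\<^sub>R real p *\<^sub>R w x = (\<theta> x / (\<theta> x) ^ p) *\<^sub>R w x"
      using p2 Y0[of x] unfolding \<theta>p by (simp add: powr_diff \<theta>_def)
    ultimately show ?thesis unfolding eq by blast
  qed
  have \<phi>der: "GDERIV \<phi> x :> g x" for x
  proof -
    have "GDERIV (\<lambda>x. 1 - \<theta> x) x :> (0 - (\<theta> x / (\<theta> x) ^ p) *\<^sub>R w x)"
      by (intro GDERIV_diff GDERIV_const \<theta>der)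
    from GDERIV_DERIV_compose[OF this DERIV_max_0_power[of 2]]
    show ?thesis unfolding \<phi>_def g_def by (simp add: algebra_simps)
  qed
  have ac: "continuous_on UNIV (a l)" if "l \<in> I" for l using gderiv_continuous der that by blast
  have wc: "continuous_on UNIV w" unfolding w_def by (intro continuous_intros ac cont)
  have \<theta>c: "continuous_on UNIV \<theta>" by (rule gderiv_continuous[OF \<theta>der])
  have gc: "continuous_on UNIV g"
    unfolding g_def by (intro continuous_intros wc \<theta>c) (use \<theta>0 in \<open>auto simp: less_imp_neq[symmetric]\<close>)
  have p1: "\<phi> x = 1/4" if "\<And>l. l \<in> I \<Longrightarrow> a l x \<le> 0" for x
  proof -
    have "s x = 0" unfolding s_def
      by (intro sum.neutral ballI) (use that p2 in \<open>simp add: max_absorb1 power_0_left\<close>)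
    then have half: "\<theta> x = 1/2" using \<theta>p[of x] \<theta>0[of x] p2
      by (intro power_eq_imp_eq_base[of "\<theta> x" p]) (auto simp: Y_def)
    show ?thesis unfolding \<phi>_def half by (simp add: power2_eq_square)
  qed
  have p3: "a l x < 1" if "\<phi> x \<noteq> 0" "l \<in> I" for x l
  proof (rule ccontr)
    assume "\<not> a l x < 1"
    then have "1 \<le> (max 0 (a l x)) ^ p" by (intro one_le_power) auto
    also have "\<dots> \<le> s x" unfolding s_def by (rule member_le_sum) (use that I in auto)
    finally have "1 \<le> Y x" by (simp add: Y_def add_increasing)
    then have "1 \<le> \<theta> x" using p2 by (simp add: \<theta>_def ge_one_powr_ge_zero)
    then show False using that by (simp add: \<phi>_def)
  qed
  have p4: "norm (g x) \<le> 3 * G"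
    if G: "G \<ge> 0" and bd: "\<And>l. l \<in> I \<Longrightarrow> 0 < a l x \<Longrightarrow> a l x < 1 \<Longrightarrow> norm (b l x) \<le> G" for x G
  proof (cases "\<phi> x = 0")
    case True
    then have "g x = 0" by (simp add: \<phi>_def g_def)
    then show ?thesis using G by simp
  next
    case False
    \<comment> \<open>In these normalised variables the gradient of \<open>\<theta>\<close> is the
      sum of \<open>u l ^ (p - 1) *\<^sub>R b l x\<close>, so a bound for the sum of the
      \<open>u l ^ (p - 1)\<close> is what is needed.\<close>
    define u where "u l = max 0 (a l x) / \<theta> x" for l
    have u0: "u l \<ge> 0" for l using \<theta>0[of x] by (simp add: u_def)
    have up: "(\<Sum>l\<in>I. u l ^ p) \<le> 1"
    proof -
      have "(\<Sum>l\<in>I. u l ^ p) = s x / Y x"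
        by (simp add: u_def s_def \<theta>p[symmetric] power_divide sum_divide_distrib)
      also have "\<dots> \<le> 1" using Y0[of x] by (simp add: Y_def)
      finally show ?thesis .
    qed
    \<comment> \<open>Values \<open>u l \<ge> 1/2\<close> are absorbed by
      \<open>2 * u l ^ p\<close>, whose sum is at most 2. The smaller ones contribute at most
      \<open>card I * (1/2) ^ (p - 1) \<le> 1\<close>, which gives the constant 3.\<close>
    have split: "u l ^ (p - 1) \<le> 2 * u l ^ p + (1/2) ^ (p - 1)" for l
    proof (cases "u l \<ge> 1/2")
      case True
      have "u l ^ (p - 1) * 1 \<le> u l ^ (p - 1) * (2 * u l)"
        using True u0[of l] by (intro mult_left_mono) auto
      also have "\<dots> = 2 * u l ^ p" using p2 by (cases p) auto
      finally show ?thesis by (simp add: add_increasing2)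
    next
      case False
      then have "u l ^ (p - 1) \<le> (1/2) ^ (p - 1)" using u0[of l] by (intro power_mono) auto
      then show ?thesis using u0[of l] by (simp add: add_increasing)
    qed
    have "(\<Sum>l\<in>I. u l ^ (p - 1)) \<le> (\<Sum>l\<in>I. 2 * u l ^ p + (1/2) ^ (p - 1))"
      by (intro sum_mono split)
    also have "\<dots> = 2 * (\<Sum>l\<in>I. u l ^ p) + real (card I) * (1/2) ^ (p - 1)"
      by (simp add: sum.distrib sum_distrib_left)
    also have "\<dots> \<le> 3" using up cardp by linarith
    finally have us: "(\<Sum>l\<in>I. u l ^ (p - 1)) \<le> 3" .
    have nw: "norm (w x) \<le> (\<Sum>l\<in>I. (max 0 (a l x)) ^ (p - 1) * G)"
      unfolding w_def
    proof (intro sum_norm_le)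
      fix l assume l: "l \<in> I"
      show "norm ((max 0 (a l x)) ^ (p - 1) *\<^sub>R b l x) \<le> (max 0 (a l x)) ^ (p - 1) * G"
      proof (cases "a l x > 0")
        case True
        then show ?thesis using bd[OF l] p3[OF False l] by (auto intro!: mult_left_mono)
      qed (use p2 in \<open>simp add: max_absorb1 power_0_left\<close>)
    qed
    have fac: "\<bar>- 2 * max 0 (1 - \<theta> x) * (\<theta> x / (\<theta> x) ^ p)\<bar> \<le> \<theta> x / (\<theta> x) ^ p"
    proof -
      have "\<bar>- 2 * max 0 (1 - \<theta> x) * (\<theta> x / (\<theta> x) ^ p)\<bar> = (2 * max 0 (1 - \<theta> x)) * (\<theta> x / (\<theta> x) ^ p)"
        using \<theta>0[of x] by (simp add: abs_mult)
      also have "\<dots> \<le> 1 * (\<theta> x / (\<theta> x) ^ p)"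
        using \<theta>2[of x] \<theta>0[of x] by (intro mult_right_mono) (auto simp: max_def)
      finally show ?thesis by simp
    qed
    have "norm (g x) \<le> (\<theta> x / (\<theta> x) ^ p) * (\<Sum>l\<in>I. (max 0 (a l x)) ^ (p - 1) * G)"
      unfolding g_def norm_scaleR using fac nw \<theta>0[of x] by (intro mult_mono) auto
    also have "\<dots> = (\<Sum>l\<in>I. u l ^ (p - 1)) * G"
      using \<theta>0[of x] p2
      by (cases p) (simp_all add: u_def sum_distrib_left sum_distrib_right power_divide field_simps)
    also have "\<dots> \<le> 3 * G" using us G by (rule mult_right_mono)
    finally show ?thesis .
  qed
  have p5: "g x = 0" if "\<phi> x = 0" for x using that by (simp add: \<phi>_def g_def)
  show ?thesis
    by (rule exI[of _ \<phi>], rule exI[of _ g], intro conjI) (use \<phi>der gc p1 p3 p4 p5 in blast)+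
qed

text \<open>Markov's inequality for counting: otherwise at least \<open>k\<close> indices would have
  \<open>d i > E / k\<close>, and their sum would exceed \<open>E\<close>.\<close>

lemma card_le_average:
  fixes d :: "'i \<Rightarrow> real"
  assumes I: "finite I" "card I \<ge> 2 * k" and k: "k \<ge> 1" and d: "\<And>i. i \<in> I \<Longrightarrow> d i \<ge> 0"
    and s: "(\<Sum>i\<in>I. d i) \<le> E"
  shows "card {i\<in>I. d i \<le> E / k} \<ge> k"
proof (rule ccontr)
  define A where "A = {i\<in>I. d i \<le> E / k}"
  assume "\<not> ?thesis"
  then have A: "card A < k" by (simp add: A_def)
  have fA: "finite A" "A \<subseteq> I" using I by (auto simp: A_def)
  then have c: "card (I - A) \<ge> k" "card (I - A) > 0"
    using A I k by (auto simp: card_Diff_subset)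
  have E0: "E \<ge> 0" using s sum_nonneg[of I d] d by fastforce
  have "E = real k * (E / k)" using k by simp
  also have "\<dots> \<le> real (card (I - A)) * (E / k)" using c E0 by (intro mult_right_mono) auto
  also have "\<dots> = (\<Sum>i\<in>I - A. E / k)" by simp
  also have "\<dots> < (\<Sum>i\<in>I - A. d i)"
    using c(2) I by (intro sum_strict_mono) (auto simp: A_def card_gt_0_iff)
  also have "\<dots> \<le> (\<Sum>i\<in>I. d i)" using I d by (intro sum_mono2) auto
  also have "\<dots> \<le> E" by (rule s)
  finally show False by simp
qed

section \<open>From a family of balls to an eigenvalue bound\<close>

lemma GDERIV_scaled_dist:
  fixes c :: "'a::euclidean_space"
  shows "GDERIV (\<lambda>x. (norm (x - c))\<^sup>2 / \<rho>\<^sup>2) x :> ((2 / \<rho>\<^sup>2) *\<^sub>R (x - c))"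
proof -
  have "GDERIV (\<lambda>x. (x - c) \<bullet> (x - c) * K) x :> ((2 * K) *\<^sub>R (x - c))" for K
    unfolding gderiv_def
    by (auto intro!: derivative_eq_intros simp: inner_commute algebra_simps)
  from this[of "1 / \<rho>\<^sup>2"] show ?thesis by (simp add: power2_norm_eq_inner)
qed

text \<open>
  The test function of the \<open>i\<close>-th ball vanishes outside a slightly larger ball and near the previous
  balls. At every point at most one of these functions is nonzero, and its gradient there
  is controlled by the smallest relevant radius.
\<close>

lemma steklov_eigenvalue_le_balls:
  fixes x :: "nat \<Rightarrow> 'a::euclidean_space" and r :: "nat \<Rightarrow> real"
  assumes \<Omega>: "open \<Omega>" "bounded \<Omega>" and fin: "finite_measure (boundary_measure \<Omega>)"
    and k: "k \<ge> 1" and r: "\<And>i. i < 2 * k \<Longrightarrow> r i > 0" and v: "v > 0"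
    and mass: "\<And>i. i < 2 * k \<Longrightarrow> ennreal v \<le> emeasure (boundary_measure \<Omega>)
      (frontier \<Omega> \<inter> (cball (x i) (r i) - (\<Union>j<i. cball (x j) (2 * r j))))"
    and \<tau>: "\<tau> \<ge> 0"
    and E: "\<tau> * measure lebesgue \<Omega>
      + (\<Sum>j\<in>{j. j < 2 * k \<and> \<tau> < 1 / (r j)\<^sup>2}. measure lborel (cball (x j) (2 * r j)) / (r j)\<^sup>2) \<le> E"
  shows "steklov_eigenvalue \<Omega> k \<le> ennreal (2304 * E / (k * v))"
proof -
  \<comment> \<open>Squared distances are smooth also at the centres. The ball of radius
    \<open>r j\<close> is \<open>t j \<le> 1\<close>, its double is \<open>t j \<le> 4\<close>, and
    the intermediate level 2 will separate the supports.\<close>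
  define t where "t j y = (norm (y - x j))\<^sup>2 / (r j)\<^sup>2" for j y
  define J where "J = {j. j < 2 * k \<and> \<tau> < 1 / (r j)\<^sup>2}"
  \<comment> \<open>Up to the factor 144 this bounds the squared gradients. Balls outside
    \<open>J\<close> have \<open>1 / (r j)\<^sup>2 \<le> \<tau>\<close> and are covered by the
    constant term; the others enter through their doubles.\<close>
  define G where "G y = \<tau> + (\<Sum>j\<in>J. indicator (cball (x j) (2 * r j)) y / (r j)\<^sup>2)" for y
  have J: "finite J" by (simp add: J_def)
  have G0: "G y \<ge> 0" for y unfolding G_def using \<tau> by (intro add_nonneg_nonneg sum_nonneg) auto
  have rG: "1 / r j \<le> sqrt (G y)" if j: "j < 2 * k" and y: "norm (y - x j) \<le> 2 * r j" for j y
  proof -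
    have "1 / (r j)\<^sup>2 \<le> G y"
    proof (cases "j \<in> J")
      case True
      have "1 / (r j)\<^sup>2 = indicator (cball (x j) (2 * r j)) y / (r j)\<^sup>2"
        using y by (simp add: dist_norm norm_minus_commute)
      also have "\<dots> \<le> (\<Sum>j\<in>J. indicator (cball (x j) (2 * r j)) y / (r j)\<^sup>2)"
        by (rule member_le_sum[OF True]) (use J in auto)
      also have "\<dots> \<le> G y" using \<tau> by (simp add: G_def)
      finally show ?thesis .
    next
      case False
      then have "1 / (r j)\<^sup>2 \<le> \<tau>" using j by (simp add: J_def)
      also have "\<dots> \<le> G y" by (simp add: G_def sum_nonneg)
      finally show ?thesis .
    qed
    then have "(1 / r j)\<^sup>2 \<le> G y" by (simp add: power_divide)
    then show ?thesis by (rule real_le_rsqrt)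
  qed
  define PP where "PP i \<phi> g \<longleftrightarrow> (\<forall>y. GDERIV \<phi> y :> g y) \<and> continuous_on UNIV g \<and>
      (\<forall>y. \<phi> y = 0 \<longrightarrow> g y = 0) \<and>
      (\<forall>y\<in>cball (x i) (r i) - (\<Union>j<i. cball (x j) (2 * r j)). \<phi> y = 1/4) \<and>
      (\<forall>y. \<phi> y \<noteq> 0 \<longrightarrow> t i y < 2 \<and> (\<forall>j<i. t j y > 2)) \<and>
      (\<forall>y. (norm (g y))\<^sup>2 \<le> 144 * G y)" for i \<phi> g
  have ex: "\<exists>\<phi> g. PP i \<phi> g" if i: "i < 2 * k" for i
  proof -
    \<comment> \<open>On the reduced ball \<open>t i \<le> 1\<close> and \<open>t j \<ge> 4\<close>,
      so all \<open>a l\<close> are nonpositive. The conditions \<open>a l < 1\<close> say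
      \<open>t i < 2\<close> and \<open>t j > 2\<close> for \<open>j < i\<close>, which makes the
      supports disjoint.\<close>
    define a where "a = (\<lambda>l y. if l = i then t l y - 1 else 3 - t l y)"
    define b where "b l y = (if l = i then 1 else - 1) *\<^sub>R ((2 / (r l)\<^sup>2) *\<^sub>R (y - x l))" for l y
    have rl: "r l > 0" if "l \<le> i" for l using r i that by simp
    have td: "GDERIV (t l) y :> ((2 / (r l)\<^sup>2) *\<^sub>R (y - x l))" for l y
      unfolding t_def by (rule GDERIV_scaled_dist)
    have ad: "GDERIV (a l) y :> b l y" for l y
      using GDERIV_diff[OF td[of l y] GDERIV_const[of 1 y]] GDERIV_diff[OF GDERIV_const[of 3 y] td[of l y]]
      by (cases "l = i") (simp_all add: a_def b_def)
    have bc: "continuous_on UNIV (b l)" for l unfolding b_def by (intro continuous_intros)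
    obtain \<phi> g where P: "\<forall>y. GDERIV \<phi> y :> g y" "continuous_on UNIV g" "\<forall>y. \<phi> y = 0 \<longrightarrow> g y = 0"
      "\<forall>y. (\<forall>l\<in>{..i}. a l y \<le> 0) \<longrightarrow> \<phi> y = 1 / 4"
      "\<forall>y. \<phi> y \<noteq> 0 \<longrightarrow> (\<forall>l\<in>{..i}. a l y < 1)"
      "\<forall>y G. 0 \<le> G \<longrightarrow> (\<forall>l\<in>{..i}. 0 < a l y \<longrightarrow> a l y < 1 \<longrightarrow> norm (b l y) \<le> G) \<longrightarrow> norm (g y) \<le> 3 * G"
      using soft_bump[of "{..i}" a b, OF finite_atMost ad bc] by blast
    have "\<phi> y = 1/4" if y: "y \<in> cball (x i) (r i) - (\<Union>j<i. cball (x j) (2 * r j))" for y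
    proof (rule P(4)[rule_format])
      fix l assume l: "l \<in> {..i}"
      show "a l y \<le> 0"
      proof (cases "l = i")
        case True
        have "(norm (y - x i))\<^sup>2 \<le> (r i)\<^sup>2"
          using y by (intro power_mono) (auto simp: dist_norm norm_minus_commute)
        then show ?thesis using True rl[of i] by (simp add: a_def t_def)
      next
        case False
        then have "l < i" using l by simp
        then have "y \<notin> cball (x l) (2 * r l)" using y by blast
        then have "norm (y - x l) \<ge> 2 * r l" by (simp add: dist_norm norm_minus_commute)
        then have "(norm (y - x l))\<^sup>2 \<ge> (2 * r l)\<^sup>2" using rl[of l] l by (intro power_mono) auto
        then have "(norm (y - x l))\<^sup>2 \<ge> 4 * (r l)\<^sup>2" by (simp add: power_mult_distrib)
        then have "3 * (r l)\<^sup>2 \<le> (norm (y - x l))\<^sup>2" using zero_le_power2[of "r l"] by linarith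
        then show ?thesis using False rl[of l] l by (simp add: a_def t_def pos_le_divide_eq)
      qed
    qed
    moreover have "t i y < 2 \<and> (\<forall>j<i. t j y > 2)" if "\<phi> y \<noteq> 0" for y
    proof (intro conjI allI impI)
      show "t i y < 2" using P(5)[rule_format, OF that, of i] by (simp add: a_def)
      show "t j y > 2" if "j < i" for j using P(5)[rule_format, OF \<open>\<phi> y \<noteq> 0\<close>, of j] that by (simp add: a_def)
    qed
    moreover have "(norm (g y))\<^sup>2 \<le> 144 * G y" for y
    proof -
      \<comment> \<open>The transition region \<open>0 < a l < 1\<close> lies in the double of the
        ball \<open>l\<close>, where the gradient of \<open>t l\<close> is at most
        \<open>4 / r l\<close>. The factor 3 comes from the soft maximum, and
        \<open>12\<^sup>2 = 144\<close>.\<close>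
      have "norm (g y) \<le> 3 * (4 * sqrt (G y))"
      proof (rule P(6)[rule_format])
        show "4 * sqrt (G y) \<ge> 0" using G0 by simp
        fix l assume l: "l \<in> {..i}" and al: "0 < a l y" "a l y < 1"
        have "t l y < 4" using al by (auto simp: a_def split: if_splits)
        then have "(norm (y - x l))\<^sup>2 < (2 * r l)\<^sup>2" using rl[of l] l
          by (simp add: t_def pos_divide_less_eq power_mult_distrib)
        moreover have "0 \<le> 2 * r l" using rl[of l] l by simp
        ultimately have n: "norm (y - x l) < 2 * r l" by (rule power2_less_imp_less)
        have "norm (b l y) = (2 / (r l)\<^sup>2) * norm (y - x l)" by (simp add: b_def)
        also have "\<dots> \<le> (2 / (r l)\<^sup>2) * (2 * r l)" using n by (intro mult_left_mono) auto
        also have "\<dots> = 4 * (1 / r l)" using rl[of l] l by (simp add: power2_eq_square)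
        also have "\<dots> \<le> 4 * sqrt (G y)" using rG[of l y] n l i by simp
        finally show "norm (b l y) \<le> 4 * sqrt (G y)" .
      qed
      then have "(norm (g y))\<^sup>2 \<le> (12 * sqrt (G y))\<^sup>2" by (intro power_mono) auto
      then show ?thesis using G0 by (simp add: power_mult_distrib)
    qed
    ultimately have "PP i \<phi> g" unfolding PP_def using P(1-3) by simp
    then show ?thesis by blast
  qed
  then obtain \<phi> g where "\<And>i. i < 2 * k \<Longrightarrow> PP i (\<phi> i) (g i)" by metis
  note P = this[unfolded PP_def]
  have disj: "\<phi> i y = 0 \<or> \<phi> j y = 0" if "i < 2 * k" "j < 2 * k" "i \<noteq> j" for i j y
  proof -
    have "False" if "i' < j'" "\<phi> i' y \<noteq> 0" "\<phi> j' y \<noteq> 0" "j' < 2 * k" for i' j'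
    proof -
      have "t i' y < 2" using P[of i'] that by auto
      moreover have "t i' y > 2" using P[of j'] that by auto
      ultimately show False by simp
    qed
    then show ?thesis using that by (metis nat_neq_iff)
  qed
  define D where "D i = (\<integral>\<^sup>+y. ennreal ((norm (g i y))\<^sup>2) \<partial>lebesgue_on \<Omega>)" for i
  have gm: "g i \<in> borel_measurable (lebesgue_on \<Omega>)" if "i < 2 * k" for i
    using square_integrable_lebesgue_on[OF \<Omega>, of "g i"] P[OF that] by (simp add: square_integrable_def)
  have Om: "\<Omega> \<in> lmeasurable" using \<Omega> by (simp add: lmeasurable_open)
  have "(\<Sum>i<2*k. D i) = (\<integral>\<^sup>+y. (\<Sum>i<2*k. ennreal ((norm (g i y))\<^sup>2)) \<partial>lebesgue_on \<Omega>)"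
    unfolding D_def using gm by (subst nn_integral_sum) auto
  also have "\<dots> \<le> (\<integral>\<^sup>+y. ennreal (144 * G y) \<partial>lebesgue_on \<Omega>)"
  proof (intro nn_integral_mono)
    fix y
    \<comment> \<open>At most one summand is nonzero at each point, so no factor \<open>k\<close> is
      lost.\<close>
    have "(\<Sum>i<2*k. (norm (g i y))\<^sup>2) \<le> 144 * G y"
    proof (cases "\<exists>i<2*k. \<phi> i y \<noteq> 0")
      case True
      then obtain i where i: "i < 2*k" "\<phi> i y \<noteq> 0" by blast
      have "g j y = 0" if "j < 2*k" "j \<noteq> i" for j
      proof -
        have "\<phi> j y = 0" using disj[OF that(1) i(1) that(2)] i(2) by blast
        then show ?thesis using P[OF that(1)] by simp
      qed
      then have "(\<Sum>j<2*k. (norm (g j y))\<^sup>2) = (norm (g i y))\<^sup>2"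
        using i by (subst sum.remove[of _ i]) auto
      then show ?thesis using P[OF i(1)] by simp
    next
      case False
      then have "g j y = 0" if "j < 2*k" for j using P[OF that] that by simp
      then show ?thesis using G0[of y] by simp
    qed
    then show "(\<Sum>i<2*k. ennreal ((norm (g i y))\<^sup>2)) \<le> ennreal (144 * G y)"
      by (simp add: sum_ennreal ennreal_leI)
  qed
  also have "\<dots> \<le> ennreal (144 * E)"
  proof -
    have "(\<integral>\<^sup>+y. ennreal (144 * G y) \<partial>lebesgue_on \<Omega>)
       = (\<integral>\<^sup>+y. ennreal (144 * \<tau>) + (\<Sum>j\<in>J. ennreal (144 / (r j)\<^sup>2) * indicator (cball (x j) (2 * r j)) y) \<partial>lebesgue_on \<Omega>)"
    proof (intro nn_integral_cong)
      fix y
      have e: "ennreal (144 / (r j)\<^sup>2) * indicator (cball (x j) (2 * r j)) y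
        = ennreal (144 * (indicator (cball (x j) (2 * r j)) y / (r j)\<^sup>2))" for j
        by (auto simp: indicator_def)
      show "ennreal (144 * G y) = ennreal (144 * \<tau>) + (\<Sum>j\<in>J. ennreal (144 / (r j)\<^sup>2) * indicator (cball (x j) (2 * r j)) y)"
      proof -
        have "(\<Sum>j\<in>J. ennreal (144 / (r j)\<^sup>2) * indicator (cball (x j) (2 * r j)) y)
          = ennreal (\<Sum>j\<in>J. 144 * (indicator (cball (x j) (2 * r j)) y / (r j)\<^sup>2))"
          unfolding e by (rule sum_ennreal) simp
        moreover have "ennreal (144 * \<tau> + (\<Sum>j\<in>J. 144 * (indicator (cball (x j) (2 * r j)) y / (r j)\<^sup>2)))
          = ennreal (144 * \<tau>) + ennreal (\<Sum>j\<in>J. 144 * (indicator (cball (x j) (2 * r j)) y / (r j)\<^sup>2))"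
          using \<tau> by (intro ennreal_plus sum_nonneg) auto
        moreover have "144 * G y = 144 * \<tau> + (\<Sum>j\<in>J. 144 * (indicator (cball (x j) (2 * r j)) y / (r j)\<^sup>2))"
          by (simp only: G_def distrib_left sum_distrib_left)
        ultimately show ?thesis by metis
      qed
    qed
    also have "\<dots> = ennreal (144 * \<tau>) * emeasure lebesgue \<Omega>
        + (\<Sum>j\<in>J. ennreal (144 / (r j)\<^sup>2) * emeasure (lebesgue_on \<Omega>) (\<Omega> \<inter> cball (x j) (2 * r j)))"
    proof -
      have "cball (x j) (2 * r j) \<inter> space (lebesgue_on \<Omega>) \<in> sets (lebesgue_on \<Omega>)" for j
        using \<Omega>(1) by (simp add: sets_restrict_space_iff space_restrict_space)
      then have [measurable]: "(\<lambda>y. indicator (cball (x j) (2 * r j)) y :: ennreal) \<in> borel_measurable (lebesgue_on \<Omega>)" for j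
        by (simp add: borel_measurable_indicator_iff Int_commute)
      have ii: "(\<integral>\<^sup>+y. indicator (cball (x j) (2 * r j)) y \<partial>lebesgue_on \<Omega>) = emeasure (lebesgue_on \<Omega>) (\<Omega> \<inter> cball (x j) (2 * r j))" for j
      proof -
        have "(\<integral>\<^sup>+y. indicator (cball (x j) (2 * r j)) y \<partial>lebesgue_on \<Omega>)
          = (\<integral>\<^sup>+y. indicator (\<Omega> \<inter> cball (x j) (2 * r j)) y \<partial>lebesgue_on \<Omega>)"
          by (intro nn_integral_cong) (auto simp: indicator_def space_restrict_space)
        also have "\<dots> = emeasure (lebesgue_on \<Omega>) (\<Omega> \<inter> cball (x j) (2 * r j))"
          using \<Omega> by (intro nn_integral_indicator) (auto simp: sets_restrict_space)
        finally show ?thesis .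
      qed
      show ?thesis
        by (subst nn_integral_add, simp, simp, subst nn_integral_sum, simp)
          (use \<Omega> in \<open>simp add: nn_integral_cmult ii emeasure_restrict_space space_restrict_space\<close>)
    qed
    also have "\<dots> \<le> ennreal (144 * \<tau>) * ennreal (measure lebesgue \<Omega>)
        + (\<Sum>j\<in>J. ennreal (144 / (r j)\<^sup>2) * ennreal (measure lborel (cball (x j) (2 * r j))))"
    proof (intro add_mono sum_mono mult_left_mono)
      show "emeasure lebesgue \<Omega> \<le> ennreal (measure lebesgue \<Omega>)"
        using Om by (simp add: emeasure_eq_measure2)
      show "emeasure (lebesgue_on \<Omega>) (\<Omega> \<inter> cball (x j) (2 * r j)) \<le> ennreal (measure lborel (cball (x j) (2 * r j)))" for j
      proof -
        have "emeasure (lebesgue_on \<Omega>) (\<Omega> \<inter> cball (x j) (2 * r j)) = emeasure lebesgue (\<Omega> \<inter> cball (x j) (2 * r j))"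
          using \<Omega> by (intro emeasure_restrict_space) auto
        also have "\<dots> \<le> emeasure lebesgue (cball (x j) (2 * r j))" by (intro emeasure_mono) auto
        also have "\<dots> = ennreal (measure lborel (cball (x j) (2 * r j)))"
        proof -
          have "emeasure lborel (cball (x j) (2 * r j)) \<noteq> top"
            using emeasure_bounded_finite[OF bounded_cball, of "x j" "2 * r j"] by (auto simp: less_top)
          from emeasure_eq_ennreal_measure[OF this] show ?thesis by simp
        qed
        finally show ?thesis .
      qed
    qed auto
    also have "\<dots> = ennreal (144 * (\<tau> * measure lebesgue \<Omega> + (\<Sum>j\<in>J. measure lborel (cball (x j) (2 * r j)) / (r j)\<^sup>2)))"
    proof -
      define c where "c j = measure lborel (cball (x j) (2 * r j))" for j
      have "(\<Sum>j\<in>J. ennreal (144 / (r j)\<^sup>2) * ennreal (c j)) = (\<Sum>j\<in>J. ennreal (144 / (r j)\<^sup>2 * c j))"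
        by (intro sum.cong refl ennreal_mult[symmetric]) (auto simp: c_def)
      also have "\<dots> = ennreal (\<Sum>j\<in>J. 144 / (r j)\<^sup>2 * c j)" by (intro sum_ennreal) (auto simp: c_def)
      finally have 1: "(\<Sum>j\<in>J. ennreal (144 / (r j)\<^sup>2) * ennreal (c j)) = ennreal (\<Sum>j\<in>J. 144 / (r j)\<^sup>2 * c j)" .
      have 2: "ennreal (144 * \<tau>) * ennreal (measure lebesgue \<Omega>) = ennreal (144 * \<tau> * measure lebesgue \<Omega>)"
        using \<tau> by (intro ennreal_mult[symmetric]) auto
      have "144 * \<tau> * measure lebesgue \<Omega> + (\<Sum>j\<in>J. 144 / (r j)\<^sup>2 * c j)
        = 144 * (\<tau> * measure lebesgue \<Omega> + (\<Sum>j\<in>J. c j / (r j)\<^sup>2))"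
        by (simp add: distrib_left sum_distrib_left)
      moreover have "ennreal (144 * \<tau> * measure lebesgue \<Omega>) + ennreal (\<Sum>j\<in>J. 144 / (r j)\<^sup>2 * c j)
        = ennreal (144 * \<tau> * measure lebesgue \<Omega> + (\<Sum>j\<in>J. 144 / (r j)\<^sup>2 * c j))"
        using \<tau> by (intro ennreal_plus[symmetric] sum_nonneg) (auto simp: c_def)
      ultimately show ?thesis using 1 2 by (simp add: c_def mult.assoc)
    qed
    also have "\<dots> \<le> ennreal (144 * E)" using E unfolding J_def by (intro ennreal_leI) simp
    finally show ?thesis .
  qed
  finally have Dsum: "(\<Sum>i<2*k. D i) \<le> ennreal (144 * E)" .
  have "0 \<le> \<tau> * measure lebesgue \<Omega>
      + (\<Sum>j\<in>{j. j < 2 * k \<and> \<tau> < 1 / (r j)\<^sup>2}. measure lborel (cball (x j) (2 * r j)) / (r j)\<^sup>2)"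
    using \<tau> by (intro add_nonneg_nonneg sum_nonneg) auto
  then have E0: "E \<ge> 0" using E by linarith
  define d where "d i = enn2real (D i)" for i
  have Dd: "D i = ennreal (d i)" if "i < 2 * k" for i
  proof -
    have "D i \<le> (\<Sum>i<2*k. D i)" using that by (intro member_le_sum) auto
    then have "D i < top" using Dsum le_less_trans ennreal_less_top by (metis)
    then show ?thesis by (simp add: d_def)
  qed
  have "(\<Sum>i<2*k. d i) \<le> 144 * E"
  proof -
    have "ennreal (\<Sum>i<2*k. d i) = (\<Sum>i<2*k. D i)"
      using Dd by (subst sum_ennreal[symmetric]) (auto simp: d_def)
    then have "ennreal (\<Sum>i<2*k. d i) \<le> ennreal (144 * E)" using Dsum by metis
    then show ?thesis using E0 by (subst (asm) ennreal_le_iff) auto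
  qed
  then have "card {i\<in>{..<2*k}. d i \<le> 144 * E / k} \<ge> k"
    using k by (intro card_le_average) (auto simp: d_def)
  then obtain T where T: "T \<subseteq> {i\<in>{..<2*k}. d i \<le> 144 * E / k}" "card T = k" "finite T"
    by (rule obtain_subset_with_card_n)
  obtain h where h: "bij_betw h {0..<k} T" using ex_bij_betw_nat_finite[OF T(3)] T(2) by auto
  have hT: "h i < 2 * k" "d (h i) \<le> 144 * E / k" if "i < k" for i
    using bij_betwE[OF h] T(1) that by auto
  have hinj: "h i \<noteq> h j" if "i < k" "j < k" "i \<noteq> j" for i j
    using h that by (auto simp: bij_betw_def inj_on_def)
  \<comment> \<open>Of the \<open>2 * k\<close> functions, \<open>k\<close> have at most the energy
    \<open>144 * E / k\<close>. Each equals 1/4 on a set of boundary mass at least \<open>v\<close>,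
    hence the denominator \<open>v / 16\<close>.\<close>
  have "steklov_eigenvalue \<Omega> k \<le> ennreal ((144 * E / k) / (v / 16))"
  proof (rule steklov_eigenvalue_le_disjoint_supports[OF \<Omega> fin, where \<phi> = "\<lambda>i. \<phi> (h i)" and g = "\<lambda>i. g (h i)"])
    fix i assume i: "i < k"
    show "(\<integral>\<^sup>+y. ennreal ((norm (g (h i) y))\<^sup>2) \<partial>lebesgue_on \<Omega>) \<le> ennreal (144 * E / k)"
      using Dd[OF hT(1)[OF i]] hT(2)[OF i] by (simp add: D_def[symmetric] ennreal_leI)
    let ?S = "cball (x (h i)) (r (h i)) - (\<Union>j<h i. cball (x j) (2 * r j))"
    have "ennreal (v / 16) = ennreal (1/16) * ennreal v"
      using v by (subst ennreal_mult[symmetric]) auto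
    also have "\<dots> \<le> ennreal (1/16) * emeasure (boundary_measure \<Omega>) (frontier \<Omega> \<inter> ?S)"
      by (intro mult_left_mono mass hT i) simp
    also have "\<dots> = (\<integral>\<^sup>+y. ennreal (1/16) * indicator (frontier \<Omega> \<inter> ?S) y \<partial>boundary_measure \<Omega>)"
    proof (rule nn_integral_cmult_indicator[symmetric])
      have "?S \<in> sets borel" by (intro sets.Diff sets.countable_UN) auto
      then show "frontier \<Omega> \<inter> ?S \<in> sets (boundary_measure \<Omega>)"
        unfolding sets_boundary_measure by blast
    qed
    also have "\<dots> \<le> (\<integral>\<^sup>+y. ennreal ((\<phi> (h i) y)\<^sup>2) \<partial>boundary_measure \<Omega>)"
    proof (intro nn_integral_mono)
      fix y
      show "ennreal (1/16) * indicator (frontier \<Omega> \<inter> ?S) y \<le> ennreal ((\<phi> (h i) y)\<^sup>2)"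
      proof (cases "y \<in> ?S")
        case True
        then have "\<phi> (h i) y = 1/4" using P[OF hT(1)[OF i]] by blast
        then have "(\<phi> (h i) y)\<^sup>2 = 1/16" by (simp only: power_divide) simp
        then show ?thesis by (simp add: indicator_def)
      next
        case False
        then have "y \<notin> frontier \<Omega> \<inter> ?S" by blast
        then show ?thesis by simp
      qed
    qed
    finally show "ennreal (v / 16) \<le> (\<integral>\<^sup>+y. ennreal ((\<phi> (h i) y)\<^sup>2) \<partial>boundary_measure \<Omega>)" .
  next
    show "\<phi> (h i) y = 0 \<or> \<phi> (h j) y = 0" if "i < k" "j < k" "i \<noteq> j" for i j y
      by (rule disj[OF hT(1)[OF that(1)] hT(1)[OF that(2)] hinj[OF that]])
  qed (use P[OF hT(1)] E0 v in auto)
  also have "(144 * E / k) / (v / 16) = 2304 * E / (k * v)" by simp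
  finally show ?thesis .
qed

subsection \<open>Selection of balls\<close>

text \<open>The cardinality of such a \<open>T\<close> is the covering constant that controls the
  mass of a doubled ball by the masses of balls of half the radius.\<close>

lemma finite_half_ball_cover:
  "\<exists>T. finite T \<and> cball (0::'a::euclidean_space) 2 \<subseteq> (\<Union>p\<in>T. cball p (1/2))"
proof -
  obtain T where T: "finite T" "cball (0::'a) 2 \<subseteq> (\<Union>p\<in>T. ball p (1/2))"
    using compact_cball[of "0::'a" 2] unfolding compact_eq_totally_bounded
    by (metis half_gt_zero_iff zero_less_one)
  then have "cball (0::'a) 2 \<subseteq> (\<Union>p\<in>T. cball p (1/2))" using ball_subset_cball by blast
  then show ?thesis using T by blast
qed

text \<open>Continuity from above gives a light ball around each point, and a Lebesgue number of
  this cover of the compact carrier \<open>F\<close> makes the radius uniform.\<close>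

lemma nonatomic_small_balls:
  fixes N :: "'a::euclidean_space measure" and v :: real
  assumes fin: "finite_measure N" and sets: "sets N = sets borel" and F: "compact F"
    and null: "measure N (- F) = 0" and atom: "\<And>x. measure N {x} = 0" and v: "v > 0"
  shows "\<exists>\<delta>>0. \<forall>x. measure N (cball x \<delta>) < v"
proof -
  interpret finite_measure N by (rule fin)
  note [simp] = sets
  define \<G> where "\<G> = {B. \<exists>y e. B = ball y e \<and> measure N B < v}"
  have small: "\<exists>e>0. measure N (ball y e) < v" for y
  proof -
    define B where "B n = ball y (inverse (real (Suc n)))" for n
    have "decseq B" unfolding B_def
      by (intro decseq_SucI subset_ball) (simp add: field_simps)
    then have "(\<lambda>n. measure N (B n)) \<longlonglongrightarrow> measure N (\<Inter>n. B n)"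
      by (rule finite_Lim_measure_decseq[rotated]) (auto simp: B_def)
    moreover have "(\<Inter>n. B n) = {y}"
    proof
      show "(\<Inter>n. B n) \<subseteq> {y}"
      proof
        fix z assume z: "z \<in> (\<Inter>n. B n)"
        show "z \<in> {y}"
        proof (rule ccontr)
          assume "z \<notin> {y}"
          then obtain n where "inverse (real (Suc n)) < dist y z"
            using reals_Archimedean[of "dist y z"] by auto
          moreover have "z \<in> B n" using z by blast
          ultimately show False by (simp add: B_def)
        qed
      qed
    qed (auto simp: B_def)
    ultimately have "(\<lambda>n. measure N (B n)) \<longlonglongrightarrow> 0" using atom by simp
    then have "eventually (\<lambda>n. measure N (B n) < v) sequentially" using v by (rule order_tendstoD)
    then obtain n where "measure N (B n) < v" by (auto simp: eventually_sequentially)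
    then show ?thesis unfolding B_def by (intro exI[of _ "inverse (real (Suc n))"]) simp
  qed
  have "F \<subseteq> \<Union>\<G>"
  proof
    fix y assume "y \<in> F"
    obtain e where "e > 0" "measure N (ball y e) < v" using small by blast
    then show "y \<in> \<Union>\<G>" unfolding \<G>_def by (intro UnionI[of "ball y e"]) auto
  qed
  moreover have "open G" if "G \<in> \<G>" for G using that by (auto simp: \<G>_def)
  ultimately obtain e where e: "e > 0" "\<forall>x\<in>F. \<exists>G\<in>\<G>. ball x e \<subseteq> G"
    using Heine_Borel_lemma[OF F, of \<G>] by metis
  \<comment> \<open>The centre need not lie in \<open>F\<close>: a ball missing \<open>F\<close> is
    null, and one meeting \<open>F\<close> at \<open>y\<close> lies in \<open>ball y e\<close> since
    \<open>e/3 + e/3 < e\<close>.\<close>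
  have "measure N (cball x (e/3)) < v" for x
  proof (cases "cball x (e/3) \<inter> F = {}")
    case True
    then have "measure N (cball x (e/3)) \<le> measure N (- F)"
      using F by (intro finite_measure_mono) (auto simp: compact_imp_closed borel_closed)
    then show ?thesis using null v by simp
  next
    case False
    then obtain y where y: "y \<in> F" "dist x y \<le> e/3" by auto
    then obtain G where G: "G \<in> \<G>" "ball y e \<subseteq> G" using e by blast
    have "cball x (e/3) \<subseteq> ball y e"
    proof
      fix z assume "z \<in> cball x (e/3)"
      then have "dist y z \<le> e/3 + e/3" using y(2) dist_triangle3[of y z x] by simp
      then show "z \<in> ball y e" using e(1) by simp
    qed
    then have "measure N (cball x (e/3)) \<le> measure N G"
      using G by (intro finite_measure_mono) (auto simp: \<G>_def)
    then show ?thesis using G(1) by (auto simp: \<G>_def)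
  qed
  then show ?thesis using e(1) by (intro exI[of _ "e/3"]) auto
qed

text \<open>
  A ball of almost minimal radius among those of mass at least \<open>v\<close>: all balls of half the radius
  are lighter than \<open>v\<close>, so that deleting even the doubled ball costs only a multiple of \<open>v\<close>.
\<close>

lemma heavy_ball_of_almost_minimal_radius:
  fixes N :: "'a::euclidean_space measure" and v :: real
  assumes fin: "finite_measure N" and sets: "sets N = sets borel" and F: "compact F"
    and null: "measure N (- F) = 0" and atom: "\<And>x. measure N {x} = 0" and v: "v > 0"
    and T: "finite T" "cball (0::'a) 2 \<subseteq> (\<Union>p\<in>T. cball p (1/2))"
    and W: "W \<in> sets borel" "measure N W + v \<le> measure N UNIV"
  shows "\<exists>x \<rho>. \<rho> > 0 \<and> v \<le> measure N (cball x \<rho> - W) \<and>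
    measure N (W \<union> cball x (2 * \<rho>)) \<le> measure N W + card T * v"
proof -
  interpret finite_measure N by (rule fin)
  have "- F \<in> sets borel" using F by (intro borel_comp borel_compact)
  note [simp] = sets W(1) this
  obtain \<delta> where \<delta>: "\<delta> > 0" "\<And>x. measure N (cball x \<delta>) < v"
    using nonatomic_small_balls[OF fin sets F null atom v] by blast
  define R where "R = {\<rho>. \<rho> > 0 \<and> (\<exists>x. v \<le> measure N (cball x \<rho> - W))}"
  have lower: "\<delta> \<le> \<rho>" if \<rho>R: "\<rho> \<in> R" for \<rho>
  proof (rule ccontr)
    assume "\<not> \<delta> \<le> \<rho>"
    moreover obtain x where "v \<le> measure N (cball x \<rho> - W)" using \<rho>R by (auto simp: R_def)
    moreover have "measure N (cball x \<rho> - W) \<le> measure N (cball x \<delta>)"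
      using \<open>\<not> \<delta> \<le> \<rho>\<close> by (intro finite_measure_mono) auto
    ultimately show False using \<delta>(2)[of x] by simp
  qed
  obtain \<rho>0 where \<rho>0: "\<rho>0 > 0" "\<And>x. x \<in> F \<Longrightarrow> norm x \<le> \<rho>0"
    using compact_imp_bounded[OF F] by (auto simp: bounded_pos)
  \<comment> \<open>A ball containing all of \<open>F\<close> carries the mass left over by
    \<open>W\<close>, so the set \<open>R\<close> of admissible radii is nonempty.\<close>
  have "measure N UNIV \<le> measure N (W \<union> (cball 0 \<rho>0 - W) \<union> (- F))"
    using \<rho>0 by (intro finite_measure_mono) (auto intro!: sets.Un)
  also have "\<dots> \<le> measure N W + measure N (cball 0 \<rho>0 - W) + measure N (- F)"
    using F by (intro order_trans[OF measure_Un_le] add_mono order.refl measure_Un_le)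
      (auto simp: compact_imp_closed borel_closed)
  finally have "\<rho>0 \<in> R" using W(2) null \<rho>0(1) by (auto simp: R_def intro!: exI[of _ 0])
  then have Rne: "R \<noteq> {}" by auto
  have "\<delta> \<le> Inf R" using Rne lower by (rule cInf_greatest)
  then have I: "Inf R > 0" using \<delta>(1) by simp
  \<comment> \<open>The infimum need not be attained; a radius below twice its value suffices, since
    then \<open>\<rho> / 2\<close> is not admissible for any centre.\<close>
  then obtain \<rho> where \<rho>: "\<rho> \<in> R" "\<rho> < 2 * Inf R"
    using cInf_lessD[OF Rne, of "2 * Inf R"] by auto
  have bdd: "bdd_below R" using lower by (intro bdd_belowI)
  have "\<rho> / 2 \<notin> R" using cInf_lower[OF _ bdd, of "\<rho> / 2"] \<rho>(2) by auto
  then have half: "measure N (cball y (\<rho> / 2) - W) < v" for y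
    using \<rho>(1) by (auto simp: R_def not_le)
  obtain x where x: "\<rho> > 0" "v \<le> measure N (cball x \<rho> - W)" using \<rho>(1) by (auto simp: R_def)
  \<comment> \<open>The cover \<open>T\<close> of the ball of radius 2, scaled by
    \<open>\<rho>\<close> and moved to \<open>x\<close>.\<close>
  have cover: "W \<union> cball x (2 * \<rho>) \<subseteq> W \<union> (\<Union>p\<in>T. cball (x + \<rho> *\<^sub>R p) (\<rho> / 2) - W)"
  proof -
    have "\<exists>p\<in>T. z \<in> cball (x + \<rho> *\<^sub>R p) (\<rho> / 2)" if "z \<in> cball x (2 * \<rho>)" for z
    proof -
      define y where "y = (z - x) /\<^sub>R \<rho>"
      have z: "z = x + \<rho> *\<^sub>R y" using x(1) by (simp add: y_def)
      have "norm (z - x) \<le> 2 * \<rho>" using that by (simp add: dist_norm norm_minus_commute)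
      moreover have "norm y = norm (z - x) / \<rho>" using x(1) by (simp add: y_def divide_inverse mult.commute)
      ultimately have "y \<in> cball 0 2" using x(1) by (simp add: pos_divide_le_eq)
      then obtain p where p: "p \<in> T" "y \<in> cball p (1/2)" using T(2) by blast
      have "(x + \<rho> *\<^sub>R p) - z = \<rho> *\<^sub>R (p - y)" by (simp add: z algebra_simps)
      then have "dist (x + \<rho> *\<^sub>R p) z = \<rho> * dist p y" using x(1) by (simp add: dist_norm)
      also have "\<dots> \<le> \<rho> * (1/2)" using p(2) x(1) by (intro mult_left_mono) auto
      finally show ?thesis using p(1) by auto
    qed
    then show ?thesis by blast
  qed
  have "measure N (W \<union> cball x (2 * \<rho>)) \<le> measure N (W \<union> (\<Union>p\<in>T. cball (x + \<rho> *\<^sub>R p) (\<rho> / 2) - W))"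
    using cover T(1) by (intro finite_measure_mono) (auto intro!: sets.finite_UN)
  also have "\<dots> \<le> measure N W + measure N (\<Union>p\<in>T. cball (x + \<rho> *\<^sub>R p) (\<rho> / 2) - W)"
    using T(1) by (intro measure_Un_le) (auto intro!: sets.finite_UN)
  also have "\<dots> \<le> measure N W + (\<Sum>p\<in>T. measure N (cball (x + \<rho> *\<^sub>R p) (\<rho> / 2) - W))"
    using T(1) by (intro add_left_mono measure_UNION_le) auto
  also have "\<dots> \<le> measure N W + (\<Sum>p\<in>T. v)"
    using half by (intro add_left_mono sum_mono) (auto intro: less_imp_le)
  finally show ?thesis using x by (intro exI[of _ x] exI[of _ \<rho>]) simp
qed

text \<open>Induction with the invariant that the first \<open>l\<close> doubled balls have mass at
  most \<open>l * card T * v\<close>. For \<open>l < m\<close> the total mass then leaves at least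
  \<open>v\<close> for the next ball.\<close>

lemma ball_selection:
  fixes N :: "'a::euclidean_space measure" and v :: real
  assumes fin: "finite_measure N" and sets: "sets N = sets borel" and F: "compact F"
    and null: "measure N (- F) = 0" and atom: "\<And>x. measure N {x} = 0" and v: "v > 0"
    and T: "finite T" "cball (0::'a) 2 \<subseteq> (\<Union>p\<in>T. cball p (1/2))"
    and m: "real m * card T * v \<le> measure N UNIV"
  shows "\<exists>x r. \<forall>i<m. r i > 0 \<and> v \<le> measure N (cball (x i) (r i) - (\<Union>j<i. cball (x j) (2 * r j)))"
proof -
  have "T \<noteq> {}" using T(2) by auto
  then have cT: "card T \<ge> 1" using T(1) by (simp add: Suc_leI card_gt_0_iff)
  have "\<exists>x r. (\<forall>i<l. r i > 0 \<and> v \<le> measure N (cball (x i) (r i) - (\<Union>j<i. cball (x j) (2 * r j)))) \<and>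
     measure N (\<Union>j<l. cball (x j) (2 * r j)) \<le> real l * card T * v" if "l \<le> m" for l
    using that
  proof (induction l)
    case 0
    then show ?case by simp
  next
    case (Suc l)
    then obtain x r where xr: "\<And>i. i < l \<Longrightarrow> r i > 0 \<and> v \<le> measure N (cball (x i) (r i) - (\<Union>j<i. cball (x j) (2 * r j)))"
      "measure N (\<Union>j<l. cball (x j) (2 * r j)) \<le> real l * card T * v" by auto
    define W where "W = (\<Union>j<l. cball (x j) (2 * r j))"
    have "real l * card T * v + 1 * v \<le> real l * card T * v + card T * v"
      using cT v by (intro add_left_mono mult_right_mono) auto
    also have "\<dots> = real (Suc l) * card T * v" by (simp add: algebra_simps)
    also have "\<dots> \<le> real m * card T * v" using Suc.prems v by (intro mult_right_mono) auto
    finally have "measure N W + v \<le> measure N UNIV" using xr(2) m by (simp add: W_def)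
    moreover have "W \<in> sets borel" by (auto simp: W_def)
    ultimately obtain y \<rho> where y: "\<rho> > 0" "v \<le> measure N (cball y \<rho> - W)"
      "measure N (W \<union> cball y (2 * \<rho>)) \<le> measure N W + card T * v"
      using heavy_ball_of_almost_minimal_radius[OF fin sets F null atom v T] by blast
    define x' r' where "x' = x(l := y)" and "r' = r(l := \<rho>)"
    have same: "(\<Union>j<i. cball (x' j) (2 * r' j)) = (\<Union>j<i. cball (x j) (2 * r j))" if "i \<le> l" for i
      using that by (intro SUP_cong) (auto simp: x'_def r'_def)
    have "(\<Union>j<Suc l. cball (x' j) (2 * r' j)) = W \<union> cball y (2 * \<rho>)"
      unfolding lessThan_Suc using same[of l] by (auto simp: x'_def r'_def W_def)
    then have "measure N (\<Union>j<Suc l. cball (x' j) (2 * r' j)) \<le> real (Suc l) * card T * v"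
      using y(3) xr(2) by (simp add: W_def algebra_simps)
    moreover have "r' i > 0 \<and> v \<le> measure N (cball (x' i) (r' i) - (\<Union>j<i. cball (x' j) (2 * r' j)))"
      if "i < Suc l" for i
    proof (cases "i = l")
      case True
      then show ?thesis using y same[of l] by (simp add: x'_def r'_def W_def)
    next
      case False
      then show ?thesis using that xr(1)[of i] same[of i] by (simp add: x'_def r'_def)
    qed
    ultimately show ?case by blast
  qed
  from this[of m] show ?thesis by blast
qed

subsection \<open>Isoperimetric inequalities by projection\<close>

definition axis_point :: "(nat \<Rightarrow> 'a::euclidean_space) \<Rightarrow> 'a \<Rightarrow> nat \<Rightarrow> 'a \<Rightarrow> 'a" where
  "axis_point e z i x = x + (\<Sum>j<i. (z \<bullet> e j) *\<^sub>R e j)"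

text \<open>The path from \<open>x\<close> to \<open>x + z\<close> changes the coordinates one after another, in the order given by \<open>e\<close>.\<close>

definition axis_path_meets :: "(nat \<Rightarrow> 'a::euclidean_space) \<Rightarrow> 'a \<Rightarrow> 'a set \<Rightarrow> 'a \<Rightarrow> bool" where
  "axis_path_meets e z Z x \<longleftrightarrow>
     (\<exists>i<DIM('a). closed_segment (axis_point e z i x) (axis_point e z (Suc i) x) \<inter> Z \<noteq> {})"

text \<open>Up to translation, the box contains all points from which a set of diameter
  \<open>d\<close> can be reached by a move of length at most \<open>S\<close> along
  \<open>b0\<close>. The constant uses \<open>d + S \<le> 2 * S\<close>.\<close>

lemma emeasure_axis_box:
  fixes c :: "'a::euclidean_space"
  assumes b0: "b0 \<in> Basis" and d: "0 \<le> d" "d \<le> S"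
  defines "w \<equiv> \<Sum>b\<in>Basis. (if b = b0 then d + S else d) *\<^sub>R b"
  shows "emeasure lborel (cbox (c - w) (c + w)) \<le> ennreal (2 ^ (DIM('a) + 1) * S * d ^ (DIM('a) - 1))"
proof -
  have wb: "w \<bullet> b = (if b = b0 then d + S else d)" if "b \<in> Basis" for b
    using that by (simp add: w_def)
  have "emeasure lborel (cbox (c - w) (c + w)) = ennreal (\<Prod>b\<in>Basis. ((c + w) - (c - w)) \<bullet> b)"
    using d wb by (intro emeasure_lborel_cbox) (auto simp: inner_diff_left inner_add_left)
  also have "(\<Prod>b\<in>Basis. ((c + w) - (c - w)) \<bullet> b) = (\<Prod>b\<in>Basis. if b = b0 then 2 * (d + S) else 2 * d)"
    by (intro prod.cong) (auto simp: inner_diff_left inner_add_left wb)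
  also have "\<dots> = 2 * (d + S) * (2 * d) ^ (DIM('a) - 1)"
    using b0 by (subst prod.remove[of _ b0]) (auto simp: card_Diff_singleton)
  also have "\<dots> \<le> 4 * S * (2 * d) ^ (DIM('a) - 1)"
    using d by (intro mult_right_mono) auto
  also have "\<dots> = 2 ^ (DIM('a) + 1) * S * d ^ (DIM('a) - 1)"
    using DIM_positive[where 'a='a] by (cases "DIM('a)") (auto simp: power_mult_distrib)
  finally show ?thesis by (simp add: ennreal_leI)
qed

text \<open>If the \<open>i\<close>-th segment of the path from \<open>x\<close> hits
  \<open>U m\<close>, then undoing the moves of that path puts \<open>x\<close> in a box that is
  long only in the direction \<open>e i\<close>. Each covering set thus accounts for one box per
  axis.\<close>

lemma emeasure_axis_path_meets_le:
  fixes P :: "'a::euclidean_space set" and S :: real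
  assumes e: "bij_betw e {..<DIM('a)} Basis"
    and S: "\<And>b. b \<in> Basis \<Longrightarrow> \<bar>z \<bullet> b\<bar> \<le> S"
    and U: "\<And>m::nat. bounded (U m)" "\<And>m. diameter (U m) \<le> S"
    and meets: "\<And>x. x \<in> P \<Longrightarrow> axis_path_meets e z (\<Union>m. U m) x"
  shows "emeasure lborel P \<le>
    (\<Sum>m. if U m = {} then 0
         else ennreal (real DIM('a) * 2 ^ (DIM('a) + 1) * S * diameter (U m) ^ (DIM('a) - 1)))"
proof -
  have S0: "S \<ge> 0" using diameter_ge_0[OF U(1)] U(2) order_trans by blast
  have eB: "e i \<in> Basis" if "i < DIM('a)" for i using e that by (auto simp: bij_betw_def)
  define u where "u m = (SOME y. y \<in> U m)" for m
  have u: "u m \<in> U m" if "U m \<noteq> {}" for m using that by (simp add: u_def some_in_eq)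
  \<comment> \<open>The moves completed before the \<open>i\<close>-th one are the same for all
    \<open>x\<close>, so they only shift the centre; the partial \<open>i\<close>-th move is
    absorbed by the longer side of the box.\<close>
  define c where "c i m = u m - (\<Sum>j<i. (z \<bullet> e j) *\<^sub>R e j)" for i m
  define w where "w i m = (\<Sum>b\<in>Basis. (if b = e i then diameter (U m) + S else diameter (U m)) *\<^sub>R b)" for i m
  define X where "X i m = (if U m = {} then {} else cbox (c i m - w i m) (c i m + w i m))" for i m
  have PX: "P \<subseteq> (\<Union>m. \<Union>i<DIM('a). X i m)"
  proof
    fix x assume "x \<in> P"
    then obtain i m y where i: "i < DIM('a)" and y: "y \<in> U m"
      and seg: "y \<in> closed_segment (axis_point e z i x) (axis_point e z (Suc i) x)"
      using meets unfolding axis_path_meets_def by blast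
    then obtain t where t: "0 \<le> t" "t \<le> 1"
      and yt: "y = (1 - t) *\<^sub>R axis_point e z i x + t *\<^sub>R axis_point e z (Suc i) x"
      by (auto simp: closed_segment_def)
    have "y = axis_point e z i x + t *\<^sub>R ((z \<bullet> e i) *\<^sub>R e i)"
      unfolding yt by (simp add: axis_point_def algebra_simps)
    then have xc: "x - c i m = (y - u m) - (t * (z \<bullet> e i)) *\<^sub>R e i"
      by (simp add: axis_point_def c_def algebra_simps)
    have Um: "U m \<noteq> {}" using y by auto
    have "\<bar>(x - c i m) \<bullet> b\<bar> \<le> w i m \<bullet> b" if b: "b \<in> Basis" for b
    proof -
      have "norm (y - u m) \<le> diameter (U m)"
        using diameter_bounded_bound[OF U(1) y u[OF Um]] by (simp add: dist_norm)
      then have yu: "\<bar>(y - u m) \<bullet> b\<bar> \<le> diameter (U m)" using Basis_le_norm[OF b, of "y - u m"] by simp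
      have "\<bar>t * (z \<bullet> e i)\<bar> \<le> 1 * S"
        unfolding abs_mult using t S[OF eB[OF i]] S0 by (intro mult_mono) auto
      then have "\<bar>(t * (z \<bullet> e i)) * (e i \<bullet> b)\<bar> \<le> (if b = e i then S else 0)"
        using b eB[OF i] by (auto simp: inner_Basis)
      then have "\<bar>(x - c i m) \<bullet> b\<bar> \<le> diameter (U m) + (if b = e i then S else 0)"
        unfolding xc inner_diff_left inner_scaleR_left using yu by (simp only: inner_diff_left)
      then show ?thesis using b by (simp add: w_def split: if_splits)
    qed
    then have "x \<in> X i m" using Um unfolding X_def
      by (auto simp: mem_box inner_diff_left inner_add_left abs_le_iff algebra_simps)
    then show "x \<in> (\<Union>m. \<Union>i<DIM('a). X i m)" using i by blast
  qed
  have Xm: "X i m \<in> sets lborel" for i m by (simp add: X_def)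
  have Xe: "emeasure lborel (X i m) \<le> (if U m = {} then 0
      else ennreal (2 ^ (DIM('a) + 1) * S * diameter (U m) ^ (DIM('a) - 1)))" if "i < DIM('a)" for i m
    using emeasure_axis_box[OF eB[OF that] diameter_ge_0[OF U(1)] U(2), of "c i m" m]
    by (simp add: X_def w_def)
  have "emeasure lborel P \<le> emeasure lborel (\<Union>m. \<Union>i<DIM('a). X i m)"
    using PX Xm by (intro emeasure_mono sets.countable_UN sets.finite_UN) auto
  also have "\<dots> \<le> (\<Sum>m. emeasure lborel (\<Union>i<DIM('a). X i m))"
    using Xm by (intro emeasure_subadditive_countably) auto
  also have "\<dots> \<le> (\<Sum>m. if U m = {} then 0
      else ennreal (real DIM('a) * 2 ^ (DIM('a) + 1) * S * diameter (U m) ^ (DIM('a) - 1)))"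
  proof (intro suminf_le summableI)
    fix m
    have "emeasure lborel (\<Union>i<DIM('a). X i m) \<le> (\<Sum>i<DIM('a). emeasure lborel (X i m))"
      using Xm by (intro emeasure_subadditive_finite) auto
    also have "\<dots> \<le> (\<Sum>i<DIM('a). if U m = {} then 0
      else ennreal (2 ^ (DIM('a) + 1) * S * diameter (U m) ^ (DIM('a) - 1)))"
      using Xe by (intro sum_mono) simp
    also have "\<dots> = (if U m = {} then 0
      else ennreal (real DIM('a) * 2 ^ (DIM('a) + 1) * S * diameter (U m) ^ (DIM('a) - 1)))"
      using S0 diameter_ge_0[OF U(1)[of m]]
      by (simp add: ennreal_of_nat_eq_real_of_nat ennreal_mult[symmetric] mult.assoc)
    finally show "emeasure lborel (\<Union>i<DIM('a). X i m) \<le> \<dots>" .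
  qed
  finally show ?thesis .
qed

text \<open>With the Hausdorff weight \<open>\<omega> * (d / 2) ^ (n - 1)\<close> of a set of
  diameter \<open>d\<close>, the box volume \<open>n * 2 ^ (n + 1) * S * d ^ (n - 1)\<close> is this
  constant times \<open>S\<close> times the weight.\<close>

definition projection_const :: "'a::euclidean_space itself \<Rightarrow> real" where
  "projection_const _ = real DIM('a) * 4 ^ DIM('a) / unit_ball_vol (real (DIM('a) - 1))"

lemma projection_const_pos: "projection_const TYPE('a::euclidean_space) > 0"
  unfolding projection_const_def by (intro divide_pos_pos mult_pos_pos) auto

text \<open>The covering estimate applies to all coverings of mesh at most \<open>S\<close>, so it
  bounds the volume by the premeasure at \<open>\<delta> = S\<close>, which lies below the supremum
  over \<open>\<delta>\<close>.\<close>

lemma emeasure_axis_path_meets_le_hausdorff: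
  fixes P :: "'a::euclidean_space set" and S :: real
  assumes e: "bij_betw e {..<DIM('a)} Basis" and S0: "S > 0"
    and S: "\<And>b. b \<in> Basis \<Longrightarrow> \<bar>z \<bullet> b\<bar> \<le> S"
    and meets: "\<And>x. x \<in> P \<Longrightarrow> axis_path_meets e z Z x"
  shows "emeasure lborel P \<le> ennreal (projection_const TYPE('a) * S) * hausdorff_outer (DIM('a) - 1) Z"
proof -
  define K where "K = projection_const TYPE('a) * S"
  have K: "K > 0" using projection_const_pos[where 'a='a] S0 by (simp add: K_def)
  define \<omega> where "\<omega> = unit_ball_vol (real (DIM('a) - 1))"
  have \<omega>: "\<omega> > 0" by (simp add: \<omega>_def)
  have "emeasure lborel P / ennreal K \<le> hausdorff_pre (DIM('a) - 1) S Z"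
    unfolding hausdorff_pre_def
  proof (intro INF_greatest)
    fix U :: "nat \<Rightarrow> 'a set"
    assume "U \<in> {U. Z \<subseteq> (\<Union>i. U i) \<and> (\<forall>i. bounded (U i) \<and> diameter (U i) \<le> S)}"
    then have U: "Z \<subseteq> (\<Union>i. U i)" "\<And>i. bounded (U i)" "\<And>i. diameter (U i) \<le> S" by auto
    have "axis_path_meets e z (\<Union>i. U i) x" if "x \<in> P" for x
      using meets[OF that] U(1) unfolding axis_path_meets_def by blast
    then have "emeasure lborel P \<le> (\<Sum>m. if U m = {} then 0
         else ennreal (real DIM('a) * 2 ^ (DIM('a) + 1) * S * diameter (U m) ^ (DIM('a) - 1)))"
      by (intro emeasure_axis_path_meets_le[OF e S U(2,3)])
    also have "\<dots> = (\<Sum>m. ennreal K * (if U m = {} then 0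
         else ennreal (\<omega> * (diameter (U m) / 2) ^ (DIM('a) - 1))))"
    proof (intro suminf_cong)
      fix m
      have p: "(2::real) ^ DIM('a) = 2 * 2 ^ (DIM('a) - 1)"
        using DIM_positive[where 'a='a] by (cases "DIM('a)") auto
      have "K * (\<omega> * (diameter (U m) / 2) ^ (DIM('a) - 1))
        = real DIM('a) * 2 ^ (DIM('a) + 1) * S * diameter (U m) ^ (DIM('a) - 1)"
      proof -
        define m' where "m' = DIM('a) - 1"
        have 4: "(4::real) ^ DIM('a) = 2 ^ (DIM('a) + 1) * 2 ^ m'"
        proof -
          have "(4::real) ^ DIM('a) = 4 * 4 ^ m'"
            using DIM_positive[where 'a='a] by (cases "DIM('a)") (auto simp: m'_def)
          then show ?thesis using power_mult_distrib[of 2 "2::real" m'] p by (simp add: m'_def)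
        qed
        have "K * \<omega> = real DIM('a) * 4 ^ DIM('a) * S"
        proof -
          have "K = real DIM('a) * 4 ^ DIM('a) / \<omega> * S" unfolding K_def projection_const_def \<omega>_def ..
          then show ?thesis using \<omega> by simp
        qed
        then have "K * (\<omega> * (diameter (U m) / 2) ^ m') = real DIM('a) * 4 ^ DIM('a) * S * (diameter (U m) / 2) ^ m'"
          by (simp only: mult.assoc[symmetric])
        then show ?thesis unfolding m'_def[symmetric] by (simp add: 4 power_divide)
      qed
      then show "(if U m = {} then 0
         else ennreal (real DIM('a) * 2 ^ (DIM('a) + 1) * S * diameter (U m) ^ (DIM('a) - 1)))
         = ennreal K * (if U m = {} then 0 else ennreal (\<omega> * (diameter (U m) / 2) ^ (DIM('a) - 1)))"
        using K \<omega> diameter_ge_0[OF U(2)[of m]] by (simp add: ennreal_mult[symmetric])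
    qed
    also have "\<dots> = ennreal K * (\<Sum>m. if U m = {} then 0
         else ennreal (\<omega> * (diameter (U m) / 2) ^ (DIM('a) - 1)))"
      by (rule ennreal_suminf_cmult)
    finally show "emeasure lborel P / ennreal K \<le> (\<Sum>i. if U i = {} then 0
      else ennreal (unit_ball_vol (real (DIM('a) - 1)) * (diameter (U i) / 2) ^ (DIM('a) - 1)))"
      unfolding \<omega>_def using K by (intro divide_le_posI_ennreal) simp_all
  qed
  also have "\<dots> \<le> hausdorff_outer (DIM('a) - 1) Z"
    unfolding hausdorff_outer_def using S0 by (intro SUP_upper) simp
  finally have "ennreal K * (emeasure lborel P / ennreal K) \<le> ennreal K * hausdorff_outer (DIM('a) - 1) Z"
    by (intro mult_left_mono) auto
  also have "ennreal K * (emeasure lborel P / ennreal K) = emeasure lborel P"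
    using K by (simp add: ennreal_times_divide mult.commute[of "ennreal K"] ennreal_mult_divide_eq)
  finally show ?thesis by (simp add: K_def)
qed

text \<open>The corners of the path start in \<open>A\<close> and end outside, so some segment has
  its first endpoint in \<open>A\<close> and its second outside; a connected set of this kind meets
  the frontier.\<close>

lemma axis_path_meets_frontier:
  fixes x :: "'a::euclidean_space"
  assumes e: "bij_betw e {..<DIM('a)} Basis" and x: "x \<in> A" "x + z \<notin> A"
  shows "axis_path_meets e z (frontier A) x"
proof -
  have "(\<Sum>j<DIM('a). (z \<bullet> e j) *\<^sub>R e j) = (\<Sum>b\<in>Basis. (z \<bullet> b) *\<^sub>R b)"
    by (rule sum.reindex_bij_betw[OF e, of "\<lambda>b. (z \<bullet> b) *\<^sub>R b"])
  then have "axis_point e z (DIM('a)) x = x + z"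
    by (simp add: axis_point_def euclidean_representation)
  then have n: "axis_point e z (DIM('a)) x \<notin> A" using x by simp
  have 0: "\<not> axis_point e z 0 x \<notin> A" using x by (simp add: axis_point_def)
  obtain i where i: "i < DIM('a)" "axis_point e z i x \<in> A" "axis_point e z (Suc i) x \<notin> A"
    using ex_least_nat_less[of "\<lambda>i. axis_point e z i x \<notin> A", OF n 0] by auto
  have "closed_segment (axis_point e z i x) (axis_point e z (Suc i) x) \<inter> frontier A \<noteq> {}"
    by (rule connected_Int_frontier) (use i in auto)
  then show ?thesis using i(1) by (auto simp: axis_path_meets_def)
qed

text \<open>Each coordinate of a corner is that of \<open>x\<close> or of \<open>x + z\<close>, so
  all corners lie in the box, and by convexity so do the segments. This localises the boundary that
  the path meets.\<close>

lemma axis_path_meets_box: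
  fixes x :: "'a::euclidean_space"
  assumes e: "bij_betw e {..<DIM('a)} Basis" and Q: "x \<in> cbox a b" "x + z \<in> cbox a b"
    and meets: "axis_path_meets e z Z x"
  shows "axis_path_meets e z (Z \<inter> cbox a b) x"
proof -
  have eB: "e i \<in> Basis" if "i < DIM('a)" for i using e that by (auto simp: bij_betw_def)
  have inj: "e i = e j \<longleftrightarrow> i = j" if "i < DIM('a)" "j < DIM('a)" for i j
    using e that by (auto simp: bij_betw_def inj_on_def)
  have mem: "axis_point e z i x \<in> cbox a b" if i: "i \<le> DIM('a)" for i
    unfolding mem_box
  proof
    fix b' :: 'a assume "b' \<in> Basis"
    then obtain l where l: "l < DIM('a)" "b' = e l" using e by (auto simp: bij_betw_def)
    have "axis_point e z i x \<bullet> b' = x \<bullet> b' + (\<Sum>j<i. (z \<bullet> e j) * (e j \<bullet> e l))"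
      by (simp add: axis_point_def inner_add_left inner_sum_left l)
    also have "(\<Sum>j<i. (z \<bullet> e j) * (e j \<bullet> e l)) = (\<Sum>j<i. if j = l then z \<bullet> e l else 0)"
      using l i inj eB by (intro sum.cong) (auto simp: inner_Basis)
    also have "\<dots> = (if l < i then z \<bullet> e l else 0)" by simp
    finally have "axis_point e z i x \<bullet> b' = x \<bullet> b' \<or> axis_point e z i x \<bullet> b' = (x + z) \<bullet> b'"
      by (auto simp: l inner_add_left)
    then show "a \<bullet> b' \<le> axis_point e z i x \<bullet> b' \<and> axis_point e z i x \<bullet> b' \<le> b \<bullet> b'"
      using Q \<open>b' \<in> Basis\<close> by (auto simp: mem_box)
  qed
  have "closed_segment (axis_point e z i x) (axis_point e z (Suc i) x) \<subseteq> cbox a b" if "i < DIM('a)" for i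
    by (rule closed_segment_subset) (use that mem in \<open>auto simp: convex_box\<close>)
  then show ?thesis using meets unfolding axis_path_meets_def by blast
qed

text \<open>Fubini for the pairs with \<open>x \<in> A\<close>, \<open>z \<in> C\<close>,
  \<open>x + z \<in> B\<close>. It turns projection estimates for fixed \<open>z\<close> into
  estimates of densities around \<open>x\<close>.\<close>

lemma nn_integral_translates_swap:
  fixes A B C :: "'a::euclidean_space set"
  assumes [measurable]: "A \<in> sets borel" "B \<in> sets borel" "C \<in> sets borel"
  shows "(\<integral>\<^sup>+z. emeasure lborel {x\<in>A. x + z \<in> B} * indicator C z \<partial>lborel)
    = (\<integral>\<^sup>+x. emeasure lborel {z\<in>C. x + z \<in> B} * indicator A x \<partial>lborel)"
proof -
  have "(\<integral>\<^sup>+z. emeasure lborel {x\<in>A. x + z \<in> B} * indicator C z \<partial>lborel)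
    = (\<integral>\<^sup>+z. \<integral>\<^sup>+x. indicator A x * indicator C z * indicator B (x + z) \<partial>lborel \<partial>lborel)"
  proof (intro nn_integral_cong)
    fix z :: 'a
    have "emeasure lborel {x\<in>A. x + z \<in> B} * indicator C z
       = (\<integral>\<^sup>+x. indicator {x\<in>A. x + z \<in> B} x * indicator C z \<partial>lborel)"
      by (subst nn_integral_multc) auto
    also have "\<dots> = (\<integral>\<^sup>+x. indicator A x * indicator C z * indicator B (x + z) \<partial>lborel)"
      by (intro nn_integral_cong) (auto simp: indicator_def)
    finally show "emeasure lborel {x\<in>A. x + z \<in> B} * indicator C z = \<dots>" .
  qed
  also have "\<dots> = (\<integral>\<^sup>+x. \<integral>\<^sup>+z. indicator A x * indicator C z * indicator B (x + z) \<partial>lborel \<partial>lborel)"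
    by (rule lborel_pair.Fubini') measurable
  also have "\<dots> = (\<integral>\<^sup>+x. emeasure lborel {z\<in>C. x + z \<in> B} * indicator A x \<partial>lborel)"
  proof (intro nn_integral_cong)
    fix x :: 'a
    have "emeasure lborel {z\<in>C. x + z \<in> B} * indicator A x
       = (\<integral>\<^sup>+z. indicator {z\<in>C. x + z \<in> B} z * indicator A x \<partial>lborel)"
      by (subst nn_integral_multc) auto
    also have "\<dots> = (\<integral>\<^sup>+z. indicator A x * indicator C z * indicator B (x + z) \<partial>lborel)"
      by (intro nn_integral_cong) (auto simp: indicator_def)
    finally show "(\<integral>\<^sup>+z. indicator A x * indicator C z * indicator B (x + z) \<partial>lborel)
      = emeasure lborel {z\<in>C. x + z \<in> B} * indicator A x" by simp
  qed
  finally show ?thesis .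
qed

lemma emeasure_lborel_translate:
  fixes B :: "'a::euclidean_space set"
  assumes [measurable]: "B \<in> sets borel"
  shows "emeasure lborel {z. x + z \<in> B} = emeasure lborel B"
proof -
  have "emeasure lborel B = emeasure (distr lborel borel (\<lambda>z. x + z)) B"
    by (simp add: lborel_distr_plus)
  also have "\<dots> = emeasure lborel {z. x + z \<in> B}"
    by (subst emeasure_distr) (auto simp: vimage_def)
  finally show ?thesis by simp
qed

section \<open>Hausdorff outer measure on the boundary\<close>

text \<open>
  If \<open>hausdorff_outer\<close> were not countably additive, \<^const>\<open>measure_of\<close> would be the null measure; a nonzero
  boundary measure therefore agrees with it on Borel sets.
\<close>

lemma boundary_measure_nonzero:
  fixes \<Omega> :: "'a::euclidean_space set"
  assumes "measure (boundary_measure \<Omega>) (frontier \<Omega>) > 0"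
  shows "finite_measure (boundary_measure \<Omega>)"
    and "\<And>A. A \<in> sets borel \<Longrightarrow> A \<subseteq> frontier \<Omega> \<Longrightarrow>
      emeasure (boundary_measure \<Omega>) A = hausdorff_outer (DIM('a) - 1) A"
proof -
  let ?H = "hausdorff_measure (DIM('a) - 1) :: 'a measure"
  have "emeasure (boundary_measure \<Omega>) (frontier \<Omega>) \<noteq> \<infinity>"
    using assms by (auto simp: measure_def)
  then show "finite_measure (boundary_measure \<Omega>)"
    by (intro finite_measureI) (simp add: sets_boundary_measure)
  have ss: "sigma_sets UNIV (sets borel) = (sets borel :: 'a set set)"
    using sets.sigma_sets_eq[of "borel :: 'a measure"] by simp
  have e: "emeasure ?H A = (if A \<in> sets borel \<and> measure_space UNIV (sets borel) (hausdorff_outer (DIM('a) - 1) :: 'a set \<Rightarrow> ennreal)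
      then hausdorff_outer (DIM('a) - 1) A else 0)" for A :: "'a set"
    unfolding hausdorff_measure_def by (auto simp: emeasure_measure_of_conv ss)
  have sH: "sets ?H = sets borel"
    unfolding hausdorff_measure_def by (simp add: sets_measure_of_conv ss)
  have r: "emeasure (boundary_measure \<Omega>) A = emeasure ?H A" if "A \<subseteq> frontier \<Omega>" for A
    unfolding boundary_measure_def
    using that by (intro emeasure_restrict_space) (auto simp: sH hausdorff_measure_def space_measure_of_conv)
  have ms: "measure_space UNIV (sets borel) (hausdorff_outer (DIM('a) - 1) :: 'a set \<Rightarrow> ennreal)"
  proof (rule ccontr)
    assume "\<not> ?thesis"
    then have "emeasure (boundary_measure \<Omega>) (frontier \<Omega>) = 0" using r[of "frontier \<Omega>"] e by simp
    then show False using assms by (simp add: measure_def)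
  qed
  show "emeasure (boundary_measure \<Omega>) A = hausdorff_outer (DIM('a) - 1) A"
    if "A \<in> sets borel" "A \<subseteq> frontier \<Omega>" for A
    using r[OF that(2)] e ms that(1) by simp
qed

text \<open>The constant covering by \<open>{x}\<close> has diameter zero, and
  \<open>0 ^ s = 0\<close> because \<open>s \<ge> 1\<close>. Hence the boundary measure has no atoms
  in dimension at least 2.\<close>

lemma hausdorff_outer_singleton:
  assumes "s \<ge> 1"
  shows "hausdorff_outer s {x} = 0"
proof -
  have "hausdorff_pre s \<delta> {x} \<le> 0" if "\<delta> > 0" for \<delta>
  proof -
    let ?U = "\<lambda>i::nat. {x}"
    have z: "(\<Sum>i. if ?U i = {} then 0
              else ennreal (unit_ball_vol (real s) * (diameter (?U i) / 2) ^ s)) = 0"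
      using assms by (simp add: power_0_left)
    show ?thesis unfolding hausdorff_pre_def
      by (rule INF_lower2[of ?U]) (use that z in auto)
  qed
  then show ?thesis unfolding hausdorff_outer_def by (intro antisym SUP_least) auto
qed

text \<open>The left side is the volume of the pairs consisting of a point of
  \<open>Q \<inter> \<Omega>\<close> and a point of \<open>Q - \<Omega>\<close>. For each difference
  \<open>z\<close> of such a pair the projection estimate applies inside \<open>Q\<close>, and
  integrating over the possible \<open>z\<close> gives the factor
  \<open>(2 * s) ^ DIM('a)\<close>.\<close>

lemma relative_isoperimetric_cube:
  fixes \<Omega> :: "'a::euclidean_space set"
  assumes \<Omega>: "\<Omega> \<in> sets borel" and s: "s > 0"
    and Q: "Q = cbox a (a + s *\<^sub>R One)"
  shows "emeasure lborel (Q \<inter> \<Omega>) * emeasure lborel (Q - \<Omega>)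
    \<le> ennreal ((2 * s) ^ DIM('a)) * (ennreal (projection_const TYPE('a) * s) * hausdorff_outer (DIM('a) - 1) (frontier \<Omega> \<inter> Q))"
proof -
  obtain e :: "nat \<Rightarrow> 'a" where "bij_betw e {0..<DIM('a)} Basis"
    using ex_bij_betw_nat_finite[OF finite_Basis] by blast
  then have e: "bij_betw e {..<DIM('a)} Basis" by (simp add: atLeast0LessThan)
  \<comment> \<open>This cube contains all differences of two points of \<open>Q\<close>.\<close>
  define C where "C = cbox (- s *\<^sub>R One) (s *\<^sub>R One :: 'a)"
  define X where "X = ennreal (projection_const TYPE('a) * s) * hausdorff_outer (DIM('a) - 1) (frontier \<Omega> \<inter> Q)"
  have [measurable]: "Q \<in> sets borel" "C \<in> sets borel" "\<Omega> \<in> sets borel" using Q \<Omega> by (auto simp: C_def)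
  have Cz: "\<bar>z \<bullet> b\<bar> \<le> s" if "z \<in> C" "b \<in> Basis" for z b
    using that by (auto simp: C_def mem_box abs_le_iff)
  have "emeasure lborel (Q \<inter> \<Omega>) * emeasure lborel (Q - \<Omega>)
     = (\<integral>\<^sup>+x. emeasure lborel (Q - \<Omega>) * indicator (Q \<inter> \<Omega>) x \<partial>lborel)"
    by (subst nn_integral_cmult_indicator) (simp_all add: mult.commute)
  also have "\<dots> = (\<integral>\<^sup>+x. emeasure lborel {z\<in>C. x + z \<in> Q - \<Omega>} * indicator (Q \<inter> \<Omega>) x \<partial>lborel)"
  proof (intro nn_integral_cong)
    fix x
    have "{z\<in>C. x + z \<in> Q - \<Omega>} = {z. x + z \<in> Q - \<Omega>}" if "x \<in> Q"
    proof -
      have "z \<in> C" if "x + z \<in> Q" for z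
        unfolding C_def mem_box
      proof
        fix b :: 'a assume b: "b \<in> Basis"
        have "a \<bullet> b \<le> x \<bullet> b" "x \<bullet> b \<le> a \<bullet> b + s" "a \<bullet> b \<le> x \<bullet> b + z \<bullet> b" "x \<bullet> b + z \<bullet> b \<le> a \<bullet> b + s"
          using b \<open>x \<in> Q\<close> that by (auto simp: Q mem_box inner_add_left)
        then show "(- s *\<^sub>R One) \<bullet> b \<le> z \<bullet> b \<and> z \<bullet> b \<le> (s *\<^sub>R One) \<bullet> b" using b by simp
      qed
      then show ?thesis by blast
    qed
    then show "emeasure lborel (Q - \<Omega>) * indicator (Q \<inter> \<Omega>) x
       = emeasure lborel {z\<in>C. x + z \<in> Q - \<Omega>} * indicator (Q \<inter> \<Omega>) x"
      using emeasure_lborel_translate[of "Q - \<Omega>" x] by (cases "x \<in> Q \<inter> \<Omega>") auto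
  qed
  also have "\<dots> = (\<integral>\<^sup>+z. emeasure lborel {x\<in>Q \<inter> \<Omega>. x + z \<in> Q - \<Omega>} * indicator C z \<partial>lborel)"
    by (rule nn_integral_translates_swap[symmetric]) measurable
  also have "\<dots> \<le> (\<integral>\<^sup>+z. X * indicator C z \<partial>lborel)"
  proof (intro nn_integral_mono)
    fix z
    have "emeasure lborel {x\<in>Q \<inter> \<Omega>. x + z \<in> Q - \<Omega>} \<le> X" if "z \<in> C"
      unfolding X_def
    proof (rule emeasure_axis_path_meets_le_hausdorff[OF e s])
      fix x assume "x \<in> {x\<in>Q \<inter> \<Omega>. x + z \<in> Q - \<Omega>}"
      then show "axis_path_meets e z (frontier \<Omega> \<inter> Q) x"
        unfolding Q by (intro axis_path_meets_box[OF e] axis_path_meets_frontier[OF e]) auto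
    qed (use Cz that in auto)
    then show "emeasure lborel {x\<in>Q \<inter> \<Omega>. x + z \<in> Q - \<Omega>} * indicator C z \<le> X * indicator C z"
      by (auto simp: indicator_def)
  qed
  also have "\<dots> = X * emeasure lborel C" by (subst nn_integral_cmult_indicator) simp_all
  also have "emeasure lborel C = ennreal ((2 * s) ^ DIM('a))"
  proof -
    have "emeasure lborel C = ennreal (\<Prod>b\<in>Basis. (s *\<^sub>R One - (- s *\<^sub>R One :: 'a)) \<bullet> b)"
      unfolding C_def using s by (intro emeasure_lborel_cbox) auto
    also have "(\<Prod>b\<in>Basis. (s *\<^sub>R One - (- s *\<^sub>R One :: 'a)) \<bullet> b) = (\<Prod>b\<in>(Basis::'a set). 2 * s)"
      by (intro prod.cong) (auto simp: inner_diff_left inner_add_left)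
    finally show ?thesis by simp
  qed
  finally show ?thesis by (simp add: X_def mult.commute)
qed

section \<open>Many separated balls carrying boundary\<close>

lemma greedy_separated:
  fixes A :: "'a::euclidean_space set" and N :: nat
  assumes "\<And>N' x. N' < N \<Longrightarrow> \<not> A \<subseteq> (\<Union>i<N'. cball (x i) \<rho>)"
  shows "\<exists>x. \<forall>i<N. x i \<in> A \<and> (\<forall>j<i. \<rho> < dist (x j) (x i))"
proof -
  have "\<exists>x. \<forall>i<m. x i \<in> A \<and> (\<forall>j<i. \<rho> < dist (x j) (x i))" if "m \<le> N" for m
    using that
  proof (induction m)
    case 0
    then show ?case by simp
  next
    case (Suc m)
    then obtain x where x: "\<And>i. i < m \<Longrightarrow> x i \<in> A \<and> (\<forall>j<i. \<rho> < dist (x j) (x i))" by auto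
    have "\<not> A \<subseteq> (\<Union>i<m. cball (x i) \<rho>)" using assms Suc.prems by simp
    then obtain y where y: "y \<in> A" "y \<notin> (\<Union>i<m. cball (x i) \<rho>)" by blast
    then have "\<rho> < dist (x i) y" if "i < m" for i using that by (auto simp: not_le)
    have "\<forall>i<Suc m. (x(m := y)) i \<in> A \<and> (\<forall>j<i. \<rho> < dist ((x(m := y)) j) ((x(m := y)) i))"
      using x y(1) \<open>\<And>i. i < m \<Longrightarrow> \<rho> < dist (x i) y\<close> by (auto simp: less_Suc_eq)
    then show ?case by blast
  qed
  then show ?thesis by blast
qed

text \<open>
  The set of points around which \<open>\<Omega>\<close> fills at least half of a cube of side \<open>r\<close> has volume comparable
  to that of \<open>\<Omega>\<close>, and at each of its boundary points a cube of side \<open>3r\<close> is divided substantially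
  by \<open>\<Omega>\<close>. By projection, many disjoint balls of radius comparable to \<open>r\<close> are needed to cover
  this boundary.
\<close>

lemma separated_boundary_balls:
  fixes \<Omega> :: "'a::euclidean_space set" and V r S M :: real and N :: nat
  defines "n \<equiv> DIM('a)" and "K \<equiv> projection_const TYPE('a)"
  assumes \<Omega>: "\<Omega> \<in> sets borel" and V: "emeasure lborel \<Omega> = ennreal V" "V > 0"
    and M: "hausdorff_outer (n - 1) (frontier \<Omega>) \<le> ennreal M" "M \<ge> 0"
    and r: "r > 0" "4 * K * r * M \<le> V"
    and S: "S > 0" "S ^ n = 4 * V" "12 * real n * r \<le> S"
    and N: "4 * (N * (real n * 2 ^ (n + 1) * S * (12 * real n * r) ^ (n - 1))) \<le> V"
  shows "\<exists>x. \<forall>i<N. ennreal (r ^ (n - 1) / (12 * 6 ^ n * K))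
      \<le> hausdorff_outer (n - 1) (frontier \<Omega> \<inter> cball (x i) (2 * real n * r))
      \<and> (\<forall>j<i. 6 * real n * r < dist (x j) (x i))"
proof -
  have n: "n \<ge> 1" "n > 0" unfolding n_def by (simp_all add: Suc_leI)
  have K: "K > 0" unfolding K_def by (rule projection_const_pos)
  obtain e :: "nat \<Rightarrow> 'a" where "bij_betw e {0..<DIM('a)} Basis"
    using ex_bij_betw_nat_finite[OF finite_Basis] by blast
  then have e: "bij_betw e {..<DIM('a)} Basis" by (simp add: atLeast0LessThan)
  define cube where "cube s = cbox 0 (s *\<^sub>R One :: 'a)" for s :: real
  have ecube: "emeasure lborel (cube s) = ennreal (s ^ n)" if "s > 0" for s
    unfolding cube_def n_def using that by (subst emeasure_lborel_cbox) (auto simp: inner_diff_left)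
  have cz: "\<bar>z \<bullet> b\<bar> \<le> s" if "z \<in> cube s" "b \<in> Basis" for z b s
    using that by (auto simp: cube_def mem_box)
  have [measurable]: "\<Omega> \<in> sets borel" "cube s \<in> sets borel" for s using \<Omega> by (auto simp: cube_def)
  define f where "f x = emeasure lborel {z\<in>cube r. x + z \<in> \<Omega>}" for x
  define g where "g x = emeasure lborel {z\<in>cube r. x + z \<in> - \<Omega>}" for x
  have fg: "f x + g x = ennreal (r ^ n)" for x
  proof -
    have "f x + g x = emeasure lborel ({z\<in>cube r. x + z \<in> \<Omega>} \<union> {z\<in>cube r. x + z \<in> - \<Omega>})"
      unfolding f_def g_def by (intro plus_emeasure) auto
    also have "{z\<in>cube r. x + z \<in> \<Omega>} \<union> {z\<in>cube r. x + z \<in> - \<Omega>} = cube r" by auto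
    finally show ?thesis using ecube r by simp
  qed
  \<comment> \<open>Half the volume of the cube of side \<open>r\<close>: the set \<open>E\<close>
    below consists of the points around which the complement of \<open>\<Omega>\<close> fills at
    most half of it.\<close>
  define h where "h = r ^ n / 2"
  have h: "h > 0" using r by (simp add: h_def)
  define E where "E = {x. g x \<le> ennreal h}"
  have gmeas [measurable]: "g \<in> borel_measurable borel"
  proof -
    have "g = (\<lambda>x. \<integral>\<^sup>+z. indicator (cube r) z * indicator (- \<Omega>) (x + z) \<partial>lborel)"
    proof
      fix x
      have "g x = (\<integral>\<^sup>+z. indicator {z\<in>cube r. x + z \<in> - \<Omega>} z \<partial>lborel)"
        unfolding g_def by (subst nn_integral_indicator) auto
      also have "\<dots> = (\<integral>\<^sup>+z. indicator (cube r) z * indicator (- \<Omega>) (x + z) \<partial>lborel)"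
        by (intro nn_integral_cong) (auto simp: indicator_def)
      finally show "g x = \<dots>" .
    qed
    then show ?thesis by simp
  qed
  have [measurable]: "E \<in> sets borel" unfolding E_def by measurable
  have fE: "f x \<ge> ennreal h" if "x \<in> E" for x
  proof -
    have "ennreal h + ennreal h = f x + g x"
      using h fg by (simp add: ennreal_plus[symmetric] h_def del: ennreal_plus)
    also have "\<dots> \<le> f x + ennreal h" using that by (intro add_left_mono) (simp add: E_def)
    finally show ?thesis by (simp add: ennreal_add_left_cancel_le add.commute)
  qed
  \<comment> \<open>Few points leave \<open>\<Omega>\<close> under a translation of size
    \<open>r\<close>; this is where the hypothesis \<open>4 * K * r * M \<le> V\<close>
    enters.\<close>
  have KM: "emeasure lborel {x\<in>\<Omega>. x + z \<in> - \<Omega>} \<le> ennreal (V / 4)" if "z \<in> cube r" for z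
  proof -
    have "emeasure lborel {x\<in>\<Omega>. x + z \<in> - \<Omega>} \<le> ennreal (K * r) * hausdorff_outer (n - 1) (frontier \<Omega>)"
      unfolding K_def n_def
      by (rule emeasure_axis_path_meets_le_hausdorff[OF e r(1)])
        (use cz[OF that] in \<open>auto intro: axis_path_meets_frontier[OF e]\<close>)
    also have "\<dots> \<le> ennreal (K * r) * ennreal M" by (intro mult_left_mono M) simp
    also have "\<dots> = ennreal (K * r * M)" using K r M by (simp add: ennreal_mult)
    also have "\<dots> \<le> ennreal (V / 4)" using r by (intro ennreal_leI) simp
    finally show ?thesis .
  qed
  \<comment> \<open>On \<open>\<Omega> - E\<close> the function \<open>g\<close> exceeds
    \<open>h\<close>. Averaging the preceding bound over \<open>z\<close> gives
    \<open>h * |\<Omega> - E| \<le> r ^ n * V / 4\<close>, so at least half of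
    \<open>\<Omega>\<close> lies in \<open>E\<close>.\<close>
  have EV: "ennreal (V / 2) \<le> emeasure lborel E"
  proof -
    have "ennreal h * emeasure lborel (\<Omega> - E) = (\<integral>\<^sup>+x. ennreal h * indicator (\<Omega> - E) x \<partial>lborel)"
      by (simp add: nn_integral_cmult_indicator)
    also have "\<dots> \<le> (\<integral>\<^sup>+x. emeasure lborel {z\<in>cube r. x + z \<in> - \<Omega>} * indicator \<Omega> x \<partial>lborel)"
      by (intro nn_integral_mono) (auto simp: indicator_def E_def g_def)
    also have "\<dots> = (\<integral>\<^sup>+z. emeasure lborel {x\<in>\<Omega>. x + z \<in> - \<Omega>} * indicator (cube r) z \<partial>lborel)"
      by (rule nn_integral_translates_swap[symmetric]) auto
    also have "\<dots> \<le> (\<integral>\<^sup>+z. ennreal (V / 4) * indicator (cube r) z \<partial>lborel)"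
      using KM by (intro nn_integral_mono) (auto simp: indicator_def)
    also have "\<dots> = ennreal (V / 4) * ennreal (r ^ n)"
      using ecube[OF r(1)] by (simp add: nn_integral_cmult_indicator)
    also have "\<dots> = ennreal h * ennreal (V / 2)"
      using V(2) r by (simp add: ennreal_mult[symmetric] h_def mult.commute)
    finally have le: "ennreal h * emeasure lborel (\<Omega> - E) \<le> ennreal h * ennreal (V / 2)" .
    then have le: "emeasure lborel (\<Omega> - E) \<le> ennreal (V / 2)"
      using h by (subst (asm) ennreal_mult_le_mult_iff) auto
    have "ennreal V = emeasure lborel (\<Omega> \<inter> E) + emeasure lborel (\<Omega> - E)"
      unfolding V(1)[symmetric] by (subst plus_emeasure) (auto simp: Int_Diff_Un)
    also have "\<dots> \<le> emeasure lborel E + ennreal (V / 2)"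
      by (intro add_mono le emeasure_mono) auto
    finally have "ennreal (V / 2) + ennreal (V / 2) \<le> emeasure lborel E + ennreal (V / 2)"
      using V(2) by (simp add: ennreal_plus[symmetric] del: ennreal_plus)
    then show ?thesis using V(2) by (simp add: ennreal_add_left_cancel_le add.commute)
  qed
  have EV2: "emeasure lborel E \<le> ennreal (2 * V)"
  proof -
    have "ennreal h * emeasure lborel E = (\<integral>\<^sup>+x. ennreal h * indicator E x \<partial>lborel)"
      by (simp add: nn_integral_cmult_indicator)
    also have "\<dots> \<le> (\<integral>\<^sup>+x. emeasure lborel {z\<in>cube r. x + z \<in> \<Omega>} * indicator UNIV x \<partial>lborel)"
      using fE by (intro nn_integral_mono) (auto simp: indicator_def f_def)
    also have "\<dots> = (\<integral>\<^sup>+z. emeasure lborel {x\<in>UNIV. x + z \<in> \<Omega>} * indicator (cube r) z \<partial>lborel)"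
      by (rule nn_integral_translates_swap[symmetric]) auto
    also have "\<dots> = (\<integral>\<^sup>+z. ennreal V * indicator (cube r) z \<partial>lborel)"
      using emeasure_lborel_translate[OF \<Omega>] V by (simp add: add.commute)
    also have "\<dots> = ennreal V * ennreal (r ^ n)"
      using ecube[OF r(1)] by (simp add: nn_integral_cmult_indicator)
    also have "\<dots> = ennreal h * ennreal (2 * V)"
      using V(2) r by (simp add: ennreal_mult[symmetric] h_def mult.commute)
    finally show ?thesis
      using h by (subst (asm) ennreal_mult_le_mult_iff) auto
  qed
  \<comment> \<open>Near a frontier point of \<open>E\<close> there are a point in \<open>E\<close>
    and one outside. Their cubes of side \<open>r\<close> lie in a common cube \<open>Q\<close> of
    side \<open>3 * r\<close>, so both \<open>\<Omega>\<close> and its complement have volume at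
    least \<open>h\<close> in \<open>Q\<close>, and the relative isoperimetric inequality
    applies.\<close>
  have rich: "ennreal (r ^ (n - 1) / (12 * 6 ^ n * K)) \<le> hausdorff_outer (n - 1) (frontier \<Omega> \<inter> cball x (2 * real n * r))"
    if x: "x \<in> frontier E" for x
  proof -
    obtain y y' where y: "y \<in> E" "dist x y < r" and y': "y' \<notin> E" "dist x y' < r"
      using x r(1) unfolding frontier_straddle by blast
    define Q where "Q = cbox (x - r *\<^sub>R One) ((x - r *\<^sub>R One) + (3 * r) *\<^sub>R One)"
    have [measurable]: "Q \<in> sets borel" by (simp add: Q_def)
    have inQ: "w + z \<in> Q" if "dist x w < r" "z \<in> cube r" for w z
      unfolding Q_def mem_box
    proof
      fix b :: 'a assume b: "b \<in> Basis"
      have "\<bar>(x - w) \<bullet> b\<bar> < r"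
        using Basis_le_norm[OF b, of "x - w"] that(1) by (simp add: dist_norm)
      moreover have "0 \<le> z \<bullet> b" "z \<bullet> b \<le> r" using that(2) b by (auto simp: cube_def mem_box)
      ultimately show "(x - r *\<^sub>R One) \<bullet> b \<le> (w + z) \<bullet> b \<and> (w + z) \<bullet> b \<le> (x - r *\<^sub>R One + (3 * r) *\<^sub>R One) \<bullet> b"
        using b by (auto simp: inner_add_left inner_diff_left)
    qed
    have "ennreal h \<le> f y" by (rule fE[OF y(1)])
    also have "\<dots> \<le> emeasure lborel {z. y + z \<in> Q \<inter> \<Omega>}"
      unfolding f_def using inQ[OF y(2)] by (intro emeasure_mono) auto
    also have "\<dots> = emeasure lborel (Q \<inter> \<Omega>)" by (rule emeasure_lborel_translate) simp
    finally have 1: "ennreal h \<le> emeasure lborel (Q \<inter> \<Omega>)" .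
    have "ennreal h \<le> g y'" using y'(1) by (simp add: E_def)
    also have "\<dots> \<le> emeasure lborel {z. y' + z \<in> Q - \<Omega>}"
      unfolding g_def using inQ[OF y'(2)] by (intro emeasure_mono) auto
    also have "\<dots> = emeasure lborel (Q - \<Omega>)" by (rule emeasure_lborel_translate) simp
    finally have 2: "ennreal h \<le> emeasure lborel (Q - \<Omega>)" .
    define H where "H = hausdorff_outer (n - 1) (frontier \<Omega> \<inter> Q)"
    define B where "B = (6 * r) ^ n * (K * (3 * r))"
    have B: "B > 0" using r K by (simp add: B_def)
    have "ennreal (h * h) = ennreal h * ennreal h" using h by (simp add: ennreal_mult)
    also have "\<dots> \<le> emeasure lborel (Q \<inter> \<Omega>) * emeasure lborel (Q - \<Omega>)" by (intro mult_mono 1 2) auto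
    also have "\<dots> \<le> ennreal ((2 * (3 * r)) ^ n) * (ennreal (K * (3 * r)) * H)"
      unfolding n_def K_def H_def by (rule relative_isoperimetric_cube[OF \<Omega> _ Q_def]) (use r in simp)
    also have "\<dots> = ennreal B * H" using K r by (simp add: B_def ennreal_mult mult.assoc)
    finally have 3: "ennreal (h * h) \<le> ennreal B * H" .
    have "h * h = B * (r ^ (n - 1) / (12 * 6 ^ n * K))"
    proof -
      have rn: "r ^ n = r * r ^ (n - 1)" using n by (cases n) auto
      show ?thesis using K r by (simp add: B_def h_def rn power_mult_distrib field_simps)
    qed
    then have "ennreal B * ennreal (r ^ (n - 1) / (12 * 6 ^ n * K)) \<le> ennreal B * H"
      using 3 B K r by (simp add: ennreal_mult[symmetric])
    then have "ennreal (r ^ (n - 1) / (12 * 6 ^ n * K)) \<le> H"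
      using B by (subst (asm) ennreal_mult_le_mult_iff) auto
    also have "H \<le> hausdorff_outer (n - 1) (frontier \<Omega> \<inter> cball x (2 * real n * r))"
    proof -
      have "Q \<subseteq> cball x (2 * real n * r)"
      proof
        fix w assume w: "w \<in> Q"
        have "norm (w - x) \<le> (\<Sum>b\<in>Basis. \<bar>(w - x) \<bullet> b\<bar>)" by (rule norm_le_l1)
        also have "\<dots> \<le> (\<Sum>b\<in>(Basis::'a set). 2 * r)"
        proof (intro sum_mono)
          fix b :: 'a assume b: "b \<in> Basis"
          have "x \<bullet> b - r \<le> w \<bullet> b" "w \<bullet> b \<le> x \<bullet> b - r + 3 * r"
            using w b by (auto simp: Q_def mem_box inner_add_left inner_diff_left)
          then show "\<bar>(w - x) \<bullet> b\<bar> \<le> 2 * r" using r by (simp add: inner_diff_left abs_le_iff)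
        qed
        finally show "w \<in> cball x (2 * real n * r)" by (simp add: n_def dist_norm norm_minus_commute mult_ac)
      qed
      then have "frontier \<Omega> \<inter> Q \<subseteq> frontier \<Omega> \<inter> cball x (2 * real n * r)" by blast
      then have "hausdorff_pre s \<delta> (frontier \<Omega> \<inter> Q) \<le> hausdorff_pre s \<delta> (frontier \<Omega> \<inter> cball x (2 * real n * r))" for s \<delta>
        unfolding hausdorff_pre_def by (intro INF_superset_mono) auto
      then show ?thesis unfolding H_def hausdorff_outer_def by (intro SUP_mono) blast
    qed
    finally show ?thesis .
  qed
  \<comment> \<open>For a cover by \<open>N'\<close> balls, the pairs \<open>x \<in> E\<close>,
    \<open>z \<in> cube S\<close> with \<open>x + z\<close> outside \<open>E\<close> are estimated
    in two ways: their volume is at least \<open>V * V\<close> and at most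
    \<open>4 * N' * Y * V\<close>, contrary to the choice of \<open>N\<close>.\<close>
  have nocover: "\<not> frontier E \<subseteq> (\<Union>i<N'. cball (x i) (6 * real n * r))" if N': "N' < N" for N' x
  proof
    assume cov: "frontier E \<subseteq> (\<Union>i<N'. cball (x i) (6 * real n * r))"
    define U where "U i = (if i < N' then cball (x i) (6 * real n * r) else {})" for i
    have dU: "diameter (U i) = (if i < N' then 12 * real n * r else 0)" for i using r n by (auto simp: U_def mult_less_0_iff)
    define Y where "Y = real n * 2 ^ (n + 1) * S * (12 * real n * r) ^ (n - 1)"
    have Y: "Y > 0" unfolding Y_def using n S r by (intro mult_pos_pos zero_less_power) auto
    have X: "emeasure lborel {x\<in>E. x + z \<in> - E} \<le> ennreal (N' * Y)" if z: "z \<in> cube S" for z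
    proof -
      have "emeasure lborel {x\<in>E. x + z \<in> - E} \<le> (\<Sum>m. if U m = {} then 0
         else ennreal (real DIM('a) * 2 ^ (DIM('a) + 1) * S * diameter (U m) ^ (DIM('a) - 1)))"
      proof (rule emeasure_axis_path_meets_le[OF e])
        fix y assume "y \<in> {x\<in>E. x + z \<in> - E}"
        then have "axis_path_meets e z (frontier E) y" by (intro axis_path_meets_frontier[OF e]) auto
        moreover have "frontier E \<subseteq> (\<Union>m. U m)" using cov by (fastforce simp: U_def)
        ultimately show "axis_path_meets e z (\<Union>m. U m) y" unfolding axis_path_meets_def by blast
      qed (use cz[OF z] dU S in \<open>auto simp: U_def\<close>)
      also have "\<dots> = (\<Sum>m. if m < N' then ennreal Y else 0)"
      proof (intro suminf_cong)
        fix m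
        show "(if U m = {} then 0 else ennreal (real DIM('a) * 2 ^ (DIM('a) + 1) * S * diameter (U m) ^ (DIM('a) - 1)))
          = (if m < N' then ennreal Y else 0)"
        proof (cases "m < N'")
          case True
          then have "U m \<noteq> {}" using r n by (auto simp: U_def mult_less_0_iff)
          then show ?thesis unfolding n_def[symmetric] dU Y_def using True by simp
        qed (simp add: U_def)
      qed
      also have "\<dots> = (\<Sum>m<N'. ennreal Y)"
        by (subst suminf_finite[of "{..<N'}"]) auto
      also have "\<dots> = ennreal (N' * Y)"
        using Y by (simp add: ennreal_of_nat_eq_real_of_nat ennreal_mult)
      finally show ?thesis .
    qed
    have "ennreal (2 * V) * ennreal (V / 2) \<le> ennreal (2 * V) * emeasure lborel E"
      by (intro mult_left_mono EV) simp
    also have "\<dots> = (\<integral>\<^sup>+x. ennreal (2 * V) * indicator E x \<partial>lborel)"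
      by (simp add: nn_integral_cmult_indicator)
    also have "\<dots> \<le> (\<integral>\<^sup>+x. emeasure lborel {z\<in>cube S. x + z \<in> - E} * indicator E x \<partial>lborel)"
    proof (intro nn_integral_mono)
      fix x
      have "ennreal (2 * V) \<le> emeasure lborel {z\<in>cube S. x + z \<in> - E}"
      proof -
        \<comment> \<open>The value \<open>S ^ n = 4 * V\<close> is twice the upper bound for the
          volume of \<open>E\<close>, so at least half of the translations in \<open>cube S\<close>
          lead out of \<open>E\<close>.\<close>
        have "ennreal (2 * V) + ennreal (2 * V) = emeasure lborel (cube S)"
          using ecube[OF S(1)] S(2) V(2) by (simp add: ennreal_plus[symmetric] del: ennreal_plus)
        also have "\<dots> \<le> emeasure lborel ({z\<in>cube S. x + z \<in> - E} \<union> {z. x + z \<in> E})"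
          by (intro emeasure_mono) auto
        also have "\<dots> \<le> emeasure lborel {z\<in>cube S. x + z \<in> - E} + emeasure lborel {z. x + z \<in> E}"
          by (intro emeasure_subadditive) auto
        also have "\<dots> \<le> emeasure lborel {z\<in>cube S. x + z \<in> - E} + ennreal (2 * V)"
          using EV2 by (subst emeasure_lborel_translate) (auto intro: add_left_mono)
        finally show ?thesis by (simp add: ennreal_add_left_cancel_le add.commute)
      qed
      then show "ennreal (2 * V) * indicator E x \<le> emeasure lborel {z\<in>cube S. x + z \<in> - E} * indicator E x"
        by (intro mult_right_mono) auto
    qed
    also have "\<dots> = (\<integral>\<^sup>+z. emeasure lborel {x\<in>E. x + z \<in> - E} * indicator (cube S) z \<partial>lborel)"
      by (rule nn_integral_translates_swap[symmetric]) auto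
    also have "\<dots> \<le> (\<integral>\<^sup>+z. ennreal (N' * Y) * indicator (cube S) z \<partial>lborel)"
      using X by (intro nn_integral_mono) (auto simp: indicator_def)
    also have "\<dots> = ennreal (N' * Y) * ennreal (S ^ n)"
      using ecube[OF S(1)] by (simp add: nn_integral_cmult_indicator)
    finally have "ennreal (2 * V) * ennreal (V / 2) \<le> ennreal (N' * Y) * ennreal (S ^ n)" .
    moreover have "ennreal (2 * V) * ennreal (V / 2) = ennreal (2 * V * (V / 2))"
      using V(2) by (intro ennreal_mult[symmetric]) auto
    moreover have "ennreal (N' * Y) * ennreal (S ^ n) = ennreal (N' * Y * S ^ n)"
      using Y S(1) by (intro ennreal_mult[symmetric]) auto
    ultimately have "ennreal (2 * V * (V / 2)) \<le> ennreal (N' * Y * S ^ n)" by metis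
    then have "2 * V * (V / 2) \<le> N' * Y * S ^ n"
      using Y S V(2) by (subst (asm) ennreal_le_iff) auto
    then have "V * V \<le> (4 * (N' * Y)) * V" by (simp add: S(2) mult_ac)
    then have "V \<le> 4 * (N' * Y)" using V(2) by simp
    also have "\<dots> < 4 * (N * Y)" using N' Y by simp
    also have "\<dots> \<le> V" using N by (simp add: Y_def)
    finally show False by simp
  qed
  have "\<exists>x. \<forall>i<N. x i \<in> frontier E \<and> (\<forall>j<i. 6 * real n * r < dist (x j) (x i))"
    by (rule greedy_separated) (rule nocover)
  then obtain x where x: "\<And>i. i < N \<Longrightarrow> x i \<in> frontier E"
    "\<And>i j. i < N \<Longrightarrow> j < i \<Longrightarrow> 6 * real n * r < dist (x j) (x i)" by metis
  show ?thesis
    by (intro exI[of _ x] allI impI conjI rich x)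
qed

subsection \<open>The two estimates and their interpolation\<close>

lemma measure_boundary_measure_singleton:
  fixes \<Omega> :: "'a::euclidean_space set"
  assumes "DIM('a) \<ge> 2" "measure (boundary_measure \<Omega>) (frontier \<Omega>) > 0" "y \<in> frontier \<Omega>"
  shows "measure (boundary_measure \<Omega>) {y} = 0"
  using boundary_measure_nonzero(2)[OF assms(2), of "{y}"] assms hausdorff_outer_singleton[of "DIM('a) - 1" y]
  by (simp add: measure_def)

text \<open>With \<open>\<tau> = 1 / \<rho>\<^sup>2\<close> the constant part of the energy is
  \<open>k * \<rho> ^ (n - 2)\<close>. Each of the at most \<open>2 * k\<close> balls of radius
  below \<open>\<rho>\<close> adds a multiple of \<open>r ^ (n - 2) \<le> \<rho> ^ (n - 2)\<close>,
  so both parts have the same order.\<close>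

lemma steklov_eigenvalue_le_volume_over_area:
  assumes dim: "DIM('a::euclidean_space) \<ge> 2"
  shows "\<exists>C>0. \<forall>(\<Omega> :: 'a set) k \<rho>. open \<Omega> \<longrightarrow> bounded \<Omega> \<longrightarrow> k \<ge> 1 \<longrightarrow>
    measure (boundary_measure \<Omega>) (frontier \<Omega>) > 0 \<longrightarrow> \<rho> > 0 \<longrightarrow> measure lebesgue \<Omega> = k * \<rho> ^ DIM('a) \<longrightarrow>
    steklov_eigenvalue \<Omega> k \<le> ennreal (C * k * \<rho> ^ (DIM('a) - 2) / measure (boundary_measure \<Omega>) (frontier \<Omega>))"
proof -
  define n where "n = DIM('a)"
  have n2: "n \<ge> 2" using dim by (simp add: n_def)
  obtain T where T: "finite T" "cball (0::'a) 2 \<subseteq> (\<Union>p\<in>T. cball p (1/2))"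
    using finite_half_ball_cover by blast
  have "T \<noteq> {}" using T(2) by auto
  then have cT: "card T > 0" using T(1) by (simp add: card_gt_0_iff)
  define \<omega> where "\<omega> = unit_ball_vol (real n)"
  have \<omega>: "\<omega> > 0" by (simp add: \<omega>_def)
  define A where "A = 1 + 2 * \<omega> * 2 ^ n"
  have A: "A > 0" unfolding A_def using \<omega> by (intro add_pos_nonneg) auto
  define C where "C = 2304 * A * 2 * card T"
  have C: "C > 0" using A cT by (simp add: C_def)
  have "steklov_eigenvalue \<Omega> k \<le> ennreal (C * k * \<rho> ^ (n - 2) / M)"
    if \<Omega>: "open \<Omega>" "bounded \<Omega>" and k: "k \<ge> 1" and M: "M = measure (boundary_measure \<Omega>) (frontier \<Omega>)" "M > 0"
      and \<rho>: "\<rho> > 0" "measure lebesgue \<Omega> = k * \<rho> ^ n" for \<Omega> :: "'a set" and k :: nat and \<rho> M :: real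
  proof -
    have Mp: "measure (boundary_measure \<Omega>) (frontier \<Omega>) > 0" using M by simp
    have fin: "finite_measure (boundary_measure \<Omega>)" using boundary_measure_nonzero(1)[OF Mp] .
    \<comment> \<open>The boundary measure extended by zero to the Borel sets of the whole space, as
      the selection of balls requires.\<close>
    define N where "N = distr (boundary_measure \<Omega>) borel (\<lambda>x. x)"
    have meas: "(\<lambda>x. x) \<in> measurable (boundary_measure \<Omega>) borel"
      by (rule measurableI) (auto simp: sets_boundary_measure Int_commute)
    have finN: "finite_measure N"
      unfolding N_def by (rule finite_measure.finite_measure_distr[OF fin meas])
    have sN: "sets N = sets borel" by (simp add: N_def)
    have eN: "emeasure N A = emeasure (boundary_measure \<Omega>) (frontier \<Omega> \<inter> A)" if "A \<in> sets borel" for A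
      unfolding N_def using that by (subst emeasure_distr[OF meas]) (auto simp: sets_boundary_measure Int_commute)
    have mN: "measure N A = measure (boundary_measure \<Omega>) (frontier \<Omega> \<inter> A)" if "A \<in> sets borel" for A
      using eN[OF that] by (simp add: measure_def)
    have F: "compact (frontier \<Omega>)" using \<Omega> by (simp add: compact_frontier_bounded)
    have null: "measure N (- frontier \<Omega>) = 0"
      using F by (subst mN) (auto intro!: borel_comp borel_compact)
    have atom: "measure N {y} = 0" for y
      using measure_boundary_measure_singleton[OF dim Mp, of y]
      by (cases "y \<in> frontier \<Omega>") (simp_all add: mN)
    \<comment> \<open>Each of the \<open>2 * k\<close> selections may consume mass
      \<open>card T * v\<close>, so this value exhausts \<open>M\<close> exactly.\<close>
    define v where "v = M / (2 * k * card T)"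
    have v: "v > 0" using M k cT by (simp add: v_def)
    have "real (2 * k) * card T * v \<le> measure N UNIV"
      using k cT M(1) by (simp add: v_def mN)
    from ball_selection[OF finN sN F null atom v T this]
    obtain x r where xr: "\<And>i. i < 2 * k \<Longrightarrow> r i > 0"
      "\<And>i. i < 2 * k \<Longrightarrow> v \<le> measure N (cball (x i) (r i) - (\<Union>j<i. cball (x j) (2 * r j)))" by blast
    define \<tau> where "\<tau> = 1 / \<rho>\<^sup>2"
    define J where "J = {j. j < 2 * k \<and> \<tau> < 1 / (r j)\<^sup>2}"
    have rn: "t ^ n / t\<^sup>2 = t ^ (n - 2)" if "t > 0" for t :: real
      using that n2 by (simp add: power_diff)
    have "(\<Sum>j\<in>J. measure lborel (cball (x j) (2 * r j)) / (r j)\<^sup>2) \<le> (\<Sum>j\<in>J. \<omega> * 2 ^ n * \<rho> ^ (n - 2))"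
    proof (intro sum_mono)
      fix j assume j: "j \<in> J"
      then have r: "r j > 0" using xr(1) by (simp add: J_def)
      have "(r j)\<^sup>2 < \<rho>\<^sup>2" using j r \<rho>(1) by (simp add: J_def \<tau>_def field_simps)
      then have rl: "r j \<le> \<rho>" using r \<rho>(1) by (simp add: power2_less_imp_less less_imp_le)
      have "measure lborel (cball (x j) (2 * r j)) / (r j)\<^sup>2 = \<omega> * 2 ^ n * ((r j) ^ n / (r j)\<^sup>2)"
        using r by (simp add: content_cball \<omega>_def n_def power_mult_distrib)
      also have "\<dots> = \<omega> * 2 ^ n * (r j) ^ (n - 2)" by (simp only: rn[OF r])
      also have "\<dots> \<le> \<omega> * 2 ^ n * \<rho> ^ (n - 2)"
        using rl r \<omega> by (intro mult_left_mono power_mono) auto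
      finally show "measure lborel (cball (x j) (2 * r j)) / (r j)\<^sup>2 \<le> \<omega> * 2 ^ n * \<rho> ^ (n - 2)" .
    qed
    also have "\<dots> = real (card J) * (\<omega> * 2 ^ n * \<rho> ^ (n - 2))" by simp
    also have "\<dots> \<le> real (2 * k) * (\<omega> * 2 ^ n * \<rho> ^ (n - 2))"
    proof (intro mult_right_mono)
      have "card J \<le> card {..<2 * k}" by (intro card_mono) (auto simp: J_def)
      then show "real (card J) \<le> real (2 * k)" by simp
    qed (use \<omega> \<rho> in simp)
    finally have sumJ: "(\<Sum>j\<in>J. measure lborel (cball (x j) (2 * r j)) / (r j)\<^sup>2)
      \<le> real (2 * k) * (\<omega> * 2 ^ n * \<rho> ^ (n - 2))" .
    have "\<tau> * measure lebesgue \<Omega> = k * (\<rho> ^ n / \<rho>\<^sup>2)" by (simp add: \<tau>_def \<rho>(2))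
    also have "\<dots> = k * \<rho> ^ (n - 2)" by (simp only: rn[OF \<rho>(1)])
    finally have E: "\<tau> * measure lebesgue \<Omega> + (\<Sum>j\<in>J. measure lborel (cball (x j) (2 * r j)) / (r j)\<^sup>2)
      \<le> A * k * \<rho> ^ (n - 2)" using sumJ by (simp add: A_def algebra_simps)
    have "\<tau> \<ge> 0" by (simp add: \<tau>_def)
    have "steklov_eigenvalue \<Omega> k \<le> ennreal (2304 * (A * k * \<rho> ^ (n - 2)) / (k * v))"
    proof (rule steklov_eigenvalue_le_balls[OF \<Omega> fin k xr(1) v _ \<open>\<tau> \<ge> 0\<close> E[unfolded J_def]])
      fix i assume i: "i < 2 * k"
      let ?S = "cball (x i) (r i) - (\<Union>j<i. cball (x j) (2 * r j))"
      have S: "?S \<in> sets borel" by (intro sets.Diff sets.countable_UN) auto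
      interpret N: finite_measure N by (rule finN)
      have "ennreal v \<le> emeasure N ?S" using xr(2)[OF i] by (simp add: N.emeasure_eq_measure ennreal_leI)
      then show "ennreal v \<le> emeasure (boundary_measure \<Omega>) (frontier \<Omega> \<inter> ?S)" using eN[OF S] by simp
    qed
    also have "2304 * (A * k * \<rho> ^ (n - 2)) / (k * v) = C * k * \<rho> ^ (n - 2) / M"
      using k M(2) cT by (simp add: v_def C_def field_simps)
    finally show ?thesis .
  qed
  then show ?thesis using C unfolding n_def by (intro exI[of _ C]) simp
qed

text \<open>All balls have the same radius \<open>R = 2 * n * r\<close>. The total energy is of
  order \<open>k * r ^ (n - 2)\<close> and each boundary mass at least of order
  \<open>r ^ (n - 1)\<close>, which leaves \<open>1 / r\<close>.\<close>

lemma steklov_eigenvalue_le_scale: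
  assumes dim: "DIM('a::euclidean_space) \<ge> 2"
  defines "n \<equiv> DIM('a)" and "K \<equiv> projection_const TYPE('a)"
  shows "\<exists>C>0. \<forall>(\<Omega> :: 'a set) k r S. open \<Omega> \<longrightarrow> bounded \<Omega> \<longrightarrow> k \<ge> 1 \<longrightarrow>
    measure lebesgue \<Omega> > 0 \<longrightarrow> measure (boundary_measure \<Omega>) (frontier \<Omega>) > 0 \<longrightarrow> r > 0 \<longrightarrow>
    4 * K * r * measure (boundary_measure \<Omega>) (frontier \<Omega>) \<le> measure lebesgue \<Omega> \<longrightarrow>
    S > 0 \<longrightarrow> S ^ n = 4 * measure lebesgue \<Omega> \<longrightarrow> 12 * real n * r \<le> S \<longrightarrow>
    4 * (real (2 * k) * (real n * 2 ^ (n + 1) * S * (12 * real n * r) ^ (n - 1))) \<le> measure lebesgue \<Omega> \<longrightarrow>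
    steklov_eigenvalue \<Omega> k \<le> ennreal (C / r)"
proof -
  have n2: "n \<ge> 2" using dim by (simp add: n_def)
  have K: "K > 0" unfolding K_def by (rule projection_const_pos)
  define \<omega> where "\<omega> = unit_ball_vol (real n)"
  have \<omega>: "\<omega> > 0" by (simp add: \<omega>_def)
  define c where "c = 1 / (12 * 6 ^ n * K)"
  have c: "c > 0" using K by (simp add: c_def)
  define C where "C = 2304 * (2 * \<omega> * 2 ^ n * (2 * n) ^ (n - 2)) / c"
  have C: "C > 0" unfolding C_def using \<omega> c n2 by (intro divide_pos_pos mult_pos_pos zero_less_power) auto
  have "steklov_eigenvalue \<Omega> k \<le> ennreal (C / r)"
    if \<Omega>: "open \<Omega>" "bounded \<Omega>" and k: "k \<ge> 1" and V: "measure lebesgue \<Omega> > 0"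
      and M: "measure (boundary_measure \<Omega>) (frontier \<Omega>) > 0" and r: "r > 0"
      "4 * K * r * measure (boundary_measure \<Omega>) (frontier \<Omega>) \<le> measure lebesgue \<Omega>"
      and S: "S > 0" "S ^ n = 4 * measure lebesgue \<Omega>" "12 * real n * r \<le> S"
      "4 * (real (2 * k) * (real n * 2 ^ (n + 1) * S * (12 * real n * r) ^ (n - 1))) \<le> measure lebesgue \<Omega>"
    for \<Omega> :: "'a set" and k :: nat and r S :: real
  proof -
    have fin: "finite_measure (boundary_measure \<Omega>)" using boundary_measure_nonzero(1)[OF M] .
    have eH: "emeasure (boundary_measure \<Omega>) A = hausdorff_outer (n - 1) A" if "A \<in> sets borel" "A \<subseteq> frontier \<Omega>" for A
      using boundary_measure_nonzero(2)[OF M that] by (simp add: n_def)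
    have fb: "frontier \<Omega> \<in> sets borel" by (simp add: borel_closed)
    have \<Omega>b: "\<Omega> \<in> sets borel" using \<Omega> by simp
    have eV: "emeasure lborel \<Omega> = ennreal (measure lebesgue \<Omega>)"
    proof -
      have "emeasure lborel \<Omega> \<noteq> top" using emeasure_bounded_finite[OF \<Omega>(2)] by (auto simp: less_top)
      from emeasure_eq_ennreal_measure[OF this] show ?thesis using \<Omega>b by simp
    qed
    have eM: "hausdorff_outer (n - 1) (frontier \<Omega>) \<le> ennreal (measure (boundary_measure \<Omega>) (frontier \<Omega>))"
      using eH[OF fb] finite_measure.emeasure_eq_measure[OF fin] by simp
    define R where "R = 2 * real n * r"
    have R: "R > 0" using n2 r by (simp add: R_def)
    have "\<exists>x. \<forall>i<2*k. ennreal (r ^ (n - 1) / (12 * 6 ^ n * K))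
      \<le> hausdorff_outer (n - 1) (frontier \<Omega> \<inter> cball (x i) (2 * real n * r))
      \<and> (\<forall>j<i. 6 * real n * r < dist (x j) (x i))"
      unfolding n_def K_def
      by (rule separated_boundary_balls[OF \<Omega>b eV V eM[unfolded n_def] _ r[unfolded K_def] S[unfolded n_def]]) simp
    then obtain x where x: "\<And>i. i < 2 * k \<Longrightarrow> ennreal (c * r ^ (n - 1)) \<le> hausdorff_outer (n - 1) (frontier \<Omega> \<inter> cball (x i) R)"
      "\<And>i j. i < 2 * k \<Longrightarrow> j < i \<Longrightarrow> 3 * R < dist (x j) (x i)"
      unfolding R_def c_def by (auto simp: mult.assoc)
    have "steklov_eigenvalue \<Omega> k \<le> ennreal (2304 * (2 * k * (\<omega> * 2 ^ n * R ^ (n - 2))) / (k * (c * r ^ (n - 1))))"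
    \<comment> \<open>With \<open>\<tau> = 0\<close> every ball counts as small and the volume of
      \<open>\<Omega>\<close> drops out of the energy.\<close>
    proof (rule steklov_eigenvalue_le_balls[OF \<Omega> fin k, where r = "\<lambda>_. R" and x = x and \<tau> = 0])
      show "c * r ^ (n - 1) > 0" using c r by simp
    next
      fix i assume i: "i < 2 * k"
      \<comment> \<open>The centres are more than \<open>3 * R\<close> apart, so deleting the
        doubled balls removes nothing.\<close>
      have "cball (x i) R - (\<Union>j<i. cball (x j) (2 * R)) = cball (x i) R"
      proof -
        have "y \<notin> cball (x j) (2 * R)" if "j < i" "y \<in> cball (x i) R" for j y
          using x(2)[OF i that(1)] that(2) dist_triangle2[of "x j" "x i" y] by (auto simp: dist_commute)
        then show ?thesis by blast
      qed
      then show "ennreal (c * r ^ (n - 1)) \<le> emeasure (boundary_measure \<Omega>)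
        (frontier \<Omega> \<inter> (cball (x i) R - (\<Union>j<i. cball (x j) (2 * R))))"
        using x(1)[OF i] eH[of "frontier \<Omega> \<inter> cball (x i) R"] fb by simp
    next
      have e: "measure lborel (cball (x j) (2 * R)) / R\<^sup>2 = \<omega> * 2 ^ n * R ^ (n - 2)" for j
      proof -
        have "R ^ n / R\<^sup>2 = R ^ (n - 2)" using n2 R by (simp add: power_diff)
        moreover have "measure lborel (cball (x j) (2 * R)) / R\<^sup>2 = \<omega> * 2 ^ n * (R ^ n / R\<^sup>2)"
          using R by (simp add: content_cball \<omega>_def n_def power_mult_distrib)
        ultimately show ?thesis by simp
      qed
      have "{j. j < 2 * k \<and> 0 < 1 / R\<^sup>2} = {..<2 * k}" using R by auto
      then show "0 * measure lebesgue \<Omega> + (\<Sum>j\<in>{j. j < 2 * k \<and> 0 < 1 / R\<^sup>2}. measure lborel (cball (x j) (2 * R)) / R\<^sup>2)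
        \<le> 2 * k * (\<omega> * 2 ^ n * R ^ (n - 2))"
        unfolding e by simp
    qed (use R in auto)
    also have "2304 * (2 * k * (\<omega> * 2 ^ n * R ^ (n - 2))) / (k * (c * r ^ (n - 1))) = C / r"
    proof -
      have rn: "r ^ (n - 1) = r * r ^ (n - 2)" using n2 by (metis Suc_diff_Suc Suc_1 Suc_le_lessD power_Suc diff_Suc_1 numeral_2_eq_2 One_nat_def)
      show ?thesis using k c r unfolding C_def R_def rn by (simp add: power_mult_distrib field_simps)
    qed
    finally show ?thesis .
  qed
  then show ?thesis using C by (intro exI[of _ C]) simp
qed

section \<open>Arithmetic of the exponents\<close>

lemma interpolation_small_area:
  fixes L M n \<kappa> C c :: real
  assumes n: "n \<ge> 2" and k: "k \<ge> (1::real)" and L: "L > 0" and M: "M > 0" and c: "c > 0" and C: "C > 0"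
    and le: "M \<le> k powr ((n - 2) / (n * (n - 1))) * L powr (n - 1)"
  shows "M powr (1 / (n - 1)) * (C / (c * L / k powr (1 / (n - 1))))
    \<le> (C / c) * k powr (1 / (n - 1) + (n - 2) / (n * (n - 1)\<^sup>2))"
proof -
  define a where "a = (n - 2) / (n * (n - 1)\<^sup>2)"
  \<comment> \<open>Taking the root of the area bound leaves exactly one factor \<open>L\<close>,
    which cancels against the radius \<open>c * L / k powr (1 / (n - 1))\<close>.\<close>
  have "M powr (1 / (n - 1)) \<le> (k powr ((n - 2) / (n * (n - 1))) * L powr (n - 1)) powr (1 / (n - 1))"
    using le M n by (intro powr_mono2) auto
  also have "\<dots> = k powr a * L"
    using n L k by (simp add: powr_mult powr_powr a_def power2_eq_square mult.assoc)
  finally have "M powr (1 / (n - 1)) * (C / (c * L / k powr (1 / (n - 1))))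
    \<le> (k powr a * L) * (C / (c * L / k powr (1 / (n - 1))))"
    using C c L by (intro mult_right_mono) auto
  also have "\<dots> = (C / c) * (k powr (1 / (n - 1)) * k powr a)" using L c by (simp add: field_simps)
  also have "\<dots> = (C / c) * k powr (1 / (n - 1) + a)" by (simp only: powr_add)
  finally show ?thesis by (simp only: a_def)
qed

text \<open>The total exponent of \<open>M\<close> is \<open>1 / (n - 1) - 1 = - q \<le> 0\<close>,
  so the threshold is the worst case. There the powers of \<open>L\<close> cancel and only the power
  of \<open>k\<close> remains.\<close>

lemma interpolation_large_area:
  fixes L M n C :: real
  assumes n: "n \<ge> 2" and k: "k \<ge> (1::real)" and L: "L > 0" and C: "C > 0"
    and ge: "k powr ((n - 2) / (n * (n - 1))) * L powr (n - 1) \<le> M"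
  shows "M powr (1 / (n - 1)) * (C * k * (L * k powr (- 1 / n)) powr (n - 2) / M)
    \<le> C * k powr (1 / (n - 1) + (n - 2) / (n * (n - 1)\<^sup>2))"
proof -
  define q where "q = (n - 2) / (n - 1)"
  define D where "D = k powr ((n - 2) / (n * (n - 1))) * L powr (n - 1)"
  have D: "D > 0" using k L by (simp add: D_def)
  then have M: "M > 0" using ge by (simp add: D_def)
  have "1 / (n - 1) - 1 = - q" using n by (simp add: q_def field_simps)
  then have "M powr (1 / (n - 1)) / M = M powr (- q)"
    using M powr_diff[of M "1 / (n - 1)" 1] by simp
  also have "\<dots> \<le> D powr (- q)"
    using ge D n by (intro powr_mono2') (auto simp: D_def q_def)
  also have "\<dots> = k powr ((n - 2) / (n * (n - 1)) * (- q)) * L powr ((n - 1) * (- q))"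
    using k L by (simp add: D_def powr_mult powr_powr)
  also have "(n - 1) * (- q) = - (n - 2)" using n by (simp add: q_def)
  finally have 1: "M powr (1 / (n - 1)) / M \<le> k powr ((n - 2) / (n * (n - 1)) * (- q)) * L powr (- (n - 2))" .
  have "M powr (1 / (n - 1)) * (C * k * (L * k powr (- 1 / n)) powr (n - 2) / M)
    = C * k * (L powr (n - 2) * k powr (- 1 / n * (n - 2))) * (M powr (1 / (n - 1)) / M)"
    using k L by (simp add: powr_mult powr_powr)
  also have "\<dots> \<le> C * k * (L powr (n - 2) * k powr (- 1 / n * (n - 2)))
      * (k powr ((n - 2) / (n * (n - 1)) * (- q)) * L powr (- (n - 2)))"
    using C k by (intro mult_left_mono 1) auto
  also have "\<dots> = C * (k powr 1 * k powr (- 1 / n * (n - 2)) * k powr ((n - 2) / (n * (n - 1)) * (- q)))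
      * (L powr (n - 2) * L powr (- (n - 2)))"
    using k by simp
  also have "L powr (n - 2) * L powr (- (n - 2)) = 1" using L by (simp flip: powr_add)
  also have "k powr 1 * k powr (- 1 / n * (n - 2)) * k powr ((n - 2) / (n * (n - 1)) * (- q))
    = k powr (1 + (- 1 / n * (n - 2)) + (n - 2) / (n * (n - 1)) * (- q))"
    by (simp only: powr_add)
  also have "1 + (- 1 / n * (n - 2)) + (n - 2) / (n * (n - 1)) * (- q) = 1 / (n - 1) + (n - 2) / (n * (n - 1)\<^sup>2)"
  proof -
    define m where "m = n - 1"
    have m: "m > 0" "n = m + 1" using n by (auto simp: m_def)
    show ?thesis unfolding q_def m(2) using m(1)
      by (simp add: divide_simps power2_eq_square) (simp add: algebra_simps)
  qed
  finally show ?thesis by simp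
qed

text \<open>The estimate by scale is used when the area is at most
  \<open>k powr ((n - 2) / (n * (n - 1))) * L powr (n - 1)\<close>, the estimate by volume over area
  otherwise; both give the same power of \<open>k\<close>.\<close>

lemma steklov_eigenvalue_bound:
  assumes dim: "DIM('a::euclidean_space) \<ge> 2"
  defines "n \<equiv> real DIM('a)"
  shows "\<exists>C>0. \<forall>(\<Omega> :: 'a set) (k :: nat). open \<Omega> \<longrightarrow> bounded \<Omega> \<longrightarrow> \<Omega> \<noteq> {} \<longrightarrow> k \<ge> 1 \<longrightarrow>
    ennreal (measure (boundary_measure \<Omega>) (frontier \<Omega>) powr (1 / (n - 1))) * steklov_eigenvalue \<Omega> k
      \<le> ennreal (C * real k powr (1 / (n - 1) + (n - 2) / (n * (n - 1)\<^sup>2)))"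
proof -
  define d where "d = DIM('a)"
  have d2: "d \<ge> 2" using dim by (simp add: d_def)
  have n: "n = real d" "n \<ge> 2" using d2 by (simp_all add: n_def d_def)
  define K where "K = projection_const TYPE('a)"
  have K: "K > 0" unfolding K_def by (rule projection_const_pos)
  obtain C1 where C1: "C1 > 0" "\<And>(\<Omega> :: 'a set) k \<rho>. open \<Omega> \<Longrightarrow> bounded \<Omega> \<Longrightarrow> k \<ge> 1 \<Longrightarrow>
    measure (boundary_measure \<Omega>) (frontier \<Omega>) > 0 \<Longrightarrow> \<rho> > 0 \<Longrightarrow> measure lebesgue \<Omega> = k * \<rho> ^ d \<Longrightarrow>
    steklov_eigenvalue \<Omega> k \<le> ennreal (C1 * k * \<rho> ^ (d - 2) / measure (boundary_measure \<Omega>) (frontier \<Omega>))"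
    using steklov_eigenvalue_le_volume_over_area[OF dim] unfolding d_def by metis
  obtain C2 where C2: "C2 > 0" "\<And>(\<Omega> :: 'a set) k r S. open \<Omega> \<Longrightarrow> bounded \<Omega> \<Longrightarrow> k \<ge> 1 \<Longrightarrow>
    measure lebesgue \<Omega> > 0 \<Longrightarrow> measure (boundary_measure \<Omega>) (frontier \<Omega>) > 0 \<Longrightarrow> r > 0 \<Longrightarrow>
    4 * K * r * measure (boundary_measure \<Omega>) (frontier \<Omega>) \<le> measure lebesgue \<Omega> \<Longrightarrow>
    S > 0 \<Longrightarrow> S ^ d = 4 * measure lebesgue \<Omega> \<Longrightarrow> 12 * real d * r \<le> S \<Longrightarrow>
    4 * (real (2 * k) * (real d * 2 ^ (d + 1) * S * (12 * real d * r) ^ (d - 1))) \<le> measure lebesgue \<Omega> \<Longrightarrow>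
    steklov_eigenvalue \<Omega> k \<le> ennreal (C2 / r)"
    using steklov_eigenvalue_le_scale[OF dim] unfolding d_def K_def by metis
  \<comment> \<open>The factor of the covering condition after inserting
    \<open>S \<le> 4 * L\<close>; the 32 is \<open>4 * 2 * 4\<close>.\<close>
  define B where "B = 32 * real d * 2 ^ (d + 1) * (12 * real d) ^ (d - 1)"
  have B: "B > 0" unfolding B_def using d2 by (intro mult_pos_pos zero_less_power) auto
  \<comment> \<open>Small enough for all conditions on the radius \<open>c * L / \<kappa>\<close> at
    once.\<close>
  define c where "c = 1 / (1 + 12 * real d + 4 * K + B)"
  have den: "1 + 12 * real d + 4 * K + B > 0" using K B by (simp add: add_pos_nonneg)
  have c: "c > 0" "c \<le> 1" "12 * real d * c \<le> 1" "4 * K * c \<le> 1" "B * c \<le> 1"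
    unfolding c_def using K B den by (auto simp: pos_divide_le_eq)
  define C where "C = C1 + C2 / c"
  have C: "C > 0" "C1 \<le> C" "C2 / c \<le> C" using C1(1) C2(1) c(1) by (simp_all add: C_def add_pos_pos)
  have "ennreal (M powr (1 / (n - 1))) * steklov_eigenvalue \<Omega> k
      \<le> ennreal (C * real k powr (1 / (n - 1) + (n - 2) / (n * (n - 1)\<^sup>2)))"
    if \<Omega>: "open \<Omega>" "bounded \<Omega>" "\<Omega> \<noteq> {}" and k: "k \<ge> 1"
      and M: "M = measure (boundary_measure \<Omega>) (frontier \<Omega>)" for \<Omega> :: "'a set" and k :: nat and M
  proof (cases "M = 0")
    \<comment> \<open>This includes infinite area, for which \<open>measure\<close> is zero by
      convention; the left side is then zero even if the eigenvalue is infinite.\<close>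
    case True
    then show ?thesis by simp
  next
    case False
    define e where "e = 1 / (n - 1) + (n - 2) / (n * (n - 1)\<^sup>2)"
    have M0: "M > 0" using False measure_nonneg[of "boundary_measure \<Omega>" "frontier \<Omega>"] M by linarith
    define V where "V = measure lebesgue \<Omega>"
    have V: "V > 0"
      using \<Omega> open_not_negligible[of \<Omega>] lmeasurable_open[of \<Omega>] zero_less_measure_iff[of lebesgue \<Omega>]
      by (auto simp: V_def negligible_iff_measure)
    define L where "L = V powr (1 / n)"
    have L: "L > 0" "L ^ d = V"
      using V n d2 by (simp_all add: L_def powr_realpow[symmetric] powr_powr)
    define \<kappa> where "\<kappa> = real k powr (1 / (n - 1))"
    have \<kappa>: "\<kappa> \<ge> 1" unfolding \<kappa>_def using k n by (intro ge_one_powr_ge_zero) auto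
    have n1: "real (d - 1) = n - 1" "real (d - 2) = n - 2" using n d2 by (simp_all add: of_nat_diff)
    have \<kappa>d: "\<kappa> ^ (d - 1) = k"
      using k n by (simp add: \<kappa>_def powr_realpow[symmetric] powr_powr n1)
    have Ld1: "L ^ (d - 1) = L powr (n - 1)" using powr_realpow[OF L(1), of "d - 1"] unfolding n1 by (rule sym)
    have conc: ?thesis if s: "steklov_eigenvalue \<Omega> k \<le> ennreal X" and X: "X \<ge> 0"
        "M powr (1 / (n - 1)) * X \<le> C' * real k powr e" "C' \<le> C" for X C'
    proof -
      have "ennreal (M powr (1 / (n - 1))) * steklov_eigenvalue \<Omega> k \<le> ennreal (M powr (1 / (n - 1))) * ennreal X"
        by (intro mult_left_mono s) simp
      also have "\<dots> = ennreal (M powr (1 / (n - 1)) * X)" using X by (simp add: ennreal_mult)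
      also have "M powr (1 / (n - 1)) * X \<le> C * real k powr e"
        using X(2) mult_right_mono[OF X(3), of "real k powr e"] by simp
      finally show ?thesis by (simp add: e_def ennreal_leI)
    qed
    show ?thesis
    proof (cases "M \<le> real k powr ((n - 2) / (n * (n - 1))) * L powr (n - 1)")
      case True
      define r where "r = c * L / \<kappa>"
      have r: "r > 0" using c L \<kappa> by (simp add: r_def)
      define S where "S = 4 powr (1 / n) * L"
      have S4: "4 powr (1 / n) \<le> (4::real)" "4 powr (1 / n) \<ge> (1::real)"
        using powr_mono[of "1 / n" 1 "4::real"] n ge_one_powr_ge_zero[of "4::real" "1 / n"] by auto
      have S: "S > 0" "S ^ d = 4 * V" "S \<le> 4 * L" "L \<le> S"
      proof -
        show "S > 0" using L by (simp add: S_def)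
        have "(4 powr (1 / n)) ^ d = (4::real)" using n d2 by (simp add: powr_realpow[symmetric] powr_powr)
        then show "S ^ d = 4 * V" by (simp add: S_def power_mult_distrib L)
        show "S \<le> 4 * L" "L \<le> S" using S4 L by (simp_all add: S_def)
      qed
      have LV: "V = L * L ^ (d - 1)" using L(2) d2 by (cases d) auto
      have s: "steklov_eigenvalue \<Omega> k \<le> ennreal (C2 / r)"
      proof (rule C2(2)[OF \<Omega>(1,2) k, where S = S])
        show "measure lebesgue \<Omega> > 0" using V by (simp add: V_def)
        show "measure (boundary_measure \<Omega>) (frontier \<Omega>) > 0" using M0 M by simp
        show "r > 0" "S > 0" by fact+
        show "S ^ d = 4 * measure lebesgue \<Omega>" using S by (simp add: V_def)
        have rcL: "r \<le> c * L" using divide_left_mono[of 1 \<kappa> "c * L"] c L \<kappa> by (simp add: r_def)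
        have "12 * real d * r \<le> 12 * real d * (c * L)" using rcL by (intro mult_left_mono) auto
        also have "\<dots> = (12 * real d * c) * L" by simp
        also have "\<dots> \<le> 1 * L" using c L by (intro mult_right_mono) auto
        finally show "12 * real d * r \<le> S" using S by simp
        \<comment> \<open>Since \<open>(n - 2) / n \<le> 1\<close>, the threshold lies below
          \<open>\<kappa> * L ^ (d - 1)\<close>. This is what \<open>r * M \<le> c * V\<close>
          requires, as the factor \<open>\<kappa>\<close> cancels in \<open>r\<close>.\<close>
        have "real k powr ((n - 2) / (n * (n - 1))) \<le> \<kappa>"
          unfolding \<kappa>_def using k n by (intro powr_mono) (auto simp: field_simps)
        then have "real k powr ((n - 2) / (n * (n - 1))) * L powr (n - 1) \<le> \<kappa> * L powr (n - 1)"
          by (intro mult_right_mono) auto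
        then have "M \<le> \<kappa> * L ^ (d - 1)" unfolding Ld1 using True by linarith
        then have "4 * K * r * M \<le> 4 * K * r * (\<kappa> * L ^ (d - 1))" using K r by (intro mult_left_mono) auto
        also have "\<dots> = (4 * K * c) * V" using \<kappa> by (simp add: r_def LV)
        also have "\<dots> \<le> 1 * V" using c V by (intro mult_right_mono) auto
        finally show "4 * K * r * measure (boundary_measure \<Omega>) (frontier \<Omega>) \<le> measure lebesgue \<Omega>"
          by (simp add: M V_def)
        \<comment> \<open>By \<open>\<kappa> ^ (d - 1) = k\<close> the number of balls
          cancels.\<close>
        have "r ^ (d - 1) * k = c ^ (d - 1) * L ^ (d - 1)"
          using \<kappa> by (simp add: r_def power_divide power_mult_distrib \<kappa>d[symmetric])
        also have "\<dots> \<le> c * L ^ (d - 1)"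
          using c L d2 power_decreasing[of 1 "d - 1" c] by (intro mult_right_mono) auto
        finally have rk: "r ^ (d - 1) * k \<le> c * L ^ (d - 1)" .
        have Srk: "S * (r ^ (d - 1) * k) \<le> 4 * L * (c * L ^ (d - 1))"
          by (rule mult_mono[OF S(3) rk]) (use r L in simp_all)
        have "4 * (real (2 * k) * (real d * 2 ^ (d + 1) * S * (12 * real d * r) ^ (d - 1)))
          = (8 * real d * 2 ^ (d + 1) * (12 * real d) ^ (d - 1)) * (S * (r ^ (d - 1) * k))"
          by (simp add: power_mult_distrib)
        also have "\<dots> \<le> (8 * real d * 2 ^ (d + 1) * (12 * real d) ^ (d - 1)) * (4 * L * (c * L ^ (d - 1)))"
          by (intro mult_left_mono Srk) simp
        also have "\<dots> = (B * c) * V" by (simp add: B_def LV)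
        also have "\<dots> \<le> 1 * V" using c V by (intro mult_right_mono) auto
        finally show "4 * (real (2 * k) * (real d * 2 ^ (d + 1) * S * (12 * real d * r) ^ (d - 1))) \<le> measure lebesgue \<Omega>"
          by (simp add: V_def)
      qed
      have kr: "real k \<ge> 1" using k by simp
      show ?thesis
      proof (rule conc[OF s _ _ C(3)])
        show "C2 / r \<ge> 0" using C2(1) r by simp
        show "M powr (1 / (n - 1)) * (C2 / r) \<le> C2 / c * real k powr e"
          unfolding r_def \<kappa>_def e_def by (rule interpolation_small_area[OF n(2) kr L(1) M0 c(1) C2(1) True])
      qed
    next
      case False
      \<comment> \<open>The solution of \<open>V = k * \<rho> ^ d\<close>.\<close>
      define \<rho> where "\<rho> = L * real k powr (- 1 / n)"
      have \<rho>: "\<rho> > 0" using L k by (simp add: \<rho>_def)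
      have "(real k powr (- 1 / n)) ^ d = real k powr (- 1 / n * real d)"
        unfolding powr_powr[symmetric] using k by (intro powr_realpow[symmetric]) simp
      also have "- 1 / n * real d = - 1" using n d2 by simp
      also have "real k powr (- 1) = 1 / k" using k by (simp add: powr_minus_divide)
      finally have "(real k powr (- 1 / n)) ^ d = 1 / k" .
      then have "measure lebesgue \<Omega> = k * \<rho> ^ d"
        using k by (simp add: \<rho>_def power_mult_distrib L V_def)
      then have s: "steklov_eigenvalue \<Omega> k \<le> ennreal (C1 * k * \<rho> ^ (d - 2) / M)"
        using C1(2)[OF \<Omega>(1,2) k _ \<rho>] M0 M by simp
      have kr: "real k \<ge> 1" using k by simp
      have \<rho>p: "\<rho> ^ (d - 2) = \<rho> powr (n - 2)" using \<rho> by (simp add: powr_realpow[symmetric] n1)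
      have "M powr (1 / (n - 1)) * (C1 * k * \<rho> ^ (d - 2) / M) \<le> C1 * real k powr e"
        unfolding \<rho>p unfolding \<rho>_def e_def
        by (rule interpolation_large_area[OF n(2) kr L(1) C1(1)]) (use False in simp)
      then show ?thesis using conc[OF s _ _ C(2)] C1(1) \<rho> M0 by simp
    qed
  qed
  then show ?thesis using C(1) by (intro exI[of _ C]) simp
qed

theorem corollary1p4:
  fixes n :: real
  assumes "n = real CARD('n::finite)" and "CARD('n) \<ge> 2"
  shows "\<exists>C>0. \<forall>(\<Omega> :: (real ^ 'n) set) (k :: nat).
           smooth_bounded_domain \<Omega> \<longrightarrow> k \<ge> 1 \<longrightarrow>
           ennreal (measure (boundary_measure \<Omega>) (frontier \<Omega>) powr (1 / (n - 1)))
             * steklov_eigenvalue \<Omega> k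
           \<le> ennreal (C * real k powr (1 / (n - 1) + (n - 2) / (n * (n - 1)\<^sup>2)))"
proof -
  have dim: "DIM(real ^ 'n) \<ge> 2" and n: "real DIM(real ^ 'n) = n" using assms by simp_all
  obtain C where C: "C > 0" "\<And>(\<Omega> :: (real ^ 'n) set) (k :: nat). open \<Omega> \<Longrightarrow> bounded \<Omega> \<Longrightarrow> \<Omega> \<noteq> {} \<Longrightarrow> k \<ge> 1 \<Longrightarrow>
    ennreal (measure (boundary_measure \<Omega>) (frontier \<Omega>) powr (1 / (n - 1))) * steklov_eigenvalue \<Omega> k
      \<le> ennreal (C * real k powr (1 / (n - 1) + (n - 2) / (n * (n - 1)\<^sup>2)))"
    using steklov_eigenvalue_bound[OF dim] unfolding n by blast
  show ?thesis
    by (intro exI[of _ C] conjI allI impI C) (simp_all add: smooth_bounded_domain_def)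
qed

end
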